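(* Let $M^2$ be a Riemannian $2$-manifold with Gaussian curvature $K$ and let $u$ be harmonic in a domain $\Omega\Subset M^2$ such that $\overline{\Omega}$ does not contain critical points of $u$. Let $k$ be the curvature of the level curves of $u$ and $h$ the curvature of the curves of steepest descent of $u$. (1) Let $K\le 0$ and $\langle\nabla K,\nabla u\rangle\ge 0$. If the maximum of $|\nabla u|^{-1}k$ is non-negative, then it is attained on $\partial\Omega$. (2) Let $K\le 0$ and $\langle\nabla K,\nabla u\rangle\le 0$. If the minimum of $|\nabla u|^{-1}k$ is non-positive, then it is attained on $\partial\Omega$. (3) Let $K\ge 0$ and $\langle\nabla K,\nabla u\rangle\ge 0$. If the maximum of $|\nabla u|^{-1}k$ is non-positive, then it is attained on $\partial\Omega$. (4) Let $K\ge 0$ and $\langle\nabla K,\nabla u\rangle\le 0$. If the minimum of $|\nabla u|^{-1}k$ is non-negative, then it is attained on $\partial\Omega$. The same four conclusions hold with $|\nabla u|^{-1}h$ in place of $|\nabla u|^{-1}k$, provided that $\langle\nabla K,\nabla u\rangle$ is replaced by $\langle\nabla K,-\star\nabla u\rangle$ in the assumptions.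
   Context: The curvatures are defined by $$k:=-\operatorname{div}\left(\frac{\nabla u}{|\nabla u|}\right),\qquad h:=\operatorname{div}\left(\frac{\star\nabla u}{|\nabla u|}\right),$$ where $\star$ is the Hodge star operator acting on tangent vectors. In a local (oriented) orthonormal frame $\{e_1,e_2\}$, with $u_i=e_i(u)$, one has $\star\nabla u=(-u_2,u_1)$ and hence $h=-\operatorname{div}\left(\frac{(u_2,-u_1)}{|\nabla u|}\right)$. Harmonic refers to the Laplace--Beltrami operator. The sign conditions on $K$ and $\langle\nabla K,\cdot\rangle$ are on $\Omega$. Maxima and minima are over $\overline{\Omega}$, with $u$, $k$ and $h$ understood to be defined and continuous (and $\nabla u\ne 0$) up to $\overline{\Omega}$. *)

theory Defs
  imports "HOL-Analysis.Analysis"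
begin

definition pd :: "2 \<Rightarrow> (real^2 \<Rightarrow> real) \<Rightarrow> real^2 \<Rightarrow> real" where
  "pd i f x = frechet_derivative f (at x) (axis i 1)"

primrec Ck_on :: "nat \<Rightarrow> (real^2 \<Rightarrow> real) \<Rightarrow> (real^2) set \<Rightarrow> bool" where
  "Ck_on 0 f S \<longleftrightarrow> continuous_on S f"
| "Ck_on (Suc n) f S \<longleftrightarrow> (\<forall>x\<in>S. f differentiable (at x)) \<and> (\<forall>i. Ck_on n (pd i f) S)"

text \<open>Only meant for open \<open>S\<close>, since \<^const>\<open>pd\<close> uses the full derivative at each point.\<close>

definition smooth_on :: "(real^2 \<Rightarrow> real) \<Rightarrow> (real^2) set \<Rightarrow> bool" where
  "smooth_on f S \<longleftrightarrow> (\<forall>n. Ck_on n f S)"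

text \<open>Local expressions on a coordinate domain: here \<open>G x\<close> is the matrix of the metric in the
  coordinates \<open>x\<close>, and vectors are given by their contravariant components.\<close>

definition inner_loc :: "(real^2 \<Rightarrow> real^2^2) \<Rightarrow> real^2 \<Rightarrow> real^2 \<Rightarrow> real^2 \<Rightarrow> real" where
  "inner_loc G x v w = v \<bullet> (G x *v w)"

definition norm_loc :: "(real^2 \<Rightarrow> real^2^2) \<Rightarrow> real^2 \<Rightarrow> real^2 \<Rightarrow> real" where
  "norm_loc G x v = sqrt (inner_loc G x v v)"

definition grad_loc :: "(real^2 \<Rightarrow> real^2^2) \<Rightarrow> (real^2 \<Rightarrow> real) \<Rightarrow> real^2 \<Rightarrow> real^2" where
  "grad_loc G f x = matrix_inv (G x) *v (\<chi> j. pd j f x)"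

definition div_loc :: "(real^2 \<Rightarrow> real^2^2) \<Rightarrow> (real^2 \<Rightarrow> real^2) \<Rightarrow> real^2 \<Rightarrow> real" where
  "div_loc G X x = (\<Sum>i\<in>UNIV. pd i (\<lambda>y. sqrt (det (G y)) * X y $ i) x) / sqrt (det (G x))"

text \<open>The Hodge star on tangent vectors, i.e. the rotation by a right angle in the positive
  sense, for positively oriented coordinates. The lemma \<open>star_loc_frame\<close> below shows that
  it is \<open>(a, b) \<mapsto> (-b, a)\<close> with respect to every oriented orthonormal frame.\<close>

definition star_loc :: "(real^2 \<Rightarrow> real^2^2) \<Rightarrow> real^2 \<Rightarrow> real^2 \<Rightarrow> real^2" where
  "star_loc G x v = (1 / sqrt (det (G x))) *\<^sub>R vector [- (G x *v v) $ 2, (G x *v v) $ 1]"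

definition christoffel :: "(real^2 \<Rightarrow> real^2^2) \<Rightarrow> 2 \<Rightarrow> 2 \<Rightarrow> 2 \<Rightarrow> real^2 \<Rightarrow> real" where
  "christoffel G k i j x =
     (\<Sum>l\<in>UNIV. matrix_inv (G x) $ k $ l *
        (pd i (\<lambda>y. G y $ l $ j) x + pd j (\<lambda>y. G y $ l $ i) x - pd l (\<lambda>y. G y $ i $ j) x)) / 2"

text \<open>The component \<open>l\<close> of \<open>R(\<partial>\<^sub>i, \<partial>\<^sub>j) \<partial>\<^sub>k\<close>, where
  \<open>R(X, Y) Z = \<nabla>\<^sub>X \<nabla>\<^sub>Y Z - \<nabla>\<^sub>Y \<nabla>\<^sub>X Z - \<nabla>\<^sub>[\<^sub>X\<^sub>,\<^sub>Y\<^sub>] Z\<close>.\<close>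

definition riemann :: "(real^2 \<Rightarrow> real^2^2) \<Rightarrow> 2 \<Rightarrow> 2 \<Rightarrow> 2 \<Rightarrow> 2 \<Rightarrow> real^2 \<Rightarrow> real" where
  "riemann G l i j k x =
     pd i (christoffel G l j k) x - pd j (christoffel G l i k) x
     + (\<Sum>m\<in>UNIV. christoffel G m j k x * christoffel G l i m x
                - christoffel G m i k x * christoffel G l j m x)"

text \<open>The Gaussian curvature is \<open>\<langle>R(\<partial>\<^sub>1, \<partial>\<^sub>2) \<partial>\<^sub>2, \<partial>\<^sub>1\<rangle> / det G\<close>;
  round spheres have positive curvature.\<close>

definition gauss_loc :: "(real^2 \<Rightarrow> real^2^2) \<Rightarrow> real^2 \<Rightarrow> real" where
  "gauss_loc G x = inner_loc G x (\<chi> l. riemann G l 1 2 2 x) (axis 1 1) / det (G x)"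

lemma star_loc_frame:
  assumes sym: "transpose (G x) = G x"
    and on: "inner_loc G x e1 e1 = 1" "inner_loc G x e2 e2 = 1" "inner_loc G x e1 e2 = 0"
    and pos: "e1 $ 1 * e2 $ 2 - e1 $ 2 * e2 $ 1 > 0"
  shows "star_loc G x (a *\<^sub>R e1 + b *\<^sub>R e2) = (- b) *\<^sub>R e1 + a *\<^sub>R e2"
proof -
  define g11 g12 g22 where "g11 = G x $ 1 $ 1" and "g12 = G x $ 1 $ 2" and "g22 = G x $ 2 $ 2"
  have g21: "G x $ 2 $ 1 = g12"
    using arg_cong [OF sym, of "\<lambda>A. A $ 2 $ 1"] by (simp add: g12_def transpose_def)
  note gs = g11_def [symmetric] g12_def [symmetric] g22_def [symmetric] g21
  define p q r s where "p = e1 $ 1" and "q = e1 $ 2" and "r = e2 $ 1" and "s = e2 $ 2"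
  note es = p_def [symmetric] q_def [symmetric] r_def [symmetric] s_def [symmetric]
  define D where "D = p * s - q * r"
  have D: "D > 0" using pos by (simp add: D_def es)
  have on': "p * (g11 * p + g12 * q) + q * (g12 * p + g22 * q) = 1"
    "r * (g11 * r + g12 * s) + s * (g12 * r + g22 * s) = 1"
    "p * (g11 * r + g12 * s) + q * (g12 * r + g22 * s) = 0"
    using on by (simp_all add: inner_loc_def inner_vec_def matrix_vector_mult_def sum_2 gs es)
  have det: "det (G x) = g11 * g22 - g12 * g12"
    by (simp add: det_2 gs)
  have "(g11 * g22 - g12 * g12) * D\<^sup>2
      = (p * (g11 * p + g12 * q) + q * (g12 * p + g22 * q)) *
        (r * (g11 * r + g12 * s) + s * (g12 * r + g22 * s))
      - (p * (g11 * r + g12 * s) + q * (g12 * r + g22 * s))\<^sup>2"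
    by (simp add: D_def power2_eq_square algebra_simps)
  then have "det (G x) * D\<^sup>2 = 1" by (simp add: on' det)
  then have "det (G x) = (1 / D)\<^sup>2" using D by (simp add: field_simps)
  then have sq: "1 / sqrt (det (G x)) = D" using D by (simp add: real_sqrt_divide)
  define A B A' B' where "A = g11 * p + g12 * q" and "B = g12 * p + g22 * q"
    and "A' = g11 * r + g12 * s" and "B' = g12 * r + g22 * s"
  note ABs = A_def B_def A'_def B'_def
  have AB: "p * A + q * B = 1" "r * A' + s * B' = 1" "p * A' + q * B' = 0" "r * A + s * B = 0"
    using on' by (simp_all add: ABs algebra_simps)
  have "D * A = s * (p * A + q * B) - q * (r * A + s * B)"
    "D * B = p * (r * A + s * B) - r * (p * A + q * B)"
    "D * A' = s * (p * A' + q * B') - q * (r * A' + s * B')"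
    "D * B' = p * (r * A' + s * B') - r * (p * A' + q * B')"
    by (simp_all add: D_def algebra_simps)
  then have lower: "D * A = s" "D * B = - r" "D * A' = - q" "D * B' = p"
    by (simp_all add: AB)
  have "g12 * (a * p + b * r) + g22 * (a * q + b * s) = a * B + b * B'"
    "g11 * (a * p + b * r) + g12 * (a * q + b * s) = a * A + b * A'"
    by (simp_all add: ABs algebra_simps)
  moreover have "D * - (a * B + b * B') = - a * (D * B) - b * (D * B')"
    "D * (a * A + b * A') = a * (D * A) + b * (D * A')"
    by (simp_all add: algebra_simps)
  ultimately have
    "D * - (g12 * (a * p + b * r) + g22 * (a * q + b * s)) = - b * p + a * r"
    "D * (g11 * (a * p + b * r) + g12 * (a * q + b * s)) = - b * q + a * s"
    by (simp_all add: lower)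
  then show ?thesis
    by (simp add: star_loc_def sq vec_eq_iff forall_2 matrix_vector_mult_def sum_2 gs es)
qed

text \<open>A chart is a domain together with a coordinate map, whose values outside the domain are
  irrelevant. A manifold is given by a smooth atlas; the manifold is the union of the
  chart domains, an open subset of the ambient space. The metric is given by its matrix in each
  chart of the atlas, as a function of the coordinates.\<close>

type_synonym 'a chart = "'a set \<times> ('a \<Rightarrow> real^2)"

record 'a manifold2 =
  charts :: "'a chart set"
  metric :: "'a chart \<Rightarrow> real^2 \<Rightarrow> real^2^2"

definition carrier :: "'a manifold2 \<Rightarrow> 'a set" where
  "carrier M = (\<Union>c\<in>charts M. fst c)"

definition is_chart :: "'a::topological_space chart \<Rightarrow> bool" where
  "is_chart c \<longleftrightarrow> open (fst c) \<and> open (snd c ` fst c) \<and>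
     (\<exists>\<psi>. homeomorphism (fst c) (snd c ` fst c) (snd c) \<psi>)"

definition param :: "'a chart \<Rightarrow> real^2 \<Rightarrow> 'a" where
  "param c = inv_into (fst c) (snd c)"

definition overlap :: "'a chart \<Rightarrow> 'a chart \<Rightarrow> (real^2) set" where
  "overlap c d = snd c ` (fst c \<inter> fst d)"

definition transition :: "'a chart \<Rightarrow> 'a chart \<Rightarrow> real^2 \<Rightarrow> real^2" where
  "transition c d = snd d \<circ> param c"

definition jacobian :: "'a chart \<Rightarrow> 'a chart \<Rightarrow> real^2 \<Rightarrow> real^2^2" where
  "jacobian c d x = matrix (frechet_derivative (transition c d) (at x))"

definition smooth_atlas :: "'a::topological_space chart set \<Rightarrow> bool" where
  "smooth_atlas A \<longleftrightarrow> (\<forall>c\<in>A. is_chart c) \<and>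
     (\<forall>c\<in>A. \<forall>d\<in>A. \<forall>i. smooth_on (\<lambda>x. transition c d x $ i) (overlap c d))"

definition riemannian_metric ::
  "'a chart set \<Rightarrow> ('a chart \<Rightarrow> real^2 \<Rightarrow> real^2^2) \<Rightarrow> bool" where
  "riemannian_metric A g \<longleftrightarrow>
     (\<forall>c\<in>A. (\<forall>i j. smooth_on (\<lambda>x. g c x $ i $ j) (snd c ` fst c)) \<and>
        (\<forall>x\<in>snd c ` fst c. transpose (g c x) = g c x \<and> (\<forall>v. v \<noteq> 0 \<longrightarrow> v \<bullet> (g c x *v v) > 0))) \<and>
     (\<forall>c\<in>A. \<forall>d\<in>A. \<forall>x\<in>overlap c d.
        g c x = transpose (jacobian c d x) ** g d (transition c d x) ** jacobian c d x)"

definition riemannian_2_manifold ::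
  "'a::{t2_space, second_countable_topology} manifold2 \<Rightarrow> bool" where
  "riemannian_2_manifold M \<longleftrightarrow> smooth_atlas (charts M) \<and> riemannian_metric (charts M) (metric M)"

definition oriented_manifold :: "'a manifold2 \<Rightarrow> bool" where
  "oriented_manifold M \<longleftrightarrow>
     (\<forall>c\<in>charts M. \<forall>d\<in>charts M. \<forall>x\<in>overlap c d. det (jacobian c d x) > 0)"

text \<open>A vector field is given by its components in each chart, as functions of the coordinates.
  Scalars built from vector fields are evaluated at \<open>p\<close> in some chart around \<open>p\<close>; for the
  metric notions below the value does not depend on the choice (for those involving
  \<open>star\<close>: provided that the atlas is oriented).\<close>

type_synonym 'a vfield = "'a chart \<Rightarrow> real^2 \<Rightarrow> real^2"

definition chart_at :: "'a manifold2 \<Rightarrow> 'a \<Rightarrow> 'a chart" where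
  "chart_at M p = (SOME c. c \<in> charts M \<and> p \<in> fst c)"

definition smooth_fun :: "'a manifold2 \<Rightarrow> 'a set \<Rightarrow> ('a \<Rightarrow> real) \<Rightarrow> bool" where
  "smooth_fun M \<Omega> u \<longleftrightarrow> (\<forall>c\<in>charts M. smooth_on (u \<circ> param c) (snd c ` (fst c \<inter> \<Omega>)))"

definition vinner :: "'a manifold2 \<Rightarrow> 'a vfield \<Rightarrow> 'a vfield \<Rightarrow> 'a \<Rightarrow> real" where
  "vinner M X Y p =
     (let c = chart_at M p; x = snd c p in inner_loc (metric M c) x (X c x) (Y c x))"

definition vnorm :: "'a manifold2 \<Rightarrow> 'a vfield \<Rightarrow> 'a \<Rightarrow> real" where
  "vnorm M X p = sqrt (vinner M X X p)"

definition grad :: "'a manifold2 \<Rightarrow> ('a \<Rightarrow> real) \<Rightarrow> 'a vfield" where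
  "grad M u = (\<lambda>c. grad_loc (metric M c) (u \<circ> param c))"

definition divergence :: "'a manifold2 \<Rightarrow> 'a vfield \<Rightarrow> 'a \<Rightarrow> real" where
  "divergence M X p = (let c = chart_at M p in div_loc (metric M c) (X c) (snd c p))"

definition star :: "'a manifold2 \<Rightarrow> 'a vfield \<Rightarrow> 'a vfield" where
  "star M X = (\<lambda>c x. star_loc (metric M c) x (X c x))"

definition neg_field :: "'a vfield \<Rightarrow> 'a vfield" where
  "neg_field X = (\<lambda>c x. - X c x)"

definition over_norm :: "'a manifold2 \<Rightarrow> 'a vfield \<Rightarrow> 'a vfield \<Rightarrow> 'a vfield" where
  "over_norm M X Y = (\<lambda>c x. X c x /\<^sub>R norm_loc (metric M c) x (Y c x))"

definition gauss_curvature :: "'a manifold2 \<Rightarrow> 'a \<Rightarrow> real" where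
  "gauss_curvature M p = (let c = chart_at M p in gauss_loc (metric M c) (snd c p))"

definition harmonic_on :: "'a manifold2 \<Rightarrow> 'a set \<Rightarrow> ('a \<Rightarrow> real) \<Rightarrow> bool" where
  "harmonic_on M \<Omega> u \<longleftrightarrow> smooth_fun M \<Omega> u \<and> (\<forall>p\<in>\<Omega>. divergence M (grad M u) p = 0)"

definition level_curvature :: "'a manifold2 \<Rightarrow> ('a \<Rightarrow> real) \<Rightarrow> 'a \<Rightarrow> real" where
  "level_curvature M u p = - divergence M (over_norm M (grad M u) (grad M u)) p"

definition descent_curvature :: "'a manifold2 \<Rightarrow> ('a \<Rightarrow> real) \<Rightarrow> 'a \<Rightarrow> real" where
  "descent_curvature M u p = divergence M (over_norm M (star M (grad M u)) (grad M u)) p"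

text \<open>Here \<open>F\<close> and \<open>V\<close> are the continuous extensions; nothing is assumed on a neighbourhood of
  the closure. The transformation law of \<open>V\<close> at boundary points follows by continuity.\<close>

definition extends_to_closure ::
  "'a::topological_space set \<Rightarrow> ('a \<Rightarrow> real) \<Rightarrow> ('a \<Rightarrow> real) \<Rightarrow> bool" where
  "extends_to_closure \<Omega> f F \<longleftrightarrow> continuous_on (closure \<Omega>) F \<and> (\<forall>p\<in>\<Omega>. F p = f p)"

definition grad_extends_to_closure ::
  "'a::topological_space manifold2 \<Rightarrow> 'a set \<Rightarrow> ('a \<Rightarrow> real) \<Rightarrow> 'a vfield \<Rightarrow> bool" where
  "grad_extends_to_closure M \<Omega> u V \<longleftrightarrow>
     (\<forall>c\<in>charts M. continuous_on (snd c ` (fst c \<inter> closure \<Omega>)) (V c) \<and>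
        (\<forall>x\<in>snd c ` (fst c \<inter> \<Omega>). V c x = grad M u c x))"

definition nonvanishing_on :: "'a manifold2 \<Rightarrow> 'a set \<Rightarrow> 'a vfield \<Rightarrow> bool" where
  "nonvanishing_on M S V \<longleftrightarrow> (\<forall>c\<in>charts M. \<forall>x\<in>snd c ` (fst c \<inter> S). V c x \<noteq> 0)"

definition max_attained_on :: "('a \<Rightarrow> real) \<Rightarrow> 'a set \<Rightarrow> 'a set \<Rightarrow> bool" where
  "max_attained_on F S B \<longleftrightarrow> (\<exists>q\<in>B. is_arg_max F (\<lambda>p. p \<in> S) q)"

definition min_attained_on :: "('a \<Rightarrow> real) \<Rightarrow> 'a set \<Rightarrow> 'a set \<Rightarrow> bool" where
  "min_attained_on F S B \<longleftrightarrow> (\<exists>q\<in>B. is_arg_min F (\<lambda>p. p \<in> S) q)"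

end

theory Submission
  imports Defs
begin

text \<open>Near a point where \<open>\<nabla>u \<noteq> 0\<close> the harmonic function \<open>u\<close> has a conjugate \<open>v\<close>, and \<open>(u, v)\<close> are
  conformal coordinates: the metric is \<open>(du\<^sup>2 + dv\<^sup>2) / |\<nabla>u|\<^sup>2\<close>. Let \<open>\<psi> = log |\<nabla>u|\<close>. In these
  coordinates the two curvatures are first derivatives,
  \<open>k / |\<nabla>u| = \<partial>\<^sub>u \<psi>\<close> and \<open>h / |\<nabla>u| = - \<partial>\<^sub>v \<psi>\<close>, the Laplacian is
  \<open>\<Delta> = |\<nabla>u|\<^sup>2 (\<partial>\<^sub>u\<^sup>2 + \<partial>\<^sub>v\<^sup>2)\<close>, and Gauss's equation reads \<open>K = \<Delta>\<psi>\<close>. Applying \<open>\<partial>\<^sub>u\<close> to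
  \<open>(\<partial>\<^sub>u\<^sup>2 + \<partial>\<^sub>v\<^sup>2) \<psi> = K / |\<nabla>u|\<^sup>2\<close> gives, for \<open>F = k / |\<nabla>u|\<close>,
  \<open>\<Delta>F + 2 K F = \<langle>\<nabla>K, \<nabla>u\<rangle> / |\<nabla>u|\<^sup>2\<close>; applying \<open>- \<partial>\<^sub>v\<close> gives the same equation for
  \<open>h / |\<nabla>u|\<close> with \<open>- \<star>\<nabla>u\<close> in place of \<open>\<nabla>u\<close> in the inner product.

  If \<open>K \<le> 0\<close>, the zeroth-order coefficient \<open>2 K\<close> is nonpositive, which is the sign that the
  maximum principle for nonnegative maxima wants. If \<open>K \<ge> 0\<close>, the sign of the extremum
  makes \<open>K F\<close> have the right sign to be moved to the other side, so that \<open>F\<close> itself is sub- or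
  superharmonic. In both situations \<open>e\<^sup>\<alpha>\<^sup>u\<close> is a barrier:
  \<open>\<Delta>e\<^sup>\<alpha>\<^sup>u = \<alpha>\<^sup>2 |\<nabla>u|\<^sup>2 e\<^sup>\<alpha>\<^sup>u\<close>, which dominates the zeroth-order term for large \<open>\<alpha>\<close>. If the maximum
  of \<open>F\<close> were missed by the boundary, then \<open>F + \<epsilon> e\<^sup>\<alpha>\<^sup>u\<close> with a small \<open>\<epsilon> > 0\<close> would have an interior
  maximum at which its Laplacian is positive.

  The conjugate \<open>v\<close> is never constructed. Only the fields \<open>\<partial>\<^sub>u = \<nabla>u / |\<nabla>u|\<^sup>2\<close> and
  \<open>\<partial>\<^sub>v = \<star>\<nabla>u / |\<nabla>u|\<^sup>2\<close> are used, written in an arbitrary chart as the derivations \<open>along\<close> and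
  \<open>across\<close>. They commute because \<open>du\<close> and \<open>\<star>du\<close> are closed (\<open>along_across_commute\<close>), they
  diagonalise the Laplacian (\<open>laplacian_frame\<close>), and \<open>K = \<Delta>\<psi>\<close> is obtained from the Levi-Civita
  connection form of the frame that they span (\<open>gauss_eq_laplacian_log_norm\<close>). The equations for
  the two quotients are \<open>laplacian_along_log_norm\<close> and \<open>laplacian_across_log_norm\<close>.

  On the manifold every quantity at a point is computed in a chart chosen at that point, so
  differentiating it requires independence of the chart. For the Laplacian and the inner product of
  gradients this is a calculation with the transition map; for the Gaussian curvature it then
  follows on \<open>\<Omega>\<close> from \<open>K = \<Delta>\<psi>\<close>.\<close>

section \<open>Partial derivatives and smooth functions in the plane\<close>

lemma frechet_derivative_eq_sum_pd:
  assumes "f differentiable (at x)"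
  shows "frechet_derivative f (at x) v = (\<Sum>i\<in>UNIV. v $ i * pd i f x)"
proof -
  interpret linear "frechet_derivative f (at x)"
    using assms by (rule linear_frechet_derivative)
  have "frechet_derivative f (at x) v = frechet_derivative f (at x) (\<Sum>i\<in>UNIV. v $ i *\<^sub>R axis i 1)"
    by (simp add: basis_expansion flip: scalar_mult_eq_scaleR)
  also have "\<dots> = (\<Sum>i\<in>UNIV. v $ i * pd i f x)"
    by (simp add: sum scale pd_def)
  finally show ?thesis .
qed

lemma has_derivative_pd:
  assumes "f differentiable (at x)"
  shows "(f has_derivative (\<lambda>v. \<Sum>i\<in>UNIV. v $ i * pd i f x)) (at x)"
  using assms by (metis (no_types, lifting) ext frechet_derivative_eq_sum_pd frechet_derivative_works)

lemma pd_eqI: "(f has_derivative f') (at x) \<Longrightarrow> pd i f x = f' (axis i 1)"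
  unfolding pd_def using frechet_derivative_at by metis

lemma pd_cong:
  assumes "open S" "x \<in> S" "\<And>y. y \<in> S \<Longrightarrow> f y = g y"
  shows "pd i f x = pd i g x"
proof -
  have "(f has_derivative f') (at x) \<longleftrightarrow> (g has_derivative f') (at x)" for f'
    using assms has_derivative_transform_within_open by (metis (no_types, lifting))
  then show ?thesis by (simp add: pd_def frechet_derivative_def)
qed

lemma differentiable_cong_open:
  assumes "open S" "x \<in> S" "\<And>y. y \<in> S \<Longrightarrow> f y = g y"
  shows "f differentiable (at x) \<longleftrightarrow> g differentiable (at x)"
  unfolding differentiable_def
  using assms has_derivative_transform_within_open by (metis (no_types, lifting))

lemma pd_const: "pd i (\<lambda>y. c) x = 0"
  by (subst pd_eqI[OF has_derivative_const]) simp

lemma pd_add: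
  assumes "f differentiable (at x)" "g differentiable (at x)"
  shows "pd i (\<lambda>y. f y + g y) x = pd i f x + pd i g x"
  using pd_eqI[OF has_derivative_add[OF assms[unfolded frechet_derivative_works]]] by (simp add: pd_def)

lemma pd_diff:
  assumes "f differentiable (at x)" "g differentiable (at x)"
  shows "pd i (\<lambda>y. f y - g y) x = pd i f x - pd i g x"
  using pd_eqI[OF has_derivative_diff[OF assms[unfolded frechet_derivative_works]]] by (simp add: pd_def)

lemma pd_minus:
  assumes "f differentiable (at x)"
  shows "pd i (\<lambda>y. - f y) x = - pd i f x"
  using pd_eqI[OF has_derivative_minus[OF assms[unfolded frechet_derivative_works]]] by (simp add: pd_def)

lemma pd_mult:
  assumes "f differentiable (at x)" "g differentiable (at x)"
  shows "pd i (\<lambda>y. f y * g y) x = pd i f x * g x + f x * pd i g x"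
  using pd_eqI[OF has_derivative_mult[OF assms[unfolded frechet_derivative_works]]]
  by (simp add: pd_def algebra_simps)

lemma
  assumes f: "f differentiable (at x)" and \<phi>: "(\<phi> has_real_derivative c) (at (f x))"
  shows pd_compose_real: "pd i (\<lambda>y. \<phi> (f y)) x = c * pd i f x"
    and differentiable_compose_real: "(\<lambda>y. \<phi> (f y)) differentiable (at x)"
proof -
  have "((\<lambda>y. \<phi> (f y)) has_derivative (\<lambda>v. c * frechet_derivative f (at x) v)) (at x)"
    using has_derivative_compose[OF f[unfolded frechet_derivative_works] \<phi>[unfolded has_field_derivative_def]] .
  then show "pd i (\<lambda>y. \<phi> (f y)) x = c * pd i f x" "(\<lambda>y. \<phi> (f y)) differentiable (at x)"
    by (auto simp: pd_def differentiable_def dest: pd_eqI)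
qed

lemma pd_inverse:
  assumes "f differentiable (at x)" "f x \<noteq> 0"
  shows "pd i (\<lambda>y. inverse (f y)) x = - pd i f x * inverse (f x) * inverse (f x)"
  using pd_compose_real[OF assms(1) DERIV_inverse[OF assms(2)]] by (simp add: power2_eq_square)

lemma pd_divide:
  assumes "f differentiable (at x)" "g differentiable (at x)" "g x \<noteq> 0"
  shows "pd i (\<lambda>y. f y / g y) x = (pd i f x * g x - f x * pd i g x) / (g x * g x)"
proof -
  have g': "(\<lambda>y. inverse (g y)) differentiable (at x)"
    using differentiable_compose_real[OF assms(2) DERIV_inverse[OF assms(3)]] .
  have "pd i (\<lambda>y. f y * inverse (g y)) x = (pd i f x * g x - f x * pd i g x) / (g x * g x)"
    unfolding pd_mult[OF assms(1) g'] pd_inverse[OF assms(2,3)] using assms(3)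
    by (simp add: field_simps)
  then show ?thesis by (simp add: divide_inverse)
qed

lemma pd_sqrt:
  assumes "f differentiable (at x)" "f x > 0"
  shows "pd i (\<lambda>y. sqrt (f y)) x = pd i f x * (inverse (sqrt (f x)) * (1/2))"
  using pd_compose_real[OF assms(1) DERIV_real_sqrt[OF assms(2)]] by simp

lemma pd_ln:
  assumes "f differentiable (at x)" "f x > 0"
  shows "pd i (\<lambda>y. ln (f y)) x = pd i f x * inverse (f x)"
  using pd_compose_real[OF assms(1) DERIV_ln[OF assms(2)]] by simp

lemma pd_exp:
  assumes "f differentiable (at x)"
  shows "pd i (\<lambda>y. exp (f y)) x = pd i f x * exp (f x)"
  using pd_compose_real[OF assms(1) DERIV_exp] by simp

lemma Ck_on_cong:
  assumes "open S" "\<And>x. x \<in> S \<Longrightarrow> f x = g x"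
  shows "Ck_on n f S \<longleftrightarrow> Ck_on n g S"
  using assms(2)
proof (induction n arbitrary: f g)
  case 0 then show ?case by (simp cong: continuous_on_cong)
next
  case (Suc n)
  have "pd i f x = pd i g x" if "x \<in> S" for x i by (rule pd_cong[OF assms(1) that Suc.prems])
  then have "Ck_on n (pd i f) S \<longleftrightarrow> Ck_on n (pd i g) S" for i by (rule Suc.IH)
  moreover have "(\<forall>x\<in>S. f differentiable (at x)) \<longleftrightarrow> (\<forall>x\<in>S. g differentiable (at x))"
    using differentiable_cong_open[OF assms(1), of _ f g] Suc.prems by blast
  ultimately show ?case by simp
qed

lemma smooth_on_cong:
  assumes "open S" "\<And>x. x \<in> S \<Longrightarrow> f x = g x"
  shows "smooth_on f S \<longleftrightarrow> smooth_on g S"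
  unfolding smooth_on_def using Ck_on_cong[OF assms] by simp

lemma Ck_on_Suc_imp: "Ck_on (Suc n) f S \<Longrightarrow> Ck_on n f S"
proof (induction n arbitrary: f)
  case 0
  then show ?case
    by (auto intro!: differentiable_imp_continuous_on differentiable_at_imp_differentiable_on)
next
  case (Suc n) then show ?case by (metis Ck_on.simps(2))
qed

lemma smooth_onD:
  assumes "smooth_on f S"
  shows "x \<in> S \<Longrightarrow> f differentiable (at x)" "smooth_on (pd i f) S" "continuous_on S f"
  using assms unfolding smooth_on_def by (metis Ck_on.simps)+

lemma smooth_on_subset: "smooth_on f S \<Longrightarrow> T \<subseteq> S \<Longrightarrow> smooth_on f T"
proof -
  have "Ck_on n f S \<Longrightarrow> T \<subseteq> S \<Longrightarrow> Ck_on n f T" for n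
    by (induction n arbitrary: f) (auto intro: continuous_on_subset)
  then show "smooth_on f S \<Longrightarrow> T \<subseteq> S \<Longrightarrow> smooth_on f T"
    by (simp add: smooth_on_def)
qed

lemma smooth_onI_pd:
  assumes "\<And>x. x \<in> S \<Longrightarrow> f differentiable (at x)"
    and "\<And>n i. Ck_on n f S \<Longrightarrow> Ck_on n (pd i f) S"
  shows "smooth_on f S"
proof -
  have "Ck_on n f S" for n
  proof (induction n)
    case 0
    show ?case using assms(1)
      by (auto intro!: differentiable_imp_continuous_on differentiable_at_imp_differentiable_on)
  next
    case (Suc n) then show ?case using assms by simp
  qed
  then show ?thesis by (simp add: smooth_on_def)
qed

lemma smooth_on_const: "smooth_on (\<lambda>x. c) S"
proof -
  have "Ck_on n (\<lambda>x. c) S" for n and c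
  proof (induction n arbitrary: c)
    case (Suc n)
    have "pd i (\<lambda>x. c) = (\<lambda>x. 0)" for i by (simp add: fun_eq_iff pd_const)
    then show ?case using Suc[of 0] by simp
  qed simp
  then show ?thesis by (simp add: smooth_on_def)
qed

lemma Ck_on_add:
  assumes S: "open S" and "Ck_on n f S" "Ck_on n g S"
  shows "Ck_on n (\<lambda>x. f x + g x) S"
  using assms(2,3)
proof (induction n arbitrary: f g)
  case 0 then show ?case by (simp add: continuous_on_add)
next
  case (Suc n)
  have "Ck_on n (pd i (\<lambda>x. f x + g x)) S" for i
    using Suc.prems Suc.IH[of "pd i f" "pd i g"]
    by (subst Ck_on_cong[OF S, where g = "\<lambda>x. pd i f x + pd i g x"]) (auto simp: pd_add)
  then show ?case using Suc.prems by simp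
qed

lemma Ck_on_mult:
  assumes S: "open S" and "Ck_on n f S" "Ck_on n g S"
  shows "Ck_on n (\<lambda>x. f x * g x) S"
  using assms(2,3)
proof (induction n arbitrary: f g)
  case 0 then show ?case by (simp add: continuous_on_mult)
next
  case (Suc n)
  note * = Suc.prems[THEN Ck_on_Suc_imp]
  have "Ck_on n (pd i (\<lambda>x. f x * g x)) S" for i
  proof (subst Ck_on_cong[OF S])
    show "pd i (\<lambda>x. f x * g x) x = pd i f x * g x + f x * pd i g x" if "x \<in> S" for x
      using that Suc.prems by (intro pd_mult) auto
    show "Ck_on n (\<lambda>x. pd i f x * g x + f x * pd i g x) S"
      using Suc.prems * by (intro Ck_on_add[OF S] Suc.IH) auto
  qed
  then show ?case using Suc.prems by simp
qed

lemma smooth_on_add: "open S \<Longrightarrow> smooth_on f S \<Longrightarrow> smooth_on g S \<Longrightarrow> smooth_on (\<lambda>x. f x + g x) S"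
  by (simp add: smooth_on_def Ck_on_add)

lemma smooth_on_mult: "open S \<Longrightarrow> smooth_on f S \<Longrightarrow> smooth_on g S \<Longrightarrow> smooth_on (\<lambda>x. f x * g x) S"
  by (simp add: smooth_on_def Ck_on_mult)

lemma smooth_on_minus: "open S \<Longrightarrow> smooth_on f S \<Longrightarrow> smooth_on (\<lambda>x. - f x) S"
  using smooth_on_mult[OF _ smooth_on_const[of "-1"], of S f] by simp

lemma smooth_on_diff: "open S \<Longrightarrow> smooth_on f S \<Longrightarrow> smooth_on g S \<Longrightarrow> smooth_on (\<lambda>x. f x - g x) S"
  using smooth_on_add[of S f, OF _ _ smooth_on_minus] by simp

lemma smooth_on_inverse:
  assumes S: "open S" and f: "smooth_on f S" and nz: "\<And>x. x \<in> S \<Longrightarrow> f x \<noteq> 0"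
  shows "smooth_on (\<lambda>x. inverse (f x)) S"
proof (rule smooth_onI_pd)
  show "(\<lambda>x. inverse (f x)) differentiable (at x)" if "x \<in> S" for x
    using differentiable_compose_real[OF smooth_onD(1)[OF f that] DERIV_inverse] nz[OF that] by simp
  fix n i assume *: "Ck_on n (\<lambda>x. inverse (f x)) S"
  have "Ck_on n (\<lambda>x. - pd i f x * inverse (f x) * inverse (f x)) S"
    using smooth_on_minus[OF S smooth_onD(2)[OF f, of i]] *
    by (intro Ck_on_mult[OF S]) (auto simp: smooth_on_def)
  then show "Ck_on n (pd i (\<lambda>x. inverse (f x))) S"
    by (subst Ck_on_cong[OF S, where g = "\<lambda>x. - pd i f x * inverse (f x) * inverse (f x)"])
       (auto simp: pd_inverse nz smooth_onD(1)[OF f])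
qed

lemma smooth_on_divide:
  "open S \<Longrightarrow> smooth_on f S \<Longrightarrow> smooth_on g S \<Longrightarrow> (\<And>x. x \<in> S \<Longrightarrow> g x \<noteq> 0)
    \<Longrightarrow> smooth_on (\<lambda>x. f x / g x) S"
  unfolding divide_inverse by (intro smooth_on_mult smooth_on_inverse)

lemma smooth_on_sqrt:
  assumes S: "open S" and f: "smooth_on f S" and pos: "\<And>x. x \<in> S \<Longrightarrow> f x > 0"
  shows "smooth_on (\<lambda>x. sqrt (f x)) S"
proof (rule smooth_onI_pd)
  show diff: "(\<lambda>x. sqrt (f x)) differentiable (at x)" if "x \<in> S" for x
    using differentiable_compose_real[OF smooth_onD(1)[OF f that] DERIV_real_sqrt[OF pos[OF that]]] by simp
  fix n i assume *: "Ck_on n (\<lambda>x. sqrt (f x)) S"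
  \<comment> \<open>The derivative of \<open>sqrt f\<close> is \<open>f' / (2 sqrt f)\<close>, so one more order of smoothness for
    \<open>sqrt f\<close> costs the present order for its inverse, which an inner induction supplies.\<close>
  have inv: "Ck_on m (\<lambda>x. sqrt (f x)) S \<Longrightarrow> Ck_on m (\<lambda>x. inverse (sqrt (f x))) S" for m
  proof (induction m)
    case 0
    then show ?case using pos by (auto intro!: continuous_intros simp: less_le)
  next
    case (Suc m)
    have I: "Ck_on m (\<lambda>x. inverse (sqrt (f x))) S" using Suc.IH Ck_on_Suc_imp[OF Suc.prems] .
    have "Ck_on m (pd j (\<lambda>x. inverse (sqrt (f x)))) S" for j
    proof -
      have "Ck_on m (\<lambda>x. (- 1) * pd j (\<lambda>x. sqrt (f x)) x * inverse (sqrt (f x)) * inverse (sqrt (f x))) S"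
        using Suc.prems I smooth_on_const[of "-1" S]
        by (intro Ck_on_mult[OF S]) (auto simp: smooth_on_def)
      then show ?thesis
        using pos by (subst Ck_on_cong[OF S]) (auto simp: pd_inverse[OF diff] less_le)
    qed
    moreover have "(\<lambda>x. inverse (sqrt (f x))) differentiable (at x)" if "x \<in> S" for x
      using differentiable_compose_real[OF diff[OF that] DERIV_inverse] pos[OF that] by simp
    ultimately show ?case by simp
  qed
  have "Ck_on n (\<lambda>x. pd i f x * (inverse (sqrt (f x)) * (1/2))) S"
    using smooth_onD(2)[OF f, of i] smooth_on_const[of "1/2" S] inv[OF *]
    by (intro Ck_on_mult[OF S]) (auto simp: smooth_on_def)
  then show "Ck_on n (pd i (\<lambda>x. sqrt (f x))) S"
    by (subst Ck_on_cong[OF S]) (auto simp: pd_sqrt pos smooth_onD(1)[OF f])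
qed

lemma smooth_on_ln:
  assumes S: "open S" and f: "smooth_on f S" and pos: "\<And>x. x \<in> S \<Longrightarrow> f x > 0"
  shows "smooth_on (\<lambda>x. ln (f x)) S"
proof (rule smooth_onI_pd)
  show "(\<lambda>x. ln (f x)) differentiable (at x)" if "x \<in> S" for x
    using differentiable_compose_real[OF smooth_onD(1)[OF f that] DERIV_ln[OF pos[OF that]]] by simp
  fix n i
  have "smooth_on (\<lambda>x. pd i f x * inverse (f x)) S"
    using pos by (intro smooth_on_mult[OF S] smooth_on_inverse[OF S] smooth_onD(2)[OF f] f) (auto simp: less_le)
  then show "Ck_on n (pd i (\<lambda>x. ln (f x))) S"
    by (subst Ck_on_cong[OF S]) (auto simp: pd_ln pos smooth_onD(1)[OF f] smooth_on_def)
qed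

lemma smooth_on_exp:
  assumes S: "open S" and f: "smooth_on f S"
  shows "smooth_on (\<lambda>x. exp (f x)) S"
proof (rule smooth_onI_pd)
  show "(\<lambda>x. exp (f x)) differentiable (at x)" if "x \<in> S" for x
    using differentiable_compose_real[OF smooth_onD(1)[OF f that] DERIV_exp] by simp
  fix n i assume *: "Ck_on n (\<lambda>x. exp (f x)) S"
  have "Ck_on n (\<lambda>x. pd i f x * exp (f x)) S"
    using smooth_onD(2)[OF f, of i] * by (intro Ck_on_mult[OF S]) (auto simp: smooth_on_def)
  then show "Ck_on n (pd i (\<lambda>x. exp (f x))) S"
    by (subst Ck_on_cong[OF S]) (auto simp: pd_exp smooth_onD(1)[OF f])
qed

lemma has_real_derivative_along_line:
  assumes "f differentiable (at (x + t *\<^sub>R v))"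
  shows "((\<lambda>s. f (x + s *\<^sub>R v)) has_real_derivative (\<Sum>i\<in>UNIV. v $ i * pd i f (x + t *\<^sub>R v))) (at t)"
proof -
  have "((\<lambda>s. x + s *\<^sub>R v) has_derivative (\<lambda>s. s *\<^sub>R v)) (at t)"
    by (auto intro!: derivative_eq_intros)
  from has_derivative_compose[OF this has_derivative_pd[OF assms]]
  have "((\<lambda>s. f (x + s *\<^sub>R v)) has_derivative (\<lambda>s. \<Sum>i\<in>UNIV. (s *\<^sub>R v) $ i * pd i f (x + t *\<^sub>R v))) (at t)" .
  moreover have "(\<lambda>s. \<Sum>i\<in>UNIV. (s *\<^sub>R v) $ i * pd i f (x + t *\<^sub>R v)) = (*) (\<Sum>i\<in>UNIV. v $ i * pd i f (x + t *\<^sub>R v))"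
    by (simp add: fun_eq_iff sum_distrib_left sum_distrib_right mult_ac)
  ultimately show ?thesis by (simp add: has_field_derivative_def)
qed

lemma has_real_derivative_along_axis:
  assumes "f differentiable (at (x + t *\<^sub>R axis i 1))"
  shows "((\<lambda>s. f (x + s *\<^sub>R axis i 1)) has_real_derivative pd i f (x + t *\<^sub>R axis i 1)) (at t)"
proof -
  have "(\<Sum>j\<in>UNIV. (axis i 1 :: real^2) $ j * pd j f (x + t *\<^sub>R axis i 1)) = pd i f (x + t *\<^sub>R axis i 1)"
    by (simp add: axis_def if_distrib[of "\<lambda>z. z * _"] cong: if_cong)
  with has_real_derivative_along_line[OF assms] show ?thesis by simp
qed

text \<open>Two applications of the mean value theorem, first in direction \<open>i\<close> and then in direction \<open>j\<close>. The
  left-hand side is symmetric in \<open>i\<close> and \<open>j\<close>, which is what makes second derivatives commute.\<close>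

lemma second_difference_mean_value:
  assumes ball: "ball x r \<subseteq> S" and f: "smooth_on f S" and t: "0 < t" "2 * t < r"
  shows "\<exists>y\<in>ball x (2 * t). f (x + t *\<^sub>R axis i 1 + t *\<^sub>R axis j 1) - f (x + t *\<^sub>R axis i 1)
      - f (x + t *\<^sub>R axis j 1) + f x = t * t * pd j (pd i f) y"
proof -
  have near: "x + a *\<^sub>R axis i 1 + b *\<^sub>R axis j 1 \<in> S" if "0 \<le> a" "a \<le> t" "0 \<le> b" "b \<le> t" for a b
  proof -
    have "dist x (x + a *\<^sub>R axis i 1 + b *\<^sub>R axis j (1::real)) \<le> a + b"
      using norm_triangle_ineq[of "a *\<^sub>R axis i (1::real)" "b *\<^sub>R axis j 1"] that
      by (simp add: dist_norm norm_minus_commute add.assoc add.commute)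
    then show ?thesis using that ball t by (auto simp: subset_iff)
  qed
  let ?\<phi> = "\<lambda>s. f (x + t *\<^sub>R axis j 1 + s *\<^sub>R axis i 1) - f (x + s *\<^sub>R axis i 1)"
  have "(?\<phi> has_real_derivative pd i f (x + t *\<^sub>R axis j 1 + s *\<^sub>R axis i 1) - pd i f (x + s *\<^sub>R axis i 1)) (at s)"
    if "0 \<le> s" "s \<le> t" for s
    using smooth_onD(1)[OF f near[of s t]] smooth_onD(1)[OF f near[of s 0]] that t
    by (intro DERIV_diff has_real_derivative_along_axis) (auto simp: add_ac)
  then obtain \<xi> where \<xi>: "0 < \<xi>" "\<xi> < t"
    "?\<phi> t - ?\<phi> 0 = (t - 0) * (pd i f (x + t *\<^sub>R axis j 1 + \<xi> *\<^sub>R axis i 1) - pd i f (x + \<xi> *\<^sub>R axis i 1))"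
    using MVT2[OF t(1), of ?\<phi>] by (metis (no_types, lifting))
  let ?\<chi> = "\<lambda>s. pd i f (x + \<xi> *\<^sub>R axis i 1 + s *\<^sub>R axis j 1)"
  have "(?\<chi> has_real_derivative pd j (pd i f) (x + \<xi> *\<^sub>R axis i 1 + s *\<^sub>R axis j 1)) (at s)"
    if "0 \<le> s" "s \<le> t" for s
    using smooth_onD(1)[OF smooth_onD(2)[OF f] near[of \<xi> s]] that \<xi>
    by (intro has_real_derivative_along_axis) auto
  then obtain \<eta> where \<eta>: "0 < \<eta>" "\<eta> < t"
    "?\<chi> t - ?\<chi> 0 = (t - 0) * pd j (pd i f) (x + \<xi> *\<^sub>R axis i 1 + \<eta> *\<^sub>R axis j 1)"
    using MVT2[OF t(1), of ?\<chi> "\<lambda>s. pd j (pd i f) (x + \<xi> *\<^sub>R axis i 1 + s *\<^sub>R axis j 1)"] by blast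
  have "x + \<xi> *\<^sub>R axis i 1 + \<eta> *\<^sub>R axis j 1 \<in> ball x (2*t)"
    
    using norm_triangle_ineq[of "\<xi> *\<^sub>R axis i (1::real)" "\<eta> *\<^sub>R axis j 1"] \<xi> \<eta>
    by (simp add: dist_norm norm_minus_commute add.assoc add.commute)
  moreover have "?\<phi> t - ?\<phi> 0 = t * t * pd j (pd i f) (x + \<xi> *\<^sub>R axis i 1 + \<eta> *\<^sub>R axis j 1)"
    using \<xi>(3) \<eta>(3) by (simp add: add_ac)
  ultimately show ?thesis by (intro bexI) (auto simp: add_ac)
qed

text \<open>Schwarz's theorem. The same second difference is \<open>t\<^sup>2\<close> times either mixed derivative at points
  that tend to \<open>x\<close> with \<open>t\<close>, so continuity forces the two to agree at \<open>x\<close>.\<close>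

lemma pd_commute:
  assumes S: "open S" "x \<in> S" and f: "smooth_on f S"
  shows "pd i (pd j f) x = pd j (pd i f) x"
proof (rule ccontr)
  define e where "e = \<bar>pd i (pd j f) x - pd j (pd i f) x\<bar> / 2"
  assume "pd i (pd j f) x \<noteq> pd j (pd i f) x"
  then have e: "e > 0" by (simp add: e_def)
  have "isCont (pd i (pd j f)) x" "isCont (pd j (pd i f)) x"
    using smooth_onD(3)[OF smooth_onD(2)[OF smooth_onD(2)[OF f]]] S by (auto simp: continuous_on_eq_continuous_at)
  then obtain d1 d2 where d: "d1 > 0" "d2 > 0"
    "\<And>y. dist y x < d1 \<Longrightarrow> dist (pd i (pd j f) y) (pd i (pd j f) x) < e"
    "\<And>y. dist y x < d2 \<Longrightarrow> dist (pd j (pd i f) y) (pd j (pd i f) x) < e"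
    using e unfolding continuous_at_eps_delta by metis
  obtain r where r: "r > 0" "ball x r \<subseteq> S" using S open_contains_ball by blast
  define t where "t = min r (min d1 d2) / 4"
  have t: "0 < t" "2 * t < r" "2 * t < d1" "2 * t < d2" using r d by (auto simp: t_def)
  obtain y z where y: "y \<in> ball x (2*t)" "z \<in> ball x (2*t)"
    "t * t * pd j (pd i f) y = t * t * pd i (pd j f) z"
    using second_difference_mean_value[OF r(2) f t(1,2), of i j]
      second_difference_mean_value[OF r(2) f t(1,2), of j i] by (smt (verit) add.assoc add.commute)
  then have "pd j (pd i f) y = pd i (pd j f) z" using t by simp
  moreover have "dist (pd i (pd j f) x) (pd i (pd j f) z) < e" "dist (pd j (pd i f) x) (pd j (pd i f) y) < e"
    using d(3)[of z] d(4)[of y] y t by (auto simp: dist_commute)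
  ultimately have "dist (pd i (pd j f) x) (pd j (pd i f) x) < 2 * e"
    using dist_triangle_half_l[of _ _ "2 * e"] by simp
  then show False by (simp add: e_def dist_real_def)
qed

section \<open>Metrics on an open subset of the plane\<close>

lemma matrix_inv_eqI:
  fixes A B :: "real^'n^'n"
  assumes "A ** B = mat 1"
  shows "matrix_inv A = B"
proof -
  have BA: "B ** A = mat 1" using assms matrix_left_right_inverse by blast
  have "A ** matrix_inv A = mat 1 \<and> matrix_inv A ** A = mat 1"
    unfolding matrix_inv_def by (rule someI[of _ B]) (simp add: assms BA)
  then show ?thesis
    by (metis BA matrix_mul_assoc matrix_mul_lid matrix_mul_rid)
qed

definition laplacian :: "(real^2 \<Rightarrow> real^2^2) \<Rightarrow> (real^2 \<Rightarrow> real) \<Rightarrow> real^2 \<Rightarrow> real" where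
  "laplacian G f = div_loc G (grad_loc G f)"

definition grad_norm2 :: "(real^2 \<Rightarrow> real^2^2) \<Rightarrow> (real^2 \<Rightarrow> real) \<Rightarrow> real^2 \<Rightarrow> real" where
  "grad_norm2 G f x = inner_loc G x (grad_loc G f x) (grad_loc G f x)"

locale surface_patch =
  fixes S :: "(real^2) set" and G :: "real^2 \<Rightarrow> real^2^2"
  assumes open_S: "open S"
    and smooth_metric: "smooth_on (\<lambda>x. G x $ i $ j) S"
    and metric_sym: "x \<in> S \<Longrightarrow> transpose (G x) = G x"
    and metric_pos: "x \<in> S \<Longrightarrow> v \<noteq> 0 \<Longrightarrow> v \<bullet> (G x *v v) > 0"
begin

lemma metric_commute: "x \<in> S \<Longrightarrow> G x $ i $ j = G x $ j $ i"
  using arg_cong[OF metric_sym, of x "\<lambda>A. A $ j $ i"] by (simp add: transpose_def)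

lemma metric_commute': "x \<in> S \<Longrightarrow> G x $ 2 $ 1 = G x $ 1 $ 2"
  by (rule metric_commute)

lemma pd_metric_commute: "x \<in> S \<Longrightarrow> pd k (\<lambda>y. G y $ i $ j) x = pd k (\<lambda>y. G y $ j $ i) x"
  by (rule pd_cong[OF open_S _ metric_commute])

lemma det_metric: "x \<in> S \<Longrightarrow> det (G x) = G x $ 1 $ 1 * G x $ 2 $ 2 - G x $ 1 $ 2 * G x $ 1 $ 2"
  by (simp add: det_2 metric_commute')

lemma metric_11_pos: "x \<in> S \<Longrightarrow> G x $ 1 $ 1 > 0"
  using metric_pos[of x "axis 1 1"]
  by (simp add: axis_eq_0_iff inner_axis' matrix_vector_mult_basis column_def)

lemma det_metric_pos:
  assumes "x \<in> S"
  shows "det (G x) > 0"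
proof -
  \<comment> \<open>This vector is \<open>G\<close>-orthogonal to \<open>\<partial>\<^sub>1\<close>; its squared length is \<open>G\<^sub>1\<^sub>1 det G\<close>.\<close>
  let ?v = "vector [- G x $ 1 $ 2, G x $ 1 $ 1] :: real^2"
  have "?v \<noteq> 0" using metric_11_pos[OF assms] by (auto simp: vec_eq_iff forall_2)
  then have "0 < ?v \<bullet> (G x *v ?v)" by (rule metric_pos[OF assms])
  also have "\<dots> = G x $ 1 $ 1 * det (G x)"
    unfolding det_metric[OF assms]
    by (simp add: inner_vec_def sum_2 matrix_vector_mult_def metric_commute'[OF assms] algebra_simps)
  finally show ?thesis using metric_11_pos[OF assms] zero_less_mult_pos by blast
qed

lemma
  assumes "x \<in> S"
  shows matrix_inv_metric: "G x ** matrix_inv (G x) = mat 1"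
    and matrix_inv_metric_nth:
      "matrix_inv (G x) $ 1 $ 1 = G x $ 2 $ 2 / det (G x)"
      "matrix_inv (G x) $ 1 $ 2 = - G x $ 1 $ 2 / det (G x)"
      "matrix_inv (G x) $ 2 $ 1 = - G x $ 1 $ 2 / det (G x)"
      "matrix_inv (G x) $ 2 $ 2 = G x $ 1 $ 1 / det (G x)"
proof -
  let ?B = "vector [vector [G x $ 2 $ 2 / det (G x), - G x $ 1 $ 2 / det (G x)],
    vector [- G x $ 1 $ 2 / det (G x), G x $ 1 $ 1 / det (G x)]] :: real^2^2"
  have "det (G x) \<noteq> 0" using det_metric_pos[OF assms] by simp
  then have "G x ** ?B = mat 1"
    using det_metric[OF assms]
    by (simp add: matrix_matrix_mult_def vec_eq_iff forall_2 sum_2 mat_def metric_commute'[OF assms] field_simps)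
  note GB = this
  have inv: "matrix_inv (G x) = ?B" by (rule matrix_inv_eqI[OF GB])
  show "G x ** matrix_inv (G x) = mat 1" unfolding inv by (rule GB)
  show "matrix_inv (G x) $ 1 $ 1 = G x $ 2 $ 2 / det (G x)"
      "matrix_inv (G x) $ 1 $ 2 = - G x $ 1 $ 2 / det (G x)"
      "matrix_inv (G x) $ 2 $ 1 = - G x $ 1 $ 2 / det (G x)"
      "matrix_inv (G x) $ 2 $ 2 = G x $ 1 $ 1 / det (G x)"
    by (simp_all add: inv)
qed

lemma grad_loc_nth:
  assumes "x \<in> S"
  shows "grad_loc G f x $ 1 = (G x $ 2 $ 2 * pd 1 f x - G x $ 1 $ 2 * pd 2 f x) / det (G x)"
    and "grad_loc G f x $ 2 = (G x $ 1 $ 1 * pd 2 f x - G x $ 1 $ 2 * pd 1 f x) / det (G x)"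
  by (simp_all add: grad_loc_def matrix_vector_mult_def sum_2 matrix_inv_metric_nth[OF assms]
      diff_divide_distrib)

lemma metric_mult_grad:
  assumes "x \<in> S"
  shows "G x *v grad_loc G f x = (\<chi> j. pd j f x)"
  by (simp add: grad_loc_def matrix_vector_mul_assoc matrix_inv_metric[OF assms])

lemma inner_loc_commute: "x \<in> S \<Longrightarrow> inner_loc G x v w = inner_loc G x w v"
  by (simp add: inner_loc_def inner_vec_def matrix_vector_mult_def sum_2 metric_commute' algebra_simps)

lemma inner_loc_grad:
  assumes "x \<in> S"
  shows "inner_loc G x v (grad_loc G f x) = v $ 1 * pd 1 f x + v $ 2 * pd 2 f x"
    and "inner_loc G x (grad_loc G f x) v = v $ 1 * pd 1 f x + v $ 2 * pd 2 f x"
  using inner_loc_commute[OF assms]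
  by (simp_all add: inner_loc_def metric_mult_grad[OF assms] inner_vec_def sum_2)

lemma inner_grad_explicit:
  assumes "x \<in> S"
  shows "inner_loc G x (grad_loc G f x) (grad_loc G h x) =
    (G x $ 2 $ 2 * (pd 1 f x * pd 1 h x) - G x $ 1 $ 2 * (pd 1 f x * pd 2 h x + pd 2 f x * pd 1 h x)
      + G x $ 1 $ 1 * (pd 2 f x * pd 2 h x)) / det (G x)"
  by (simp add: inner_loc_grad[OF assms] grad_loc_nth[OF assms] algebra_simps add_divide_distrib diff_divide_distrib)

lemma grad_norm2_eq:
  assumes "x \<in> S"
  shows "grad_norm2 G f x = grad_loc G f x $ 1 * pd 1 f x + grad_loc G f x $ 2 * pd 2 f x"
  by (simp add: grad_norm2_def inner_loc_grad[OF assms])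

lemma grad_norm2_pos:
  assumes "x \<in> S" "grad_loc G f x \<noteq> 0"
  shows "grad_norm2 G f x > 0"
  using metric_pos[OF assms] by (simp add: grad_norm2_def inner_loc_def)

lemma smooth_det: "smooth_on (\<lambda>x. det (G x)) S"
  unfolding det_2 by (intro smooth_on_diff smooth_on_mult open_S smooth_metric)

lemma smooth_sqrt_det: "smooth_on (\<lambda>x. sqrt (det (G x))) S"
  by (rule smooth_on_sqrt[OF open_S smooth_det det_metric_pos])

lemma det_metric_nz: "x \<in> S \<Longrightarrow> det (G x) \<noteq> 0"
  using det_metric_pos by force

lemma smooth_grad_loc:
  assumes "smooth_on f S"
  shows "smooth_on (\<lambda>x. grad_loc G f x $ i) S"
proof -
  have "smooth_on (\<lambda>x. grad_loc G f x $ 1) S"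
    by (subst smooth_on_cong[OF open_S grad_loc_nth(1)])
      (auto intro!: smooth_on_divide smooth_on_diff smooth_on_mult open_S smooth_metric smooth_det
        smooth_onD(2) assms det_metric_nz)
  moreover have "smooth_on (\<lambda>x. grad_loc G f x $ 2) S"
    by (subst smooth_on_cong[OF open_S grad_loc_nth(2)])
      (auto intro!: smooth_on_divide smooth_on_diff smooth_on_mult open_S smooth_metric smooth_det
        smooth_onD(2) assms det_metric_nz)
  ultimately show ?thesis using exhaust_2[of i] by auto
qed

lemma smooth_grad_norm2:
  assumes "smooth_on f S"
  shows "smooth_on (grad_norm2 G f) S"
  by (subst smooth_on_cong[OF open_S grad_norm2_eq])
    (auto intro!: smooth_on_add smooth_on_mult open_S smooth_grad_loc smooth_onD(2) assms)

lemma laplacian_eq: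
  "laplacian G f x = (pd 1 (\<lambda>y. sqrt (det (G y)) * grad_loc G f y $ 1) x
      + pd 2 (\<lambda>y. sqrt (det (G y)) * grad_loc G f y $ 2) x) / sqrt (det (G x))"
  by (simp add: laplacian_def div_loc_def sum_2)

lemma laplacian_linear:
  assumes "smooth_on f S" "smooth_on h S" "x \<in> S"
  shows "laplacian G (\<lambda>y. f y + c * h y) x = laplacian G f x + c * laplacian G h x"
proof -
  have d: "f differentiable (at y)" "h differentiable (at y)" "pd i f differentiable (at y)"
    "pd i h differentiable (at y)" if "y \<in> S" for y i
    using assms(1,2) that by (auto intro: smooth_onD)
  have "sqrt (det (G y)) * grad_loc G (\<lambda>y. f y + c * h y) y $ i
      = sqrt (det (G y)) * grad_loc G f y $ i + c * (sqrt (det (G y)) * grad_loc G h y $ i)" if y: "y \<in> S" for y i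
  proof -
    have p: "pd j (\<lambda>y. f y + c * h y) y = pd j f y + c * pd j h y" for j
      using d[OF y] by (simp add: pd_add pd_mult pd_const)
    have "grad_loc G (\<lambda>y. f y + c * h y) y = grad_loc G f y + c *\<^sub>R grad_loc G h y"
      by (auto simp: vec_eq_iff forall_2 grad_loc_nth[OF y] p add_divide_distrib diff_divide_distrib algebra_simps)
    then show ?thesis by (simp add: algebra_simps)
  qed
  then have *: "pd i (\<lambda>y. sqrt (det (G y)) * grad_loc G (\<lambda>y. f y + c * h y) y $ i) x
    = pd i (\<lambda>y. sqrt (det (G y)) * grad_loc G f y $ i + c * (sqrt (det (G y)) * grad_loc G h y $ i)) x" for i
    by (intro pd_cong[OF open_S assms(3)])
  have dd: "(\<lambda>y. sqrt (det (G y)) * grad_loc G f y $ i) differentiable (at x)"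
    "(\<lambda>y. sqrt (det (G y)) * grad_loc G h y $ i) differentiable (at x)" for i
    by (rule smooth_onD(1)[OF smooth_on_mult[OF open_S smooth_sqrt_det smooth_grad_loc] assms(3)], fact)+
  have lin: "pd i (\<lambda>y. sqrt (det (G y)) * grad_loc G f y $ i + c * (sqrt (det (G y)) * grad_loc G h y $ i)) x
    = pd i (\<lambda>y. sqrt (det (G y)) * grad_loc G f y $ i) x + c * pd i (\<lambda>y. sqrt (det (G y)) * grad_loc G h y $ i) x" for i
    using pd_add[OF dd(1) differentiable_mult[OF differentiable_const dd(2)]]
      pd_mult[OF differentiable_const dd(2)] by (simp add: pd_const)
  show ?thesis
    unfolding laplacian_eq * lin by (simp add: add_divide_distrib distrib_left)
qed

lemma smooth_matrix_inv: "smooth_on (\<lambda>x. matrix_inv (G x) $ i $ j) S"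
proof -
  have "smooth_on (\<lambda>x. matrix_inv (G x) $ 1 $ 1) S" "smooth_on (\<lambda>x. matrix_inv (G x) $ 1 $ 2) S"
    "smooth_on (\<lambda>x. matrix_inv (G x) $ 2 $ 1) S" "smooth_on (\<lambda>x. matrix_inv (G x) $ 2 $ 2) S"
    by (subst smooth_on_cong[OF open_S matrix_inv_metric_nth(1)] smooth_on_cong[OF open_S matrix_inv_metric_nth(2)]
          smooth_on_cong[OF open_S matrix_inv_metric_nth(3)] smooth_on_cong[OF open_S matrix_inv_metric_nth(4)];
        auto intro!: smooth_on_divide smooth_on_minus open_S smooth_metric smooth_det det_metric_nz)+
  then show ?thesis using exhaust_2[of i] exhaust_2[of j] by auto
qed

section \<open>The Levi-Civita connection and its curvature\<close>

lemma smooth_christoffel: "smooth_on (christoffel G k i j) S"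
  unfolding christoffel_def sum_2 
  by (intro smooth_on_divide smooth_on_add smooth_on_diff smooth_on_mult open_S smooth_matrix_inv
      smooth_onD(2) smooth_metric smooth_on_const) auto

lemma christoffel_commute:
  assumes "x \<in> S"
  shows "christoffel G k i j x = christoffel G k j i x"
proof -
  have "pd l (\<lambda>y. G y $ i $ j) x = pd l (\<lambda>y. G y $ j $ i) x" for l
    by (rule pd_metric_commute[OF assms])
  then show ?thesis by (simp add: christoffel_def add_ac)
qed

lemma christoffel_lowered:
  assumes "x \<in> S"
  shows "(\<Sum>m\<in>UNIV. G x $ l $ m * christoffel G m i j x)
    = (pd i (\<lambda>y. G y $ l $ j) x + pd j (\<lambda>y. G y $ l $ i) x - pd l (\<lambda>y. G y $ i $ j) x) / 2"
proof -
  let ?c = "\<chi> l. (pd i (\<lambda>y. G y $ l $ j) x + pd j (\<lambda>y. G y $ l $ i) x - pd l (\<lambda>y. G y $ i $ j) x) / 2"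
  have "christoffel G m i j x = (matrix_inv (G x) *v ?c) $ m" for m
    by (simp add: christoffel_def matrix_vector_mult_def sum_divide_distrib)
  then have "(\<Sum>m\<in>UNIV. G x $ l $ m * christoffel G m i j x) = (G x *v (matrix_inv (G x) *v ?c)) $ l"
    by (simp add: matrix_vector_mult_def)
  then show ?thesis by (simp add: matrix_vector_mul_assoc matrix_inv_metric[OF assms])
qed

lemma metric_compatible:
  assumes "x \<in> S"
  shows "pd i (\<lambda>y. G y $ k $ l) x
    = (\<Sum>m\<in>UNIV. G x $ l $ m * christoffel G m i k x + G x $ k $ m * christoffel G m i l x)"
  unfolding sum.distrib christoffel_lowered[OF assms]
  using pd_metric_commute[OF assms, of i k l] pd_metric_commute[OF assms, of k i l]
    pd_metric_commute[OF assms, of l i k]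
  by (simp add: field_simps)

text \<open>The trace of metric compatibility; it turns \<open>div X = \<partial>\<^sub>i(\<surd>det G X\<^sup>i) / \<surd>det G\<close> into the trace of
  the covariant derivative of \<open>X\<close>.\<close>

lemma pd_sqrt_det:
  assumes x: "x \<in> S"
  shows "pd i (\<lambda>y. sqrt (det (G y))) x
    = sqrt (det (G x)) * (christoffel G 1 i 1 x + christoffel G 2 i 2 x)"
proof -
  have d: "(\<lambda>y. G y $ k $ l) differentiable (at x)" for k l
    by (rule smooth_onD(1)[OF smooth_metric x])
  have "pd i (\<lambda>y. det (G y)) x = 2 * det (G x) * (christoffel G 1 i 1 x + christoffel G 2 i 2 x)"
    unfolding det_2 using d
    by (simp add: pd_diff pd_mult metric_compatible[OF x] sum_2 metric_commute'[OF x] algebra_simps)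
  then have "pd i (\<lambda>y. sqrt (det (G y))) x
      = det (G x) / sqrt (det (G x)) * (christoffel G 1 i 1 x + christoffel G 2 i 2 x)"
    using det_metric_pos[OF x] by (simp add: pd_sqrt[OF smooth_onD(1)[OF smooth_det x]] field_simps)
  then show ?thesis
    using det_metric_pos[OF x] by (simp add: real_div_sqrt)
qed

text \<open>Differentiating \<open>\<partial>\<^sub>2 G\<^sub>k\<^sub>l\<close> and \<open>\<partial>\<^sub>1 G\<^sub>k\<^sub>l\<close>, as given by \<open>metric_compatible\<close>, once more and using that
  mixed derivatives of \<open>G\<^sub>k\<^sub>l\<close> agree shows that \<open>R(\<partial>\<^sub>1, \<partial>\<^sub>2)\<close> is skew-adjoint.\<close>

lemma riemann_skew:
  assumes x: "x \<in> S"
  shows "(\<Sum>m\<in>UNIV. G x $ l $ m * riemann G m 1 2 k x + G x $ k $ m * riemann G m 1 2 l x) = 0"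
proof -
  have d: "(\<lambda>y. G y $ k $ l) differentiable (at x)" "christoffel G m i j differentiable (at x)" for k l m i j
    by (rule smooth_onD(1)[OF smooth_metric x] smooth_onD(1)[OF smooth_christoffel x])+
  have "pd 1 (pd 2 (\<lambda>y. G y $ k $ l)) x = pd 2 (pd 1 (\<lambda>y. G y $ k $ l)) x"
    by (rule pd_commute[OF open_S x smooth_metric])
  moreover have "pd j (pd i (\<lambda>y. G y $ k $ l)) x = pd j (\<lambda>y. \<Sum>m\<in>UNIV.
      G y $ l $ m * christoffel G m i k y + G y $ k $ m * christoffel G m i l y) x" for i j
    by (rule pd_cong[OF open_S x metric_compatible])
  ultimately show ?thesis
    using d
    by (simp add: sum_2 pd_add pd_mult metric_compatible[OF x] riemann_def metric_commute'[OF x]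
        christoffel_commute[OF x, of _ 2 1] algebra_simps)
qed

lemma smooth_gauss_loc: "smooth_on (gauss_loc G) S"
proof -
  have "smooth_on (riemann G l i j k) S" for l i j k
    unfolding riemann_def sum_2
    by (intro smooth_on_add smooth_on_diff smooth_on_mult open_S smooth_christoffel smooth_onD(2))
  then have "smooth_on (\<lambda>x. inner_loc G x (\<chi> l. riemann G l 1 2 2 x) (axis 1 1)) S"
    unfolding inner_loc_def matrix_vector_mult_basis column_def inner_vec_def sum_2
    by (simp add: smooth_on_add smooth_on_mult open_S smooth_metric)
  then show ?thesis
    unfolding gauss_loc_def by (intro smooth_on_divide open_S smooth_det det_metric_nz)
qed

text \<open>In dimension two a skew-adjoint endomorphism is a multiple of the rotation, so one number, the
  Gaussian curvature, determines \<open>R(\<partial>\<^sub>1, \<partial>\<^sub>2)\<close>.\<close>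

lemma riemann_eq_gauss:
  assumes x: "x \<in> S"
  shows "riemann G 1 1 2 1 x = G x $ 1 $ 2 * gauss_loc G x"
    and "riemann G 2 1 2 1 x = - G x $ 1 $ 1 * gauss_loc G x"
    and "riemann G 1 1 2 2 x = G x $ 2 $ 2 * gauss_loc G x"
    and "riemann G 2 1 2 2 x = - G x $ 1 $ 2 * gauss_loc G x"
proof -
  define a b c d where "a = riemann G 1 1 2 1 x" and "b = riemann G 2 1 2 1 x"
    and "c = riemann G 1 1 2 2 x" and "d = riemann G 2 1 2 2 x"
  define e f h where "e = G x $ 1 $ 1" and "f = G x $ 1 $ 2" and "h = G x $ 2 $ 2"
  define K where "K = gauss_loc G x"
  have D: "e * h - f * f \<noteq> 0"
    using det_metric_nz[OF x] det_metric[OF x] by (simp add: e_def f_def h_def)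
  have "K * (e * h - f * f) = e * c + f * d"
    using D det_metric[OF x]
    by (simp add: K_def gauss_loc_def inner_loc_def matrix_vector_mult_basis column_def inner_vec_def
        sum_2 metric_commute'[OF x] a_def b_def c_def d_def e_def f_def h_def)
  moreover have "e * a + f * b = 0" "f * c + h * d = 0" "f * a + h * b + e * c + f * d = 0"
    using riemann_skew[OF x, of 1 1] riemann_skew[OF x, of 2 2] riemann_skew[OF x, of 1 2]
    by (simp_all add: sum_2 metric_commute'[OF x] a_def b_def c_def d_def e_def f_def h_def)
  ultimately have "(e * h - f * f) * a = (e * h - f * f) * (f * K)"
    "(e * h - f * f) * b = (e * h - f * f) * (- e * K)"
    "(e * h - f * f) * c = (e * h - f * f) * (h * K)"
    "(e * h - f * f) * d = (e * h - f * f) * (- f * K)"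
    by algebra+
  then have "a = f * K" "b = - e * K" "c = h * K" "d = - f * K"
    using D by (metis mult_left_cancel)+
  then show "riemann G 1 1 2 1 x = G x $ 1 $ 2 * gauss_loc G x"
    "riemann G 2 1 2 1 x = - G x $ 1 $ 1 * gauss_loc G x"
    "riemann G 1 1 2 2 x = G x $ 2 $ 2 * gauss_loc G x"
    "riemann G 2 1 2 2 x = - G x $ 1 $ 2 * gauss_loc G x"
    by (simp_all add: a_def b_def c_def d_def e_def f_def h_def K_def)
qed

end

section \<open>Commuting frames\<close>

text \<open>The derivation \<open>f \<mapsto> (a \<and> df) / J\<close> of a covector field \<open>a\<close>. When \<open>J dx \<and> dy = a \<and> b\<close>, the
  brackets of \<open>a\<close> and \<open>b\<close> are, up to sign, the vector fields dual to the coframe \<open>(b, a)\<close>.\<close>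

definition bracket :: "(real^2 \<Rightarrow> real) \<Rightarrow> (real^2 \<Rightarrow> real) \<Rightarrow> (real^2 \<Rightarrow> real) \<Rightarrow> (real^2 \<Rightarrow> real)
    \<Rightarrow> real^2 \<Rightarrow> real" where
  "bracket J a1 a2 f x = (a1 x * pd 2 f x - a2 x * pd 1 f x) / J x"

lemma bracket_cong:
  assumes "open S" "x \<in> S" "\<And>y. y \<in> S \<Longrightarrow> f y = g y"
  shows "bracket J a1 a2 f x = bracket J a1 a2 g x"
  by (simp add: bracket_def pd_cong[OF assms])

lemma smooth_bracket:
  assumes "open S" "smooth_on J S" "smooth_on a1 S" "smooth_on a2 S" "smooth_on f S" "\<And>y. y \<in> S \<Longrightarrow> J y \<noteq> 0"
  shows "smooth_on (bracket J a1 a2 f) S"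
  unfolding bracket_def
  by (intro smooth_on_divide smooth_on_diff smooth_on_mult smooth_onD(2) assms)

lemma bracket_add:
  assumes "f differentiable (at x)" "g differentiable (at x)"
  shows "bracket J a1 a2 (\<lambda>y. f y + g y) x = bracket J a1 a2 f x + bracket J a1 a2 g x"
  by (simp add: bracket_def pd_add[OF assms] add_divide_distrib diff_divide_distrib algebra_simps)

lemma bracket_divide:
  assumes "f differentiable (at x)" "g differentiable (at x)" "g x \<noteq> 0"
  shows "bracket J a1 a2 (\<lambda>y. f y / g y) x
    = (bracket J a1 a2 f x * g x - f x * bracket J a1 a2 g x) / (g x * g x)"
  using assms(3) by (simp add: bracket_def pd_divide[OF assms] divide_simps) (simp add: algebra_simps)

text \<open>If \<open>a\<close> and \<open>b\<close> are closed, they are locally the differentials of coordinates, and the two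
  brackets are coordinate derivatives up to sign; hence they commute. The proof is the direct
  calculation, in which closedness at the single point \<open>x\<close> is enough.\<close>

lemma bracket_commute:
  assumes S: "open S" "x \<in> S"
    and smooth: "smooth_on a1 S" "smooth_on a2 S" "smooth_on b1 S" "smooth_on b2 S" "smooth_on f S"
    and closed: "pd 1 a2 x = pd 2 a1 x" "pd 1 b2 x = pd 2 b1 x"
    and J: "\<And>y. y \<in> S \<Longrightarrow> J y = a1 y * b2 y - a2 y * b1 y" "\<And>y. y \<in> S \<Longrightarrow> J y \<noteq> 0"
  shows "bracket J b1 b2 (bracket J a1 a2 f) x = bracket J a1 a2 (bracket J b1 b2 f) x"
proof -
  have d: "a1 differentiable (at x)" "a2 differentiable (at x)" "b1 differentiable (at x)"
    "b2 differentiable (at x)" "pd i f differentiable (at x)" for i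
    using smooth S by (auto intro: smooth_onD)
  have smooth_J: "smooth_on J S"
    by (subst smooth_on_cong[OF S(1) J(1)]) (auto intro!: smooth_on_diff smooth_on_mult S smooth)
  have dJ: "J differentiable (at x)" using smooth_onD(1)[OF smooth_J S(2)] .
  have pJ: "pd i J x = pd i a1 x * b2 x + a1 x * pd i b2 x - (pd i a2 x * b1 x + a2 x * pd i b1 x)" for i
    using d by (simp add: pd_cong[OF S J(1)] pd_diff pd_mult)
  have pB: "pd i (bracket J c1 c2 f) x
      = ((pd i c1 x * pd 2 f x + c1 x * pd i (pd 2 f) x - (pd i c2 x * pd 1 f x + c2 x * pd i (pd 1 f) x)) * J x
        - (c1 x * pd 2 f x - c2 x * pd 1 f x) * pd i J x) / (J x * J x)"
    if "c1 differentiable (at x)" "c2 differentiable (at x)" for i c1 c2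
    unfolding bracket_def[abs_def] using that d dJ J(2)[OF S(2)] by (simp add: pd_divide pd_diff pd_mult)
  have comm: "pd 2 (pd 1 f) x = pd 1 (pd 2 f) x" by (rule pd_commute[OF S smooth(5)])
  have "b1 x * pd 2 (bracket J a1 a2 f) x - b2 x * pd 1 (bracket J a1 a2 f) x
      = a1 x * pd 2 (bracket J b1 b2 f) x - a2 x * pd 1 (bracket J b1 b2 f) x"
    unfolding pB[OF d(1,2)] pB[OF d(3,4)] times_divide_eq_right diff_divide_distrib[symmetric]
      pJ closed comm J(1)[OF S(2)]
    by (rule arg_cong[where f = "\<lambda>z. z / _"]) algebra
  then show ?thesis unfolding bracket_def[of _ _ _ "bracket _ _ _ _"] by simp
qed

section \<open>Harmonic functions without critical points\<close>

locale harmonic_patch = surface_patch +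
  fixes u :: "real^2 \<Rightarrow> real"
  assumes smooth_u: "smooth_on u S"
    and harmonic: "x \<in> S \<Longrightarrow> laplacian G u x = 0"
    and noncritical: "x \<in> S \<Longrightarrow> grad_loc G u x \<noteq> 0"
begin

abbreviation W :: "2 \<Rightarrow> real^2 \<Rightarrow> real" where
  "W i \<equiv> (\<lambda>x. grad_loc G u x $ i)"

abbreviation N :: "real^2 \<Rightarrow> real" where
  "N \<equiv> grad_norm2 G u"

definition log_norm :: "real^2 \<Rightarrow> real" where
  "log_norm x = ln (N x) / 2"

text \<open>The component \<open>k\<close> of the covariant derivative \<open>\<nabla>\<^sub>i \<nabla>u\<close>, i.e. the Hessian of \<open>u\<close> with one raised
  index.\<close>

definition hess :: "2 \<Rightarrow> 2 \<Rightarrow> real^2 \<Rightarrow> real" where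
  "hess i k x = pd i (W k) x + christoffel G k i 1 x * W 1 x + christoffel G k i 2 x * W 2 x"

lemmas smooth_W = smooth_grad_loc[OF smooth_u]
lemmas smooth_N = smooth_grad_norm2[OF smooth_u]

lemma N_pos: "x \<in> S \<Longrightarrow> N x > 0"
  by (rule grad_norm2_pos[OF _ noncritical])

lemma N_nz: "x \<in> S \<Longrightarrow> N x \<noteq> 0"
  using N_pos by force

lemma smooth_log_norm: "smooth_on log_norm S"
  unfolding log_norm_def
  by (intro smooth_on_divide smooth_on_ln open_S smooth_N N_pos smooth_on_const) auto

lemma smooth_hess: "smooth_on (hess i k) S"
  unfolding hess_def
  by (intro smooth_on_add smooth_on_mult open_S smooth_onD(2) smooth_W smooth_christoffel)

lemma pd_W: "pd i (W k) x = hess i k x - christoffel G k i 1 x * W 1 x - christoffel G k i 2 x * W 2 x"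
  by (simp add: hess_def)

lemma pd_u_eq:
  assumes "x \<in> S"
  shows "pd j u x = G x $ j $ 1 * W 1 x + G x $ j $ 2 * W 2 x"
  using arg_cong[OF metric_mult_grad[OF assms, of u], of "\<lambda>v. v $ j"]
  by (simp add: matrix_vector_mult_def sum_2)

lemma hess_trace:
  assumes x: "x \<in> S"
  shows "hess 1 1 x + hess 2 2 x = 0"
proof -
  have d: "W i differentiable (at x)" for i by (rule smooth_onD(1)[OF smooth_W x])
  have dq: "(\<lambda>y. sqrt (det (G y))) differentiable (at x)" by (rule smooth_onD(1)[OF smooth_sqrt_det x])
  have "laplacian G u x = hess 1 1 x + hess 2 2 x"
    using det_metric_pos[OF x]
    by (simp add: laplacian_eq pd_mult[OF dq d] pd_sqrt_det[OF x] pd_W christoffel_commute[OF x, of _ 2 1] field_simps)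
  with harmonic[OF x] show ?thesis by simp
qed

text \<open>With the upper index lowered, the components are those of the symmetric Hessian
  \<open>\<partial>\<^sub>i \<partial>\<^sub>j u - \<Gamma>\<^sup>m\<^sub>i\<^sub>j \<partial>\<^sub>m u\<close>.\<close>

lemma hess_symmetric:
  assumes x: "x \<in> S"
  shows "G x $ 1 $ 2 * hess 1 1 x + G x $ 2 $ 2 * hess 1 2 x = G x $ 1 $ 1 * hess 2 1 x + G x $ 1 $ 2 * hess 2 2 x"
proof -
  have d: "W i differentiable (at x)" "(\<lambda>y. G y $ k $ l) differentiable (at x)" for i k l
    by (rule smooth_onD(1)[OF smooth_W x] smooth_onD(1)[OF smooth_metric x])+
  have *: "pd i (pd j u) x = pd i (\<lambda>y. G y $ j $ 1 * W 1 y + G y $ j $ 2 * W 2 y) x" for i j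
    by (rule pd_cong[OF open_S x pd_u_eq])
  have "pd 1 (pd 2 u) x = pd 2 (pd 1 u) x" by (rule pd_commute[OF open_S x smooth_u])
  then show ?thesis unfolding *
    using d by (simp add: pd_add pd_mult metric_compatible[OF x] sum_2 pd_W metric_commute'[OF x]
        christoffel_commute[OF x, of _ 2 1] algebra_simps)
qed

lemma N_eq: "x \<in> S \<Longrightarrow> N x = pd 1 u x * W 1 x + pd 2 u x * W 2 x"
  by (simp add: grad_norm2_eq algebra_simps)

lemma pd_N:
  assumes x: "x \<in> S"
  shows "pd i N x = 2 * (pd 1 u x * hess i 1 x + pd 2 u x * hess i 2 x)"
proof -
  have d: "W i differentiable (at x)" "(\<lambda>y. G y $ k $ l) differentiable (at x)" for i k l
    by (rule smooth_onD(1)[OF smooth_W x] smooth_onD(1)[OF smooth_metric x])+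
  have "pd i N x = pd i (\<lambda>y. (G y $ 1 $ 1 * W 1 y + G y $ 1 $ 2 * W 2 y) * W 1 y
      + (G y $ 2 $ 1 * W 1 y + G y $ 2 $ 2 * W 2 y) * W 2 y) x"
    by (rule pd_cong[OF open_S x]) (simp add: N_eq pd_u_eq)
  then show ?thesis
    using d by (simp add: pd_add pd_mult metric_compatible[OF x] sum_2 pd_W metric_commute'[OF x]
        christoffel_commute[OF x, of _ 2 1] pd_u_eq[OF x] algebra_simps)
qed

lemma pd_log_norm:
  assumes x: "x \<in> S"
  shows "pd i log_norm x = pd i N x / (2 * N x)"
proof -
  have d: "N differentiable (at x)" by (rule smooth_onD(1)[OF smooth_N x])
  have d': "(\<lambda>y. ln (N y)) differentiable (at x)"
    by (rule differentiable_compose_real[OF d DERIV_ln[OF N_pos[OF x]]])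
  show ?thesis
    unfolding log_norm_def[abs_def] using N_nz[OF x]
    by (simp add: pd_divide[OF d' differentiable_const] pd_const pd_ln[OF d N_pos[OF x]] field_simps)
qed

text \<open>The component \<open>i\<close> of the form \<open>\<langle>\<nabla>\<^sub>i \<nabla>u, \<star>\<nabla>u\<rangle> / |\<nabla>u|\<^sup>2\<close>, which is the Levi-Civita connection form
  of the orthonormal frame \<open>(\<nabla>u, \<star>\<nabla>u) / |\<nabla>u|\<close>.\<close>

definition connection_form :: "2 \<Rightarrow> real^2 \<Rightarrow> real" where
  "connection_form i x = sqrt (det (G x)) * (W 1 x * hess i 2 x - W 2 x * hess i 1 x) / N x"

text \<open>The Hessian \<open>H\<close> of a harmonic function is symmetric and trace-free, hence anticommutes with \<open>\<star>\<close>.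
  So \<open>H(X, \<star>\<nabla>u) = H(\<star>X, \<nabla>u)\<close>, where the left-hand side gives the connection form and the
  right-hand side half the derivative of \<open>|\<nabla>u|\<^sup>2\<close>: the connection form is the rotated differential
  of \<open>log |\<nabla>u|\<close>.\<close>

lemma grad_log_norm_eq_connection_form:
  assumes x: "x \<in> S"
  shows "sqrt (det (G x)) * grad_loc G log_norm x $ 1 = - connection_form 2 x"
    and "sqrt (det (G x)) * grad_loc G log_norm x $ 2 = connection_form 1 x"
proof -
  define e f h where "e = G x $ 1 $ 1" and "f = G x $ 1 $ 2" and "h = G x $ 2 $ 2"
  define D where "D = det (G x)"
  define p r where "p = pd 1 u x" and "r = pd 2 u x"
  define a b c d where "a = hess 1 1 x" and "b = hess 1 2 x" and "c = hess 2 1 x" and "d = hess 2 2 x"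
  note defs = e_def f_def h_def D_def p_def r_def a_def b_def c_def d_def
  have D: "D > 0" using det_metric_pos[OF x] by (simp add: D_def)
  have tr: "d = - a" using hess_trace[OF x] by (simp add: defs)
  have sym: "f * a + h * b = e * c + f * d" using hess_symmetric[OF x] by (simp add: defs)
  define A B where "A = h * p - f * r" and "B = e * r - f * p"
  have w: "W 1 x = A / D" "W 2 x = B / D"
    by (simp_all add: grad_loc_nth[OF x] defs A_def B_def)
  have N: "N x > 0" by (rule N_pos[OF x])
  have pd: "pd 1 log_norm x = (p * a + r * b) / N x" "pd 2 log_norm x = (p * c + r * d) / N x"
    using N by (simp_all add: pd_log_norm[OF x] pd_N[OF x] defs field_simps)
  have gr: "grad_loc G log_norm x $ 1 = (h * ((p * a + r * b) / N x) - f * ((p * c + r * d) / N x)) / D"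
    "grad_loc G log_norm x $ 2 = (e * ((p * c + r * d) / N x) - f * ((p * a + r * b) / N x)) / D"
    by (simp_all add: grad_loc_nth[OF x] pd) (simp_all add: defs)
  have "h * (p * a + r * b) - f * (p * c + r * d) = - (A * d - B * c)"
    "e * (p * c + r * d) - f * (p * a + r * b) = A * b - B * a"
    using tr sym unfolding A_def B_def by algebra+
  then have "(h * (p * a + r * b) - f * (p * c + r * d)) / (N x * D) = - (A * d - B * c) / (N x * D)"
    "(e * (p * c + r * d) - f * (p * a + r * b)) / (N x * D) = (A * b - B * a) / (N x * D)"
    by simp_all
  then have "(h * ((p * a + r * b) / N x) - f * ((p * c + r * d) / N x)) / D
      = - (A / D * d - B / D * c) / N x"
    "(e * ((p * c + r * d) / N x) - f * ((p * a + r * b) / N x)) / D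
      = (A / D * b - B / D * a) / N x"
    by (simp_all add: diff_divide_distrib mult_ac)
  then have "grad_loc G log_norm x $ 1 = - (W 1 x * d - W 2 x * c) / N x"
    "grad_loc G log_norm x $ 2 = (W 1 x * b - W 2 x * a) / N x"
    by (simp_all only: gr w)
  then show "sqrt (det (G x)) * grad_loc G log_norm x $ 1 = - connection_form 2 x"
    "sqrt (det (G x)) * grad_loc G log_norm x $ 2 = connection_form 1 x"
    by (simp_all add: connection_form_def a_def b_def c_def d_def diff_divide_distrib right_diff_distrib)
qed

text \<open>Commuting two covariant derivatives of \<open>\<nabla>u\<close> produces curvature. The
  Christoffel symbols on the right compensate for the left-hand side being a difference of partial
  instead of covariant derivatives.\<close>

lemma ricci_identity:
  assumes x: "x \<in> S"
  shows "pd 1 (hess 2 k) x - pd 2 (hess 1 k) x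
    = riemann G k 1 2 1 x * W 1 x + riemann G k 1 2 2 x * W 2 x
      + (christoffel G k 2 1 x * hess 1 1 x + christoffel G k 2 2 x * hess 1 2 x)
      - (christoffel G k 1 1 x * hess 2 1 x + christoffel G k 1 2 x * hess 2 2 x)"
proof -
  have d: "W i differentiable (at x)" "pd j (W i) differentiable (at x)"
    "christoffel G m i j differentiable (at x)" for i j m
    by (rule smooth_onD(1)[OF smooth_W x] smooth_onD(1)[OF smooth_onD(2)[OF smooth_W] x]
        smooth_onD(1)[OF smooth_christoffel x])+
  have *: "pd j (hess i k) x = pd j (pd i (W k)) x
      + (pd j (christoffel G k i 1) x * W 1 x + christoffel G k i 1 x * pd j (W 1) x)
      + (pd j (christoffel G k i 2) x * W 2 x + christoffel G k i 2 x * pd j (W 2) x)" for i j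
    unfolding hess_def[abs_def] using d by (simp add: pd_add pd_mult)
  have comm: "pd 1 (pd 2 (W k)) x = pd 2 (pd 1 (W k)) x" by (rule pd_commute[OF open_S x smooth_W])
  show ?thesis
    unfolding * comm pd_W riemann_def sum_2 by (simp add: algebra_simps)
qed

text \<open>The structure equation \<open>d\<omega> = - K dA\<close>. The terms quadratic in the Hessian come once from the
  numerator and once from \<open>d|\<nabla>u|\<^sup>2\<close>, and cancel.\<close>

lemma curl_connection_form:
  assumes x: "x \<in> S"
  shows "pd 1 (connection_form 2) x - pd 2 (connection_form 1) x = - sqrt (det (G x)) * gauss_loc G x"
proof -
  define q where "q = (\<lambda>y. sqrt (det (G y)))"
  define M where "M = (\<lambda>i y. W 1 y * hess i 2 y - W 2 y * hess i 1 y)"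
  have d: "W i differentiable (at x)" "hess i j differentiable (at x)" "N differentiable (at x)"
     "q differentiable (at x)" for i j
    by (rule smooth_onD(1)[OF smooth_W x] smooth_onD(1)[OF smooth_hess x] smooth_onD(1)[OF smooth_N x]
        smooth_onD(1)[OF smooth_sqrt_det x, folded q_def])+
  have dM: "M i differentiable (at x)" for i unfolding M_def using d by simp
  have pq: "pd i q x = q x * (christoffel G 1 i 1 x + christoffel G 2 i 2 x)" for i
    unfolding q_def by (rule pd_sqrt_det[OF x])
  have pM: "pd j (M i) x = pd j (W 1) x * hess i 2 x + W 1 x * pd j (hess i 2) x
      - (pd j (W 2) x * hess i 1 x + W 2 x * pd j (hess i 1) x)" for i j
    unfolding M_def using d by (simp add: pd_diff pd_mult)
  have pC: "pd j (connection_form i) x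
      = (pd j q x * M i x + q x * pd j (M i) x) / N x - q x * M i x * pd j N x / (N x * N x)" for i j
  proof -
    have "connection_form i = (\<lambda>y. q y * M i y / N y)"
      by (simp add: fun_eq_iff connection_form_def q_def M_def)
    then show ?thesis
      using N_nz[OF x] d dM by (simp add: pd_divide pd_mult diff_divide_distrib)
  qed
  \<comment> \<open>The determinant of the Hessian, the quantity that cancels.\<close>
  define H where "H = hess 1 1 x * hess 2 2 x - hess 1 2 x * hess 2 1 x"
  have R: "W 1 x * (riemann G 2 1 2 1 x * W 1 x + riemann G 2 1 2 2 x * W 2 x)
      - W 2 x * (riemann G 1 1 2 1 x * W 1 x + riemann G 1 1 2 2 x * W 2 x) = - gauss_loc G x * N x"
    by (simp add: riemann_eq_gauss[OF x] N_eq[OF x] pd_u_eq[OF x] metric_commute'[OF x] algebra_simps)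
  have 1: "(pd 1 q x * M 2 x + q x * pd 1 (M 2) x) - (pd 2 q x * M 1 x + q x * pd 2 (M 1) x)
      = q x * (2 * H - gauss_loc G x * N x)"
  proof -
    have r1: "pd 1 (hess 2 k) x = pd 2 (hess 1 k) x + (riemann G k 1 2 1 x * W 1 x + riemann G k 1 2 2 x * W 2 x
      + (christoffel G k 2 1 x * hess 1 1 x + christoffel G k 2 2 x * hess 1 2 x)
      - (christoffel G k 1 1 x * hess 2 1 x + christoffel G k 1 2 x * hess 2 2 x))" for k
      using ricci_identity[OF x, of k] by simp
    have "(pd 1 q x * M 2 x + q x * pd 1 (M 2) x) - (pd 2 q x * M 1 x + q x * pd 2 (M 1) x)
      = q x * (2 * H + (W 1 x * (riemann G 2 1 2 1 x * W 1 x + riemann G 2 1 2 2 x * W 2 x)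
      - W 2 x * (riemann G 1 1 2 1 x * W 1 x + riemann G 1 1 2 2 x * W 2 x)))"
      unfolding pM pq
      unfolding pd_W r1 H_def M_def christoffel_commute[OF x, of _ 2 1]
      by (simp add: algebra_simps)
    then show ?thesis unfolding R by simp
  qed
  have 2: "M 2 x * pd 1 N x - M 1 x * pd 2 N x = 2 * H * N x"
    unfolding M_def pd_N[OF x] N_eq[OF x] H_def by algebra
  have "pd 1 (connection_form 2) x - pd 2 (connection_form 1) x
    = ((pd 1 q x * M 2 x + q x * pd 1 (M 2) x) - (pd 2 q x * M 1 x + q x * pd 2 (M 1) x)) / N x
      - q x * (M 2 x * pd 1 N x - M 1 x * pd 2 N x) / (N x * N x)"
    unfolding pC by (simp add: diff_divide_distrib algebra_simps)
  also have "\<dots> = - q x * gauss_loc G x"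
    unfolding 1 2 using N_nz[OF x] by (simp add: divide_simps) (simp add: algebra_simps)
  finally show ?thesis by (simp add: q_def)
qed

text \<open>Up to the area density, the divergence of \<open>\<nabla>log |\<nabla>u|\<close> is minus the curl of the connection form.\<close>

lemma gauss_eq_laplacian_log_norm:
  assumes x: "x \<in> S"
  shows "gauss_loc G x = laplacian G log_norm x"
proof -
  have d: "connection_form i differentiable (at x)" for i
  proof (rule smooth_onD(1)[OF _ x])
    show "smooth_on (connection_form i) S"
      unfolding connection_form_def
      by (intro smooth_on_divide smooth_on_mult smooth_on_diff open_S smooth_sqrt_det smooth_W
          smooth_hess smooth_N N_nz)
  qed
  have "pd 1 (\<lambda>y. sqrt (det (G y)) * grad_loc G log_norm y $ 1) x = pd 1 (\<lambda>y. - connection_form 2 y) x"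
    "pd 2 (\<lambda>y. sqrt (det (G y)) * grad_loc G log_norm y $ 2) x = pd 2 (connection_form 1) x"
    by (rule pd_cong[OF open_S x]; simp add: grad_log_norm_eq_connection_form)+
  then have "laplacian G log_norm x
      = - (pd 1 (connection_form 2) x - pd 2 (connection_form 1) x) / sqrt (det (G x))"
    by (simp add: laplacian_eq pd_minus d)
  then show ?thesis
    unfolding curl_connection_form[OF x] using det_metric_nz[OF x] by simp
qed

end

section \<open>The frame of the curves of steepest descent and the level curves\<close>

context harmonic_patch
begin

text \<open>The density of \<open>du \<and> \<star>du = |\<nabla>u|\<^sup>2 dA\<close>, so that \<open>along\<close> and \<open>across\<close> below are differentiation
  by \<open>\<nabla>u / |\<nabla>u|\<^sup>2\<close> and by \<open>\<star>\<nabla>u / |\<nabla>u|\<^sup>2\<close>. As brackets they belong to the forms \<open>- \<star>du\<close> and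
  \<open>du\<close>, which are closed, the former since \<open>u\<close> is harmonic.\<close>

definition area :: "real^2 \<Rightarrow> real" where
  "area x = sqrt (det (G x)) * N x"

definition along :: "(real^2 \<Rightarrow> real) \<Rightarrow> real^2 \<Rightarrow> real" where
  "along = bracket area (\<lambda>y. sqrt (det (G y)) * W 2 y) (\<lambda>y. - (sqrt (det (G y)) * W 1 y))"

definition across :: "(real^2 \<Rightarrow> real) \<Rightarrow> real^2 \<Rightarrow> real" where
  "across = bracket area (pd 1 u) (pd 2 u)"

lemma smooth_area: "smooth_on area S"
  unfolding area_def by (intro smooth_on_mult open_S smooth_sqrt_det smooth_N)

lemma sqrt_det_pos: "x \<in> S \<Longrightarrow> sqrt (det (G x)) > 0"
  by (simp add: det_metric_pos)

lemma area_pos: "x \<in> S \<Longrightarrow> area x > 0"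
  by (simp add: area_def N_pos det_metric_pos)

lemma area_nz: "x \<in> S \<Longrightarrow> area x \<noteq> 0"
  using area_pos by force

lemma smooth_flux: "smooth_on (\<lambda>y. sqrt (det (G y)) * W i y) S"
  by (intro smooth_on_mult open_S smooth_sqrt_det smooth_W)

lemma smooth_along: "smooth_on f S \<Longrightarrow> smooth_on (along f) S"
  unfolding along_def
  by (intro smooth_bracket smooth_on_minus open_S smooth_flux smooth_area area_nz)

lemma smooth_across: "smooth_on f S \<Longrightarrow> smooth_on (across f) S"
  unfolding across_def
  by (intro smooth_bracket open_S smooth_onD(2) smooth_u smooth_area area_nz)

lemma flux_divergence_free:
  assumes "x \<in> S"
  shows "pd 1 (\<lambda>y. sqrt (det (G y)) * W 1 y) x + pd 2 (\<lambda>y. sqrt (det (G y)) * W 2 y) x = 0"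
  using harmonic[OF assms] sqrt_det_pos[OF assms] by (simp add: laplacian_eq)

lemma along_across_commute:
  assumes x: "x \<in> S" and f: "smooth_on f S"
  shows "across (along f) x = along (across f) x"
  unfolding along_def across_def
proof (rule bracket_commute[OF open_S x _ _ _ _ f])
  show "pd 1 (\<lambda>y. - (sqrt (det (G y)) * W 1 y)) x = pd 2 (\<lambda>y. sqrt (det (G y)) * W 2 y) x"
    using flux_divergence_free[OF x] by (simp add: pd_minus[OF smooth_onD(1)[OF smooth_flux x]])
  show "pd 1 (pd 2 u) x = pd 2 (pd 1 u) x" by (rule pd_commute[OF open_S x smooth_u])
  show "area y = sqrt (det (G y)) * W 2 y * pd 2 u y - - (sqrt (det (G y)) * W 1 y) * pd 1 u y"
    if "y \<in> S" for y using that by (simp add: area_def N_eq algebra_simps)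
qed (auto intro: smooth_flux smooth_on_minus open_S smooth_onD(2) smooth_u dest: area_nz)

lemma along_eq:
  assumes "x \<in> S"
  shows "along f x = (W 1 x * pd 1 f x + W 2 x * pd 2 f x) / N x"
proof -
  have "along f x = (sqrt (det (G x)) * (W 1 x * pd 1 f x + W 2 x * pd 2 f x)) / (sqrt (det (G x)) * N x)"
    by (simp add: along_def bracket_def area_def algebra_simps)
  then show ?thesis using sqrt_det_pos[OF assms] by simp
qed

lemma across_eq: "across f x = (pd 1 u x * pd 2 f x - pd 2 u x * pd 1 f x) / (sqrt (det (G x)) * N x)"
  by (simp add: across_def bracket_def area_def)

text \<open>The two fields are orthogonal and of equal length, so they expand a gradient. In the expansion of
  \<open>\<surd>det G \<nabla>f\<close> the coefficients of \<open>along f\<close> and \<open>across f\<close> form divergence-free fields, which makes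
  the Laplacian below a plain sum of squares.\<close>

lemma flux_frame:
  assumes x: "x \<in> S"
  shows "sqrt (det (G x)) * grad_loc G f x $ 1 = sqrt (det (G x)) * W 1 x * along f x - pd 2 u x * across f x"
    and "sqrt (det (G x)) * grad_loc G f x $ 2 = sqrt (det (G x)) * W 2 x * along f x + pd 1 u x * across f x"
proof -
  define e b h where "e = G x $ 1 $ 1" and "b = G x $ 1 $ 2" and "h = G x $ 2 $ 2"
  define q where "q = sqrt (det (G x))"
  define p r where "p = pd 1 f x" and "r = pd 2 f x"
  define m n where "m = W 1 x" and "n = W 2 x"
  have q: "q > 0" using sqrt_det_pos[OF x] by (simp add: q_def)
  have D: "det (G x) = q * q" using det_metric_pos[OF x] by (simp add: q_def)
  have qq: "q * q = e * h - b * b" using det_metric[OF x] D by (simp add: e_def b_def h_def)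
  have N: "N x > 0" by (rule N_pos[OF x])
  have u: "pd 1 u x = e * m + b * n" "pd 2 u x = b * m + h * n"
    by (simp_all add: pd_u_eq[OF x] metric_commute'[OF x] e_def b_def h_def m_def n_def)
  have Nx: "N x = (e * m + b * n) * m + (b * m + h * n) * n"
    by (simp add: N_eq[OF x] u m_def n_def)
  have g: "grad_loc G f x $ 1 = (h * p - b * r) / (q * q)" "grad_loc G f x $ 2 = (e * r - b * p) / (q * q)"
    by (simp_all add: grad_loc_nth[OF x] D e_def b_def h_def p_def r_def)
  have al: "along f x = (m * p + n * r) / N x" by (simp add: along_eq[OF x] m_def n_def p_def r_def)
  have ac: "across f x = ((e * m + b * n) * r - (b * m + h * n) * p) / (q * N x)"
    by (simp add: across_eq u q_def p_def r_def)
  have "(h * p - b * r) * N x = q * q * m * (m * p + n * r) - (b * m + h * n) * ((e * m + b * n) * r - (b * m + h * n) * p)"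
    "(e * r - b * p) * N x = q * q * n * (m * p + n * r) + (e * m + b * n) * ((e * m + b * n) * r - (b * m + h * n) * p)"
    unfolding Nx qq by algebra+
  then have "q * ((h * p - b * r) / (q * q)) = q * m * ((m * p + n * r) / N x)
      - (b * m + h * n) * (((e * m + b * n) * r - (b * m + h * n) * p) / (q * N x))"
    "q * ((e * r - b * p) / (q * q)) = q * n * ((m * p + n * r) / N x)
      + (e * m + b * n) * (((e * m + b * n) * r - (b * m + h * n) * p) / (q * N x))"
    using q N by (simp_all add: divide_simps)
  then show "sqrt (det (G x)) * grad_loc G f x $ 1 = sqrt (det (G x)) * W 1 x * along f x - pd 2 u x * across f x"
    "sqrt (det (G x)) * grad_loc G f x $ 2 = sqrt (det (G x)) * W 2 x * along f x + pd 1 u x * across f x"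
    unfolding g al ac u by (simp_all only: q_def m_def n_def)
qed

lemma laplacian_frame:
  assumes x: "x \<in> S" and f: "smooth_on f S"
  shows "laplacian G f x = N x * (along (along f) x + across (across f) x)"
proof -
  let ?q = "\<lambda>y. sqrt (det (G y))"
  have d: "(\<lambda>y. ?q y * W i y) differentiable (at x)" "along f differentiable (at x)"
    "across f differentiable (at x)" "pd i u differentiable (at x)" for i
    by (rule smooth_onD(1)[OF smooth_flux x] smooth_onD(1)[OF smooth_along[OF f] x]
        smooth_onD(1)[OF smooth_across[OF f] x] smooth_onD(1)[OF smooth_onD(2)[OF smooth_u] x])+
  have m: "(\<lambda>y. ?q y * W i y * along f y) differentiable (at x)"
    "(\<lambda>y. pd i u y * across f y) differentiable (at x)" for i
    by (rule differentiable_mult[OF d(1) d(2)] differentiable_mult[OF d(4) d(3)])+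
  have "pd 1 (\<lambda>y. ?q y * grad_loc G f y $ 1) x = pd 1 (\<lambda>y. ?q y * W 1 y * along f y - pd 2 u y * across f y) x"
    by (rule pd_cong[OF open_S x flux_frame(1)])
  moreover have "pd 2 (\<lambda>y. ?q y * grad_loc G f y $ 2) x = pd 2 (\<lambda>y. ?q y * W 2 y * along f y + pd 1 u y * across f y) x"
    by (rule pd_cong[OF open_S x flux_frame(2)])
  ultimately have "pd 1 (\<lambda>y. ?q y * grad_loc G f y $ 1) x + pd 2 (\<lambda>y. ?q y * grad_loc G f y $ 2) x
    = (pd 1 (\<lambda>y. ?q y * W 1 y) x + pd 2 (\<lambda>y. ?q y * W 2 y) x) * along f x
      + (pd 2 (pd 1 u) x - pd 1 (pd 2 u) x) * across f x
      + ?q x * (W 1 x * pd 1 (along f) x + W 2 x * pd 2 (along f) x)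
      + (pd 1 u x * pd 2 (across f) x - pd 2 u x * pd 1 (across f) x)"
    by (simp only: pd_diff[OF m] pd_add[OF m] pd_mult[OF d(1) d(2)] pd_mult[OF d(4) d(3)]) (simp add: algebra_simps)
  also have "\<dots> = ?q x * N x * (along (along f) x + across (across f) x)"
    using flux_divergence_free[OF x] pd_commute[OF open_S x smooth_u, of 1 2] sqrt_det_pos[OF x] N_pos[OF x]
    by (simp add: along_eq[OF x] across_eq field_simps)
  finally show ?thesis using sqrt_det_pos[OF x] by (simp add: laplacian_eq)
qed

lemma
  assumes "x \<in> S" "\<And>y. y \<in> S \<Longrightarrow> f y = g y"
  shows along_cong: "along f x = along g x" and across_cong: "across f x = across g x"
  unfolding along_def across_def by (rule bracket_cong[OF open_S assms], assumption)+

lemmas along_add = bracket_add[where J = area and ?a1.0 = "\<lambda>y. sqrt (det (G y)) * W 2 y"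
    and ?a2.0 = "\<lambda>y. - (sqrt (det (G y)) * W 1 y)", folded along_def]
lemmas across_add = bracket_add[where J = area and ?a1.0 = "pd 1 u" and ?a2.0 = "pd 2 u", folded across_def]
lemmas along_divide = bracket_divide[where J = area and ?a1.0 = "\<lambda>y. sqrt (det (G y)) * W 2 y"
    and ?a2.0 = "\<lambda>y. - (sqrt (det (G y)) * W 1 y)", folded along_def]
lemmas across_divide = bracket_divide[where J = area and ?a1.0 = "pd 1 u" and ?a2.0 = "pd 2 u", folded across_def]

text \<open>A derivation that commutes with \<open>along\<close> and \<open>across\<close> commutes with \<open>\<Delta> / |\<nabla>u|\<^sup>2\<close>, the sum of their
  squares.\<close>

lemma
  assumes x: "x \<in> S" and f: "smooth_on f S"
  shows laplacian_along: "laplacian G (along f) x = N x * along (\<lambda>y. laplacian G f y / N y) x"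
    and laplacian_across: "laplacian G (across f) x = N x * across (\<lambda>y. laplacian G f y / N y) x"
proof -
  have L: "laplacian G f y / N y = along (along f) y + across (across f) y" if "y \<in> S" for y
    using N_nz[OF that] laplacian_frame[OF that f] by simp
  note s = smooth_along[OF f] smooth_across[OF f]
  note ss = smooth_along[OF s(1)] smooth_across[OF s(2)]
  note ds = ss[THEN smooth_onD(1), OF x]
  have "along (\<lambda>y. laplacian G f y / N y) x = along (along (along f)) x + along (across (across f)) x"
    by (rule trans[OF along_cong along_add[OF ds]]; fact x L)
  also have "along (across (across f)) x = across (along (across f)) x"
    by (rule along_across_commute[OF x s(2), symmetric])
  also have "\<dots> = across (across (along f)) x"
    by (rule across_cong[OF x along_across_commute[OF _ f, symmetric]])
  finally show "laplacian G (along f) x = N x * along (\<lambda>y. laplacian G f y / N y) x"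
    by (simp add: laplacian_frame[OF x s(1)])
  have "across (\<lambda>y. laplacian G f y / N y) x = across (along (along f)) x + across (across (across f)) x"
    by (rule trans[OF across_cong across_add[OF ds]]; fact x L)
  also have "across (along (along f)) x = along (across (along f)) x"
    by (rule along_across_commute[OF x s(1)])
  also have "\<dots> = along (along (across f)) x"
    by (rule along_cong[OF x along_across_commute[OF _ f]])
  finally show "laplacian G (across f) x = N x * across (\<lambda>y. laplacian G f y / N y) x"
    by (simp add: laplacian_frame[OF x s(2)])
qed

text \<open>Differentiating \<open>\<Delta>\<psi> / |\<nabla>u|\<^sup>2 = K / |\<nabla>u|\<^sup>2\<close>. The zeroth-order term comes from the quotient rule,
  since a derivative of \<open>|\<nabla>u|\<^sup>2\<close> is \<open>2 |\<nabla>u|\<^sup>2\<close> times the same derivative of \<open>\<psi>\<close>.\<close>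

lemma
  assumes x: "x \<in> S"
  shows laplacian_along_log_norm:
      "laplacian G (along log_norm) x + 2 * gauss_loc G x * along log_norm x = along (gauss_loc G) x"
    and laplacian_across_log_norm:
      "laplacian G (across log_norm) x + 2 * gauss_loc G x * across log_norm x = across (gauss_loc G) x"
proof -
  have K: "laplacian G log_norm y / N y = gauss_loc G y / N y" if "y \<in> S" for y
    using gauss_eq_laplacian_log_norm[OF that] by simp
  have d: "gauss_loc G differentiable (at x)" "N differentiable (at x)"
    by (rule smooth_onD(1)[OF smooth_gauss_loc x] smooth_onD(1)[OF smooth_N x])+
  have *: "along log_norm x = along N x / (2 * N x)" "across log_norm x = across N x / (2 * N x)"
    by (simp_all add: along_eq[OF x] across_eq pd_log_norm[OF x] diff_divide_distrib[symmetric] add_divide_distrib[symmetric])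
  have "along (\<lambda>y. laplacian G log_norm y / N y) x = (along (gauss_loc G) x * N x - gauss_loc G x * along N x) / (N x * N x)"
    by (rule trans[OF along_cong along_divide[OF d N_nz[OF x]]]; fact x K)
  then show "laplacian G (along log_norm) x + 2 * gauss_loc G x * along log_norm x = along (gauss_loc G) x"
    unfolding laplacian_along[OF x smooth_log_norm] * using N_pos[OF x] by (simp add: field_simps)
  have "across (\<lambda>y. laplacian G log_norm y / N y) x = (across (gauss_loc G) x * N x - gauss_loc G x * across N x) / (N x * N x)"
    by (rule trans[OF across_cong across_divide[OF d N_nz[OF x]]]; fact x K)
  then show "laplacian G (across log_norm) x + 2 * gauss_loc G x * across log_norm x = across (gauss_loc G) x"
    unfolding laplacian_across[OF x smooth_log_norm] * using N_pos[OF x] by (simp add: field_simps)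
qed

lemma along_eq_inner: "x \<in> S \<Longrightarrow> along f x = inner_loc G x (grad_loc G f x) (grad_loc G u x) / N x"
  by (simp add: along_eq inner_loc_grad(2))

lemma across_eq_inner:
  assumes "x \<in> S"
  shows "across f x = inner_loc G x (grad_loc G f x) (star_loc G x (grad_loc G u x)) / N x"
  unfolding across_eq inner_loc_grad(2)[OF assms] star_loc_def metric_mult_grad[OF assms]
  by (simp add: diff_divide_distrib mult.commute)

lemma norm_loc_grad: "norm_loc G y (grad_loc G u y) = sqrt (N y)"
  by (simp add: norm_loc_def grad_norm2_def)

lemma pd_inverse_sqrt_N:
  assumes x: "x \<in> S"
  shows "pd i (\<lambda>y. inverse (sqrt (N y))) x = - pd i log_norm x / sqrt (N x)"
proof -
  have d: "N differentiable (at x)" by (rule smooth_onD(1)[OF smooth_N x])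
  have d': "(\<lambda>y. sqrt (N y)) differentiable (at x)"
    by (rule smooth_onD(1)[OF smooth_on_sqrt[OF open_S smooth_N N_pos] x])
  have "sqrt (N x) > 0" "sqrt (N x) * sqrt (N x) = N x" using N_pos[OF x] by simp_all
  then show ?thesis
    using pd_inverse[OF d', of i] pd_sqrt[OF d N_pos[OF x], of i] by (simp add: pd_log_norm[OF x] field_simps)
qed

lemma smooth_inverse_sqrt_N: "smooth_on (\<lambda>y. inverse (sqrt (N y))) S"
  using N_nz by (intro smooth_on_inverse smooth_on_sqrt open_S smooth_N N_pos) auto

text \<open>Only the factor \<open>1 / |\<nabla>u|\<close> is differentiated, because \<open>\<nabla>u\<close> is divergence-free; this identifies
  \<open>k / |\<nabla>u|\<close> with \<open>along log_norm\<close>.\<close>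

lemma div_normalized_grad:
  assumes x: "x \<in> S"
  shows "div_loc G (\<lambda>y. grad_loc G u y /\<^sub>R norm_loc G y (grad_loc G u y)) x = - sqrt (N x) * along log_norm x"
proof -
  let ?q = "\<lambda>y. sqrt (det (G y))" and ?n = "\<lambda>y. inverse (sqrt (N y))"
  have d: "(\<lambda>y. ?q y * W i y) differentiable (at x)" "?n differentiable (at x)" for i
    by (rule smooth_onD(1)[OF smooth_flux x] smooth_onD(1)[OF smooth_inverse_sqrt_N x])+
  have "div_loc G (\<lambda>y. grad_loc G u y /\<^sub>R norm_loc G y (grad_loc G u y)) x
      = (pd 1 (\<lambda>y. ?q y * W 1 y * ?n y) x + pd 2 (\<lambda>y. ?q y * W 2 y * ?n y) x) / ?q x"
    by (simp add: div_loc_def sum_2 norm_loc_grad divide_inverse mult_ac)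
  also have "\<dots> = ((pd 1 (\<lambda>y. ?q y * W 1 y) x + pd 2 (\<lambda>y. ?q y * W 2 y) x) * ?n x
      + ?q x * (W 1 x * pd 1 ?n x + W 2 x * pd 2 ?n x)) / ?q x"
    unfolding pd_mult[OF d] by (simp add: algebra_simps)
  also have "\<dots> = W 1 x * pd 1 ?n x + W 2 x * pd 2 ?n x"
    unfolding flux_divergence_free[OF x] using sqrt_det_pos[OF x] by simp
  also have "\<dots> = - (N x / sqrt (N x)) * along log_norm x"
    unfolding pd_inverse_sqrt_N[OF x] along_eq[OF x] using N_pos[OF x] by (simp add: field_simps)
  finally show ?thesis using N_pos[OF x] by (simp add: real_div_sqrt)
qed

text \<open>The field \<open>\<star>\<nabla>u\<close> is divergence-free as well, which identifies \<open>h / |\<nabla>u|\<close> with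
  \<open>- across log_norm\<close>.\<close>

lemma div_normalized_star_grad:
  assumes x: "x \<in> S"
  shows "div_loc G (\<lambda>y. star_loc G y (grad_loc G u y) /\<^sub>R norm_loc G y (grad_loc G u y)) x
    = - sqrt (N x) * across log_norm x"
proof -
  let ?q = "\<lambda>y. sqrt (det (G y))" and ?n = "\<lambda>y. inverse (sqrt (N y))"
  have d: "pd i u differentiable (at x)" "?n differentiable (at x)" for i
    by (rule smooth_onD(1)[OF smooth_onD(2)[OF smooth_u] x] smooth_onD(1)[OF smooth_inverse_sqrt_N x])+
  have s: "?q y * (star_loc G y (grad_loc G u y) /\<^sub>R norm_loc G y (grad_loc G u y)) $ 1 = - (pd 2 u y * ?n y)"
    "?q y * (star_loc G y (grad_loc G u y) /\<^sub>R norm_loc G y (grad_loc G u y)) $ 2 = pd 1 u y * ?n y" if "y \<in> S" for y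
    using det_metric_nz[OF that] by (simp_all add: star_loc_def metric_mult_grad[OF that] norm_loc_grad field_simps)
  have "div_loc G (\<lambda>y. star_loc G y (grad_loc G u y) /\<^sub>R norm_loc G y (grad_loc G u y)) x
      = (pd 1 (\<lambda>y. - (pd 2 u y * ?n y)) x + pd 2 (\<lambda>y. pd 1 u y * ?n y) x) / ?q x"
    by (simp only: div_loc_def sum_2 pd_cong[OF open_S x s(1)] pd_cong[OF open_S x s(2)])
  also have "\<dots> = ((pd 2 (pd 1 u) x - pd 1 (pd 2 u) x) * ?n x
      + (pd 1 u x * pd 2 ?n x - pd 2 u x * pd 1 ?n x)) / ?q x"
    unfolding pd_minus[OF differentiable_mult[OF d]] pd_mult[OF d] by (simp add: algebra_simps)
  also have "\<dots> = (pd 1 u x * pd 2 ?n x - pd 2 u x * pd 1 ?n x) / ?q x"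
    using pd_commute[OF open_S x smooth_u, of 1 2] by simp
  also have "\<dots> = - (N x / sqrt (N x)) * across log_norm x"
    unfolding pd_inverse_sqrt_N[OF x] across_eq using N_pos[OF x] det_metric_pos[OF x] by (simp add: field_simps)
  finally show ?thesis using N_pos[OF x] by (simp add: real_div_sqrt)
qed

text \<open>The source of the barrier in the maximum principle.\<close>

lemma laplacian_exp:
  assumes x: "x \<in> S"
  shows "laplacian G (\<lambda>y. exp (a * u y)) x = a\<^sup>2 * N x * exp (a * u x)"
proof -
  let ?q = "\<lambda>y. sqrt (det (G y))" and ?w = "\<lambda>y. exp (a * u y)"
  have du: "u differentiable (at y)" if "y \<in> S" for y by (rule smooth_onD(1)[OF smooth_u that])
  have p: "pd i ?w y = a * pd i u y * ?w y" if "y \<in> S" for y i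
    using du[OF that] pd_exp[of "\<lambda>y. a * u y" y i] by (simp add: pd_mult pd_const)
  have g: "?q y * grad_loc G ?w y $ i = ?q y * W i y * (a * ?w y)" if "y \<in> S" for y i
  proof -
    have "grad_loc G ?w y = (a * ?w y) *\<^sub>R grad_loc G u y"
      by (auto simp: vec_eq_iff forall_2 grad_loc_nth[OF that] p[OF that] field_simps)
    then show ?thesis by simp
  qed
  have d: "(\<lambda>y. ?q y * W i y) differentiable (at x)" "(\<lambda>y. a * ?w y) differentiable (at x)" "?w differentiable (at x)" for i
    by (rule smooth_onD(1)[OF smooth_flux x]
        smooth_onD(1)[OF smooth_on_mult[OF open_S smooth_on_const smooth_on_exp[OF open_S smooth_on_mult[OF open_S smooth_on_const smooth_u]]] x]
        smooth_onD(1)[OF smooth_on_exp[OF open_S smooth_on_mult[OF open_S smooth_on_const smooth_u]] x])+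
  have "laplacian G ?w x = (pd 1 (\<lambda>y. ?q y * W 1 y * (a * ?w y)) x + pd 2 (\<lambda>y. ?q y * W 2 y * (a * ?w y)) x) / ?q x"
    unfolding laplacian_eq
    by (simp only: pd_cong[OF open_S x g[where i = 1]] pd_cong[OF open_S x g[where i = 2]])
  also have "\<dots> = ((pd 1 (\<lambda>y. ?q y * W 1 y) x + pd 2 (\<lambda>y. ?q y * W 2 y) x) * (a * ?w x)
      + ?q x * a * a * (W 1 x * pd 1 u x + W 2 x * pd 2 u x) * ?w x) / ?q x"
    unfolding pd_mult[OF d(1,2)] pd_mult[OF differentiable_const d(3)] pd_const p[OF x] by (simp add: algebra_simps)
  also have "\<dots> = (?q x * (a\<^sup>2 * N x * ?w x)) / ?q x"
    unfolding flux_divergence_free[OF x] by (simp add: N_eq[OF x] power2_eq_square algebra_simps)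
  finally show ?thesis using sqrt_det_pos[OF x] by simp
qed

end

section \<open>The Laplacian at a local maximum\<close>

lemma
  assumes S: "open S" "x \<in> S" and f: "smooth_on f S" and le: "\<And>y. y \<in> S \<Longrightarrow> f y \<le> f x"
  shows pd_eq_0_at_max: "pd i f x = 0"
    and second_derivative_nonpos_at_max: "(\<Sum>i\<in>UNIV. \<Sum>j\<in>UNIV. v $ i * v $ j * pd i (pd j f) x) \<le> 0"
proof -
  have d: "f differentiable (at y)" "pd i f differentiable (at y)" if "y \<in> S" for y i
    using f that by (auto intro: smooth_onD(1) smooth_onD(1)[OF smooth_onD(2)])
  have "frechet_derivative f (at x) = (\<lambda>v. 0)"
    by (rule differential_zero_maxmin[OF S(2,1) d(1)[OF S(2), unfolded frechet_derivative_works]]) (use le in auto)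
  then have p0: "pd i f x = 0" for i by (simp add: pd_def)
  then show "pd i f x = 0" .
  \<comment> \<open>The restriction of \<open>f\<close> to the line through \<open>x\<close> in direction \<open>v\<close>: a positive second
    derivative at the critical point would make it increase strictly to the right.\<close>
  define T where "T = {t. x + t *\<^sub>R v \<in> S}"
  have "open ((\<lambda>t. x + t *\<^sub>R v) -` S)"
    by (rule open_vimage[OF S(1)]) (intro continuous_intros)
  then have T: "open T" "0 \<in> T" using S by (simp_all add: T_def vimage_def)
  define h' where "h' = (\<lambda>t. \<Sum>i\<in>UNIV. v $ i * pd i f (x + t *\<^sub>R v))"
  have h: "((\<lambda>t. f (x + t *\<^sub>R v)) has_real_derivative h' t) (at t)" if "t \<in> T" for t
    unfolding h'_def using that by (intro has_real_derivative_along_line d) (simp add: T_def)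
  define c where "c = (\<Sum>j\<in>UNIV. v $ j * (\<Sum>i\<in>UNIV. v $ i * pd i (pd j f) x))"
  have "(h' has_real_derivative c) (at 0)"
    unfolding h'_def c_def
    using has_real_derivative_along_line[of "pd _ f" x 0 v] d(2)[OF S(2)]
    by (intro DERIV_sum DERIV_cmult) auto
  moreover have h0: "h' 0 = 0" by (simp add: h'_def p0)
  ultimately have *: "\<exists>e>0. \<forall>t>0. t < e \<longrightarrow> h' t > 0" if "c > 0"
    using DERIV_pos_inc_right[of h' c 0] that by auto
  have "c \<le> 0"
  proof (rule ccontr)
    assume "\<not> c \<le> 0"
    then obtain e where e: "e > 0" "\<And>t. 0 < t \<Longrightarrow> t < e \<Longrightarrow> h' t > 0" using * by force
    obtain r where r: "r > 0" "ball 0 r \<subseteq> T" using T open_contains_ball by blast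
    define s where "s = min e r / 2"
    have s: "0 < s" "s < e" "s < r" using e r by (auto simp: s_def)
    have inT: "t \<in> T" if "0 \<le> t" "t \<le> s" for t using r s that by (auto simp: subset_iff dist_real_def)
    obtain z where z: "0 < z" "z < s" "f (x + s *\<^sub>R v) - f (x + 0 *\<^sub>R v) = (s - 0) * h' z"
      using MVT2[OF s(1), of "\<lambda>t. f (x + t *\<^sub>R v)" h'] h inT by blast
    moreover have "s * h' z > 0" using e(2)[of z] s z by simp
    ultimately have "f (x + s *\<^sub>R v) > f x" by simp
    moreover have "x + s *\<^sub>R v \<in> S" using inT[of s] s by (simp add: T_def)
    ultimately show False using le by force
  qed
  moreover have "c = (\<Sum>i\<in>UNIV. \<Sum>j\<in>UNIV. v $ i * v $ j * pd i (pd j f) x)"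
    by (simp add: c_def sum_2 algebra_simps)
  ultimately show "(\<Sum>i\<in>UNIV. \<Sum>j\<in>UNIV. v $ i * v $ j * pd i (pd j f) x) \<le> 0" by simp
qed

lemma (in surface_patch) laplacian_nonpos_at_max:
  assumes x: "x \<in> T" "open T" "T \<subseteq> S" and f: "smooth_on f T" and le: "\<And>y. y \<in> T \<Longrightarrow> f y \<le> f x"
  shows "laplacian G f x \<le> 0"
proof -
  have xS: "x \<in> S" using x by auto
  define q where "q = (\<lambda>y. sqrt (det (G y)))"
  define g where "g = (\<lambda>i j y. q y * G y $ i $ j / det (G y))"
  have dg: "g i j differentiable (at x)" for i j
    by (rule smooth_onD(1)[OF _ xS], unfold g_def q_def)
       (intro smooth_on_divide smooth_on_mult open_S smooth_sqrt_det smooth_metric smooth_det det_metric_nz)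
  have df: "pd i f differentiable (at x)" for i by (rule smooth_onD(1)[OF smooth_onD(2)[OF f] x(1)])
  note p0 = pd_eq_0_at_max[OF x(2,1) f le]
  have P: "pd i (\<lambda>y. g k l y * pd m f y - g k' l' y * pd m' f y) x
     = g k l x * pd i (pd m f) x - g k' l' x * pd i (pd m' f) x" for i k l m k' l' m'
    using dg df p0 by (simp add: pd_diff pd_mult)
  have fl: "q y * grad_loc G f y $ 1 = g 2 2 y * pd 1 f y - g 1 2 y * pd 2 f y"
    "q y * grad_loc G f y $ 2 = g 1 1 y * pd 2 f y - g 1 2 y * pd 1 f y" if "y \<in> S" for y
    using that by (simp_all add: grad_loc_nth g_def right_diff_distrib diff_divide_distrib mult_ac)
  have "pd 1 (\<lambda>y. q y * grad_loc G f y $ 1) x = pd 1 (\<lambda>y. g 2 2 y * pd 1 f y - g 1 2 y * pd 2 f y) x"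
    "pd 2 (\<lambda>y. q y * grad_loc G f y $ 2) x = pd 2 (\<lambda>y. g 1 1 y * pd 2 f y - g 1 2 y * pd 1 f y) x"
    by (rule pd_cong[OF open_S xS]; simp add: fl)+
  note this[unfolded P]
  then have "laplacian G f x = (g 2 2 x * pd 1 (pd 1 f) x - g 1 2 x * pd 1 (pd 2 f) x
      + (g 1 1 x * pd 2 (pd 2 f) x - g 1 2 x * pd 2 (pd 1 f) x)) / q x"
    by (simp add: laplacian_eq q_def)
  also have "\<dots> = (G x $ 2 $ 2 * pd 1 (pd 1 f) x - 2 * G x $ 1 $ 2 * pd 1 (pd 2 f) x
      + G x $ 1 $ 1 * pd 2 (pd 2 f) x) / det (G x)"
    using pd_commute[OF x(2,1) f, of 2 1] det_metric_pos[OF xS] by (simp add: g_def q_def field_simps)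
  also have "\<dots> \<le> 0"
  proof -
    define e b h where "e = G x $ 1 $ 1" and "b = G x $ 1 $ 2" and "h = G x $ 2 $ 2"
    define D where "D = det (G x)"
    have D: "D > 0" "D = e * h - b * b" using det_metric_pos[OF xS] det_metric[OF xS]
      by (simp_all add: D_def e_def b_def h_def)
    have e: "e > 0" using metric_11_pos[OF xS] by (simp add: e_def)
    note neg = second_derivative_nonpos_at_max[OF x(2,1) f le, unfolded sum_2]
    define X Y Z where "X = pd 1 (pd 1 f) x" and "Y = pd 1 (pd 2 f) x" and "Z = pd 2 (pd 2 f) x"
    have Y: "pd 2 (pd 1 f) x = Y" unfolding Y_def by (rule pd_commute[OF x(2,1) f])
    \<comment> \<open>The Hessian is evaluated on a \<open>G\<close>-orthogonal frame containing \<open>\<partial>\<^sub>1\<close>.\<close>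
    have "X \<le> 0" using neg[of "vector [1, 0]"] by (simp add: X_def)
    moreover have "b * b * X - 2 * b * e * Y + e * e * Z \<le> 0"
      using neg[of "vector [- b, e]"] unfolding Y X_def[symmetric] Y_def[symmetric] Z_def[symmetric]
      by (simp add: algebra_simps)
    ultimately have "D * X + (b * b * X - 2 * b * e * Y + e * e * Z) \<le> 0"
      using D by (smt (verit) mult_nonneg_nonpos)
    then have "e * (h * X - 2 * b * Y + e * Z) \<le> 0" unfolding D(2) by (simp add: algebra_simps)
    then have "h * X - 2 * b * Y + e * Z \<le> 0" using e by (simp add: mult_le_0_iff)
    then show ?thesis using D(1)
      by (simp add: divide_le_0_iff X_def Y_def Z_def e_def b_def h_def D_def)
  qed
  finally show ?thesis .
qed

section \<open>Change of coordinates\<close>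

lemma laplacian_cong:
  assumes "open S" "x \<in> S" "\<And>y. y \<in> S \<Longrightarrow> f y = g y"
  shows "laplacian G f x = laplacian G g x"
proof -
  have p: "pd i f y = pd i g y" if "y \<in> S" for y i by (rule pd_cong[OF assms(1) that assms(3)])
  have "pd i (\<lambda>y. sqrt (det (G y)) * grad_loc G f y $ i) x = pd i (\<lambda>y. sqrt (det (G y)) * grad_loc G g y $ i) x" for i
    by (rule pd_cong[OF assms(1,2)]) (simp add: grad_loc_def p)
  then show ?thesis by (simp add: laplacian_def div_loc_def)
qed

lemma grad_loc_cong:
  assumes "open S" "x \<in> S" "\<And>y. y \<in> S \<Longrightarrow> f y = g y"
  shows "grad_loc G f x = grad_loc G g x"
  by (simp add: grad_loc_def pd_cong[OF assms])

text \<open>\<open>T\<close> is a change of coordinates from \<open>S\<close> to \<open>S'\<close> under which \<open>G\<close> is the pullback of \<open>G'\<close>. Positive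
  definiteness of \<open>G\<close> forces its Jacobian to be invertible.\<close>

locale coordinate_change = c: surface_patch S G + d: surface_patch S' G'
  for S :: "(real^2) set" and G and S' :: "(real^2) set" and G' +
  fixes T :: "real^2 \<Rightarrow> real^2"
  assumes T_maps: "x \<in> S \<Longrightarrow> T x \<in> S'"
    and smooth_T: "smooth_on (\<lambda>x. T x $ i) S"
    and metric_pullback: "x \<in> S \<Longrightarrow>
      G x = transpose (matrix (frechet_derivative T (at x))) ** G' (T x) ** matrix (frechet_derivative T (at x))"
begin

definition t :: "2 \<Rightarrow> 2 \<Rightarrow> real^2 \<Rightarrow> real" where
  "t j i = pd i (\<lambda>y. T y $ j)"

definition jac :: "real^2 \<Rightarrow> real" where
  "jac x = t 1 1 x * t 2 2 x - t 1 2 x * t 2 1 x"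

lemma T_has_derivative:
  assumes "x \<in> S"
  shows "(T has_derivative (\<lambda>v. \<chi> j. \<Sum>i\<in>UNIV. v $ i * t j i x)) (at x)"
proof -
  have "((\<lambda>y. T y $ j) has_derivative (\<lambda>v. \<Sum>i\<in>UNIV. v $ i * t j i x)) (at x)" for j
    unfolding t_def by (rule has_derivative_pd[OF smooth_onD(1)[OF smooth_T assms]])
  then show ?thesis
    by (subst has_derivative_componentwise_within) (auto simp: Basis_vec_def inner_axis)
qed

lemma jacobian_nth:
  assumes "x \<in> S"
  shows "matrix (frechet_derivative T (at x)) $ j $ i = t j i x"
proof -
  have "frechet_derivative T (at x) = (\<lambda>v. \<chi> j. \<Sum>i\<in>UNIV. v $ i * t j i x)"
    using frechet_derivative_at[OF T_has_derivative[OF assms]] by simp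
  then show ?thesis
    by (simp add: matrix_def axis_def if_distrib[of "\<lambda>z. z * _"] cong: if_cong)
qed

lemma det_jacobian: "x \<in> S \<Longrightarrow> det (matrix (frechet_derivative T (at x))) = jac x"
  by (simp add: det_2 jacobian_nth jac_def)

lemma pullback_nth:
  assumes x: "x \<in> S"
  defines "H \<equiv> G' (T x)"
  shows "G x $ i $ j = H $ 1 $ 1 * t 1 i x * t 1 j x + H $ 1 $ 2 * (t 1 i x * t 2 j x + t 2 i x * t 1 j x)
      + H $ 2 $ 2 * t 2 i x * t 2 j x"
  unfolding metric_pullback[OF x] matrix_matrix_mult_def transpose_def
  using d.metric_commute'[OF T_maps[OF x]]
  by (simp add: jacobian_nth[OF x] sum_2 H_def algebra_simps)

lemma det_pullback:
  assumes x: "x \<in> S"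
  shows "det (G x) = (jac x)\<^sup>2 * det (G' (T x))"
  unfolding metric_pullback[OF x] det_mul det_transpose det_jacobian[OF x] by (simp add: power2_eq_square)

lemma jac_nz: "x \<in> S \<Longrightarrow> jac x \<noteq> 0"
  using det_pullback[of x] c.det_metric_pos[of x] by auto

lemma sqrt_det_pullback:
  assumes x: "x \<in> S"
  shows "sqrt (det (G x)) = \<bar>jac x\<bar> * sqrt (det (G' (T x)))"
  by (simp add: det_pullback[OF x] real_sqrt_mult)

lemma smooth_t: "smooth_on (t j i) S"
  unfolding t_def by (rule smooth_onD(2)[OF smooth_T])

lemma smooth_jac: "smooth_on jac S"
  unfolding jac_def by (intro smooth_on_diff smooth_on_mult c.open_S smooth_t)

lemma
  assumes x: "x \<in> S" and f: "f differentiable (at (T x))"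
  shows pd_compose: "pd i (\<lambda>y. f (T y)) x = t 1 i x * pd 1 f (T x) + t 2 i x * pd 2 f (T x)"
    and differentiable_compose: "(\<lambda>y. f (T y)) differentiable (at x)"
proof -
  have *: "((\<lambda>y. f (T y)) has_derivative (\<lambda>v. \<Sum>k\<in>UNIV. (\<chi> j. \<Sum>i\<in>UNIV. v $ i * t j i x) $ k * pd k f (T x))) (at x)"
    by (rule has_derivative_compose[OF T_has_derivative[OF x] has_derivative_pd[OF f]])
  then show "(\<lambda>y. f (T y)) differentiable (at x)" by (auto simp: differentiable_def)
  have "(\<Sum>k\<in>UNIV. (axis i 1 :: real^2) $ k * t j k x) = t j i x" for j
    by (simp add: axis_def if_distrib[of "\<lambda>z. z * _"] cong: if_cong)
  then show "pd i (\<lambda>y. f (T y)) x = t 1 i x * pd 1 f (T x) + t 2 i x * pd 2 f (T x)"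
    by (simp add: pd_eqI[OF *] sum_2)
qed

lemma inner_grad_invariant:
  assumes x: "x \<in> S" and f: "f differentiable (at (T x))" and h: "h differentiable (at (T x))"
  shows "inner_loc G x (grad_loc G (\<lambda>y. f (T y)) x) (grad_loc G (\<lambda>y. h (T y)) x)
    = inner_loc G' (T x) (grad_loc G' f (T x)) (grad_loc G' h (T x))"
proof -
  let ?n = "G' (T x) $ 2 $ 2 * (pd 1 f (T x) * pd 1 h (T x))
      - G' (T x) $ 1 $ 2 * (pd 1 f (T x) * pd 2 h (T x) + pd 2 f (T x) * pd 1 h (T x))
      + G' (T x) $ 1 $ 1 * (pd 2 f (T x) * pd 2 h (T x))"
  have "inner_loc G x (grad_loc G (\<lambda>y. f (T y)) x) (grad_loc G (\<lambda>y. h (T y)) x)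
    = ((jac x)\<^sup>2 * ?n) / det (G x)"
    unfolding c.inner_grad_explicit[OF x] pd_compose[OF x f] pd_compose[OF x h] pullback_nth[OF x] jac_def power2_eq_square
    by (rule arg_cong[where f = "\<lambda>z. z / _"]) algebra
  then show ?thesis
    using jac_nz[OF x] by (simp add: det_pullback[OF x] d.inner_grad_explicit[OF T_maps[OF x]])
qed

lemma bracket_invariant:
  assumes x: "x \<in> S" and f: "f differentiable (at (T x))" and h: "h differentiable (at (T x))"
    and pos: "jac x > 0"
  shows "(pd 1 (\<lambda>y. f (T y)) x * pd 2 (\<lambda>y. h (T y)) x - pd 2 (\<lambda>y. f (T y)) x * pd 1 (\<lambda>y. h (T y)) x) / sqrt (det (G x))
    = (pd 1 f (T x) * pd 2 h (T x) - pd 2 f (T x) * pd 1 h (T x)) / sqrt (det (G' (T x)))"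
proof -
  have "pd 1 (\<lambda>y. f (T y)) x * pd 2 (\<lambda>y. h (T y)) x - pd 2 (\<lambda>y. f (T y)) x * pd 1 (\<lambda>y. h (T y)) x
    = jac x * (pd 1 f (T x) * pd 2 h (T x) - pd 2 f (T x) * pd 1 h (T x))"
    unfolding pd_compose[OF x f] pd_compose[OF x h] jac_def by algebra
  then show ?thesis using pos by (simp add: sqrt_det_pullback[OF x])
qed

text \<open>The density \<open>\<surd>det G \<nabla>f\<close> transforms with the adjugate of the Jacobian (Piola transform),
  up to the orientation sign.\<close>

lemma flux_pullback:
  assumes x: "x \<in> S" and f: "f differentiable (at (T x))"
  defines "P \<equiv> \<lambda>i y. sqrt (det (G' y)) * grad_loc G' f y $ i"
  shows "sqrt (det (G x)) * grad_loc G (\<lambda>y. f (T y)) x $ 1 = sgn (jac x) * (t 2 2 x * P 1 (T x) - t 1 2 x * P 2 (T x))"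
    and "sqrt (det (G x)) * grad_loc G (\<lambda>y. f (T y)) x $ 2 = sgn (jac x) * (t 1 1 x * P 2 (T x) - t 2 1 x * P 1 (T x))"
proof -
  define j where "j = jac x"
  define q where "q = sqrt (det (G' (T x)))"
  define A B where "A = G' (T x) $ 2 $ 2 * pd 1 f (T x) - G' (T x) $ 1 $ 2 * pd 2 f (T x)"
    and "B = G' (T x) $ 1 $ 1 * pd 2 f (T x) - G' (T x) $ 1 $ 2 * pd 1 f (T x)"
  have j: "j \<noteq> 0" using jac_nz[OF x] by (simp add: j_def)
  have D: "det (G' (T x)) \<noteq> 0" using d.det_metric_nz[OF T_maps[OF x]] .
  have P: "P 1 (T x) = q * (A / det (G' (T x)))" "P 2 (T x) = q * (B / det (G' (T x)))"
    by (simp_all add: P_def q_def A_def B_def d.grad_loc_nth[OF T_maps[OF x]])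
  have sg: "\<bar>j\<bar> * j / j\<^sup>2 = sgn j" using j by (simp add: sgn_if power2_eq_square)
  have "G x $ 2 $ 2 * pd 1 (\<lambda>y. f (T y)) x - G x $ 1 $ 2 * pd 2 (\<lambda>y. f (T y)) x = j * (t 2 2 x * A - t 1 2 x * B)"
    "G x $ 1 $ 1 * pd 2 (\<lambda>y. f (T y)) x - G x $ 1 $ 2 * pd 1 (\<lambda>y. f (T y)) x = j * (t 1 1 x * B - t 2 1 x * A)"
    unfolding pd_compose[OF x f] pullback_nth[OF x] A_def B_def j_def jac_def by algebra+
  then have "sqrt (det (G x)) * grad_loc G (\<lambda>y. f (T y)) x $ 1
      = \<bar>j\<bar> * q * (j * (t 2 2 x * A - t 1 2 x * B)) / (j\<^sup>2 * det (G' (T x)))"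
    "sqrt (det (G x)) * grad_loc G (\<lambda>y. f (T y)) x $ 2
      = \<bar>j\<bar> * q * (j * (t 1 1 x * B - t 2 1 x * A)) / (j\<^sup>2 * det (G' (T x)))"
    unfolding sqrt_det_pullback[OF x, folded j_def q_def]
    unfolding c.grad_loc_nth[OF x] det_pullback[OF x, folded j_def] by simp_all
  then have "sqrt (det (G x)) * grad_loc G (\<lambda>y. f (T y)) x $ 1
      = (\<bar>j\<bar> * j / j\<^sup>2) * (q * (t 2 2 x * A - t 1 2 x * B) / det (G' (T x)))"
    "sqrt (det (G x)) * grad_loc G (\<lambda>y. f (T y)) x $ 2
      = (\<bar>j\<bar> * j / j\<^sup>2) * (q * (t 1 1 x * B - t 2 1 x * A) / det (G' (T x)))"
    by (simp_all only: times_divide_times_eq mult_ac)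
  then show "sqrt (det (G x)) * grad_loc G (\<lambda>y. f (T y)) x $ 1 = sgn (jac x) * (t 2 2 x * P 1 (T x) - t 1 2 x * P 2 (T x))"
    "sqrt (det (G x)) * grad_loc G (\<lambda>y. f (T y)) x $ 2 = sgn (jac x) * (t 1 1 x * P 2 (T x) - t 2 1 x * P 1 (T x))"
    unfolding sg P j_def[symmetric] by (simp_all add: diff_divide_distrib right_diff_distrib mult_ac)
qed

text \<open>The columns of the adjugate are divergence-free because mixed derivatives of \<open>T\<close> agree, so
  the divergence of the flux is only multiplied by the Jacobian determinant.\<close>

lemma laplacian_invariant:
  assumes x: "x \<in> S" and f: "smooth_on f S'"
  shows "laplacian G (\<lambda>y. f (T y)) x = laplacian G' f (T x)"
proof -
  define s where "s = sgn (jac x)"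
  define P where "P = (\<lambda>i y. sqrt (det (G' y)) * grad_loc G' f y $ i)"
  \<comment> \<open>The orientation sign is constant near \<open>x\<close>, hence is not differentiated.\<close>
  define S0 where "S0 = S \<inter> {y. s * jac y > 0}"
  have "open S0"
  proof -
    have "continuous_on S (\<lambda>y. s * jac y)" by (intro continuous_intros smooth_onD(3)[OF smooth_jac])
    then have "open (S \<inter> (\<lambda>y. s * jac y) -` {0<..})"
      by (rule continuous_open_preimage[OF _ c.open_S open_greaterThan])
    then show ?thesis by (simp add: S0_def vimage_def greaterThan_def)
  qed
  have xS0: "x \<in> S0" using x jac_nz[OF x] by (auto simp: S0_def s_def sgn_if)
  have sg: "y \<in> S \<and> sgn (jac y) = s" if "y \<in> S0" for y
    using that jac_nz[OF x] by (auto simp: S0_def s_def sgn_if split: if_splits)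
  have f': "f differentiable (at (T y))" if "y \<in> S" for y using smooth_onD(1)[OF f T_maps[OF that]] .
  have P': "P i differentiable (at (T x))" for i
    unfolding P_def
    by (rule smooth_onD(1)[OF smooth_on_mult[OF d.open_S d.smooth_sqrt_det d.smooth_grad_loc[OF f]] T_maps[OF x]])
  have dt: "t i j differentiable (at x)" for i j by (rule smooth_onD(1)[OF smooth_t x])
  have dP: "(\<lambda>y. P i (T y)) differentiable (at x)" for i by (rule differentiable_compose[OF x P'])
  have dm: "(\<lambda>y. t i j y * P k (T y)) differentiable (at x)" for i j k by (rule differentiable_mult[OF dt dP])
  have E: "pd m (\<lambda>y. s * (t i j y * P k (T y) - t i' j' y * P k' (T y))) x
    = s * (pd m (t i j) x * P k (T x) + t i j x * pd m (\<lambda>y. P k (T y)) x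
        - (pd m (t i' j') x * P k' (T x) + t i' j' x * pd m (\<lambda>y. P k' (T y)) x))" for m i j k i' j' k'
    by (simp add: pd_mult[OF differentiable_const differentiable_diff[OF dm dm]] pd_const
        pd_diff[OF dm dm] pd_mult[OF dt dP])
  have closed: "pd 2 (t i 1) x = pd 1 (t i 2) x" for i
    unfolding t_def by (rule pd_commute[OF c.open_S x smooth_T])
  have "pd 1 (\<lambda>y. sqrt (det (G y)) * grad_loc G (\<lambda>y. f (T y)) y $ 1) x
      = pd 1 (\<lambda>y. s * (t 2 2 y * P 1 (T y) - t 1 2 y * P 2 (T y))) x"
    "pd 2 (\<lambda>y. sqrt (det (G y)) * grad_loc G (\<lambda>y. f (T y)) y $ 2) x
      = pd 2 (\<lambda>y. s * (t 1 1 y * P 2 (T y) - t 2 1 y * P 1 (T y))) x"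
    by (rule pd_cong[OF \<open>open S0\<close> xS0], use sg flux_pullback[OF _ f'] in \<open>auto simp: P_def\<close>)+
  then have "laplacian G (\<lambda>y. f (T y)) x = s * jac x * (pd 1 (P 1) (T x) + pd 2 (P 2) (T x)) / sqrt (det (G x))"
    unfolding c.laplacian_eq E closed pd_compose[OF x P'] jac_def by (simp only: ) (simp add: algebra_simps)
  also have "s * jac x = \<bar>jac x\<bar>" by (simp add: s_def sgn_if)
  finally show ?thesis
    using jac_nz[OF x] by (simp add: sqrt_det_pullback[OF x] d.laplacian_eq P_def)
qed

end

section \<open>Harmonic functions on a surface\<close>

lemma
  assumes "is_chart c"
  shows open_chart_domain: "open (fst c)"
    and inj_on_chart: "inj_on (snd c) (fst c)"
    and continuous_on_chart: "continuous_on (fst c) (snd c)"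
    and open_chart_image: "open U \<Longrightarrow> open (snd c ` (fst c \<inter> U))"
proof -
  obtain \<psi> where h: "homeomorphism (fst c) (snd c ` fst c) (snd c) \<psi>"
    and o: "open (fst c)" "open (snd c ` fst c)"
    using assms by (auto simp: is_chart_def)
  show "open (fst c)" by fact
  show inj: "inj_on (snd c) (fst c)"
    by (rule inj_on_inverseI[of _ \<psi>]) (rule homeomorphism_apply1[OF h])
  show "continuous_on (fst c) (snd c)" using homeomorphism_cont1[OF h] .
  assume "open U"
  then have "openin (top_of_set (fst c)) (fst c \<inter> U)" by (rule openin_open_Int)
  then have "openin (top_of_set (snd c ` fst c)) (snd c ` (fst c \<inter> U))"
    using homeomorphism_imp_open_map[OF h] by blast
  then show "open (snd c ` (fst c \<inter> U))" using o openin_open_eq by blast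
qed

lemma param_chart: "is_chart c \<Longrightarrow> p \<in> fst c \<Longrightarrow> param c (snd c p) = p"
  by (simp add: param_def inj_on_chart)

locale harmonic_domain =
  fixes M :: "'a::{t2_space, second_countable_topology} manifold2" and \<Omega> :: "'a set" and u :: "'a \<Rightarrow> real"
  assumes manifold: "riemannian_2_manifold M"
    and open_domain: "open \<Omega>"
    and domain_in_carrier: "\<Omega> \<subseteq> carrier M"
    and harmonic_u: "harmonic_on M \<Omega> u"
    and noncritical_u: "c \<in> charts M \<Longrightarrow> x \<in> snd c ` (fst c \<inter> \<Omega>) \<Longrightarrow> grad M u c x \<noteq> 0"
begin

definition dom :: "'a chart \<Rightarrow> (real^2) set" where
  "dom c = snd c ` (fst c \<inter> \<Omega>)"

lemma charts_are_charts: "c \<in> charts M \<Longrightarrow> is_chart c"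
  using manifold by (simp add: riemannian_2_manifold_def smooth_atlas_def)

lemma chart_at_carrier: "p \<in> carrier M \<Longrightarrow> chart_at M p \<in> charts M \<and> p \<in> fst (chart_at M p)"
  unfolding chart_at_def carrier_def by (rule someI_ex) auto

lemma chart_at: "p \<in> \<Omega> \<Longrightarrow> chart_at M p \<in> charts M" "p \<in> \<Omega> \<Longrightarrow> p \<in> fst (chart_at M p)"
  using chart_at_carrier domain_in_carrier by blast+

lemma surface_patch_chart: "c \<in> charts M \<Longrightarrow> surface_patch (snd c ` fst c) (metric M c)"
  using manifold charts_are_charts[of c]
  by unfold_locales (auto simp: riemannian_2_manifold_def riemannian_metric_def is_chart_def)

lemma surface_patch_subset:
  "surface_patch S G \<Longrightarrow> S' \<subseteq> S \<Longrightarrow> open S' \<Longrightarrow> surface_patch S' G"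
  unfolding surface_patch_def by (blast intro: smooth_on_subset)

lemma open_dom: "c \<in> charts M \<Longrightarrow> open (dom c)"
  unfolding dom_def by (rule open_chart_image[OF charts_are_charts open_domain])

lemma surface_patch_dom: "c \<in> charts M \<Longrightarrow> surface_patch (dom c) (metric M c)"
  by (rule surface_patch_subset[OF surface_patch_chart _ open_dom]) (auto simp: dom_def)

lemma in_dom: "p \<in> fst c \<Longrightarrow> p \<in> \<Omega> \<Longrightarrow> snd c p \<in> dom c"
  by (simp add: dom_def)

lemma in_domE:
  assumes "x \<in> dom c" "c \<in> charts M"
  obtains p where "p \<in> fst c" "p \<in> \<Omega>" "x = snd c p" "param c x = p"
  using assms param_chart[OF charts_are_charts] by (auto simp: dom_def)

lemma coordinate_change_transition:
  assumes c: "c \<in> charts M" and d: "d \<in> charts M"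
  shows "coordinate_change (snd c ` (fst c \<inter> (fst d \<inter> \<Omega>))) (metric M c)
    (snd d ` (fst d \<inter> (fst c \<inter> \<Omega>))) (metric M d) (transition c d)"
proof -
  have o: "open (snd a ` (fst a \<inter> (fst b \<inter> \<Omega>)))" if "a \<in> charts M" "b \<in> charts M" for a b
    using that by (intro open_chart_image charts_are_charts open_Int open_chart_domain open_domain)
  note patch = surface_patch_subset[OF surface_patch_chart _ o]
  have sub: "snd c ` (fst c \<inter> (fst d \<inter> \<Omega>)) \<subseteq> overlap c d" by (auto simp: overlap_def)
  show ?thesis
  proof (intro coordinate_change.intro coordinate_change_axioms.intro patch c d)
    show "transition c d x \<in> snd d ` (fst d \<inter> (fst c \<inter> \<Omega>))" if "x \<in> snd c ` (fst c \<inter> (fst d \<inter> \<Omega>))" for x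
      using that param_chart[OF charts_are_charts[OF c]] by (auto simp: transition_def)
    show "smooth_on (\<lambda>x. transition c d x $ i) (snd c ` (fst c \<inter> (fst d \<inter> \<Omega>)))" for i
      using manifold c d
      by (intro smooth_on_subset[OF _ sub]) (auto simp: riemannian_2_manifold_def smooth_atlas_def)
    show "metric M c x = transpose (matrix (frechet_derivative (transition c d) (at x))) ** metric M d (transition c d x)
        ** matrix (frechet_derivative (transition c d) (at x))" if "x \<in> snd c ` (fst c \<inter> (fst d \<inter> \<Omega>))" for x
      using manifold c d sub that
      by (auto simp: riemannian_2_manifold_def riemannian_metric_def jacobian_def)
  qed auto
qed

lemma smooth_funD:
  assumes "smooth_fun M \<Omega> f" "c \<in> charts M"
  shows "smooth_on (f \<circ> param c) (dom c)"
  using assms by (simp add: smooth_fun_def dom_def)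

context
  fixes c d p
  assumes c: "c \<in> charts M" and d: "d \<in> charts M" and p: "p \<in> \<Omega>" "p \<in> fst c" "p \<in> fst d"
begin

interpretation T: coordinate_change "snd c ` (fst c \<inter> (fst d \<inter> \<Omega>))" "metric M c"
    "snd d ` (fst d \<inter> (fst c \<inter> \<Omega>))" "metric M d" "transition c d"
  by (rule coordinate_change_transition[OF c d])

lemma transition_at: "transition c d (snd c p) = snd d p"
  using p param_chart[OF charts_are_charts[OF c]] by (simp add: transition_def)

lemma mem_overlap: "snd c p \<in> snd c ` (fst c \<inter> (fst d \<inter> \<Omega>))"
  using p by auto

lemma compose_transition:
  assumes "x \<in> snd c ` (fst c \<inter> (fst d \<inter> \<Omega>))"
  shows "(f \<circ> param c) x = (f \<circ> param d) (transition c d x)"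
  using assms param_chart[OF charts_are_charts[OF c]] param_chart[OF charts_are_charts[OF d]]
  by (auto simp: transition_def)

lemma smooth_differentiable: 
  assumes "smooth_fun M \<Omega> f"
  shows "(f \<circ> param d) differentiable (at (transition c d (snd c p)))"
  unfolding transition_at by (rule smooth_onD(1)[OF smooth_funD[OF assms d] in_dom[OF p(3,1)]])

lemma inner_grad_chart_invariant:
  assumes "smooth_fun M \<Omega> f" "smooth_fun M \<Omega> h"
  shows "inner_loc (metric M c) (snd c p) (grad M f c (snd c p)) (grad M h c (snd c p))
    = inner_loc (metric M d) (snd d p) (grad M f d (snd d p)) (grad M h d (snd d p))"
  using T.inner_grad_invariant[OF mem_overlap assms[THEN smooth_differentiable]]
    grad_loc_cong[OF T.c.open_S mem_overlap compose_transition[of _ f]]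
    grad_loc_cong[OF T.c.open_S mem_overlap compose_transition[of _ h]]
  unfolding grad_def transition_at by (simp only:)

lemma laplacian_chart_invariant:
  assumes f: "smooth_fun M \<Omega> f"
  shows "laplacian (metric M c) (f \<circ> param c) (snd c p) = laplacian (metric M d) (f \<circ> param d) (snd d p)"
proof -
  have "smooth_on (f \<circ> param d) (snd d ` (fst d \<inter> (fst c \<inter> \<Omega>)))"
    by (rule smooth_on_subset[OF smooth_funD[OF f d]]) (auto simp: dom_def)
  from T.laplacian_invariant[OF mem_overlap this] show ?thesis
    using laplacian_cong[OF T.c.open_S mem_overlap compose_transition[of _ f]]
    unfolding transition_at by (simp only:)
qed

lemma bracket_chart_invariant:
  assumes f: "smooth_fun M \<Omega> f" and h: "smooth_fun M \<Omega> h" and "oriented_manifold M"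
  shows "(pd 1 (f \<circ> param c) (snd c p) * pd 2 (h \<circ> param c) (snd c p)
      - pd 2 (f \<circ> param c) (snd c p) * pd 1 (h \<circ> param c) (snd c p)) / sqrt (det (metric M c (snd c p)))
    = (pd 1 (f \<circ> param d) (snd d p) * pd 2 (h \<circ> param d) (snd d p)
      - pd 2 (f \<circ> param d) (snd d p) * pd 1 (h \<circ> param d) (snd d p)) / sqrt (det (metric M d (snd d p)))"
proof -
  have "snd c p \<in> overlap c d" using p by (auto simp: overlap_def)
  then have "T.jac (snd c p) > 0"
    using assms(3) c d unfolding T.det_jacobian[OF mem_overlap, symmetric]
    by (auto simp: oriented_manifold_def jacobian_def)
  from T.bracket_invariant[OF mem_overlap f[THEN smooth_differentiable] h[THEN smooth_differentiable] this]
  show ?thesis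
    using pd_cong[OF T.c.open_S mem_overlap compose_transition[of _ f]]
      pd_cong[OF T.c.open_S mem_overlap compose_transition[of _ h]]
    unfolding transition_at by (simp only:)
qed

end

lemma smooth_u: "smooth_fun M \<Omega> u"
  using harmonic_u by (simp add: harmonic_on_def)

abbreviation norm2 :: "'a chart \<Rightarrow> 'a \<Rightarrow> real" where
  "norm2 c p \<equiv> grad_norm2 (metric M c) (u \<circ> param c) (snd c p)"

lemma norm2_chart_invariant:
  assumes "c \<in> charts M" "d \<in> charts M" "p \<in> \<Omega>" "p \<in> fst c" "p \<in> fst d"
  shows "norm2 c p = norm2 d p"
  using inner_grad_chart_invariant[OF assms smooth_u smooth_u] by (simp add: grad_norm2_def grad_def)

lemma vnorm_grad: "vnorm M (grad M u) p = sqrt (norm2 (chart_at M p) p)"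
  by (simp add: vnorm_def vinner_def grad_norm2_def grad_def Let_def)

lemma harmonic_patch_dom:
  assumes c: "c \<in> charts M"
  shows "harmonic_patch (dom c) (metric M c) (u \<circ> param c)"
proof (intro harmonic_patch.intro harmonic_patch_axioms.intro surface_patch_dom[OF c])
  show "smooth_on (u \<circ> param c) (dom c)" by (rule smooth_funD[OF smooth_u c])
  fix x assume x: "x \<in> dom c"
  show "grad_loc (metric M c) (u \<circ> param c) x \<noteq> 0"
    using noncritical_u[OF c x[unfolded dom_def]] by (simp add: grad_def)
  obtain p where p: "p \<in> fst c" "p \<in> \<Omega>" "x = snd c p" by (rule in_domE[OF x c])
  \<comment> \<open>Harmonicity is only given in the chart selected at \<open>p\<close>, and is carried over to \<open>c\<close>.\<close>
  have "divergence M (grad M u) p = 0" using harmonic_u p by (simp add: harmonic_on_def)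
  then have "laplacian (metric M (chart_at M p)) (u \<circ> param (chart_at M p)) (snd (chart_at M p) p) = 0"
    by (simp add: divergence_def Let_def grad_def laplacian_def cong: if_cong)
  then show "laplacian (metric M c) (u \<circ> param c) x = 0"
    using laplacian_chart_invariant[OF c chart_at(1) _ _ chart_at(2) smooth_u] p by simp
qed

definition log_grad_norm :: "'a \<Rightarrow> real" where
  "log_grad_norm p = ln (norm2 (chart_at M p) p) / 2"

lemma log_grad_norm_chart:
  assumes c: "c \<in> charts M" and x: "x \<in> dom c"
  shows "(log_grad_norm \<circ> param c) x = harmonic_patch.log_norm (metric M c) (u \<circ> param c) x"
proof -
  interpret harmonic_patch "dom c" "metric M c" "u \<circ> param c" by (rule harmonic_patch_dom[OF c])
  obtain p where p: "p \<in> fst c" "p \<in> \<Omega>" "x = snd c p" "param c x = p" by (rule in_domE[OF x c])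
  show ?thesis
    using norm2_chart_invariant[OF c chart_at(1) _ _ chart_at(2)] p
    by (simp add: log_grad_norm_def log_norm_def)
qed

lemma smooth_log_grad_norm: "smooth_fun M \<Omega> log_grad_norm"
  unfolding smooth_fun_def dom_def[symmetric]
proof
  fix c assume c: "c \<in> charts M"
  interpret P: harmonic_patch "dom c" "metric M c" "u \<circ> param c" by (rule harmonic_patch_dom[OF c])
  show "smooth_on (log_grad_norm \<circ> param c) (dom c)"
    using P.smooth_log_norm smooth_on_cong[OF P.open_S, of "log_grad_norm \<circ> param c" P.log_norm] log_grad_norm_chart[OF c] by blast
qed

lemma gauss_loc_chart:
  assumes c: "c \<in> charts M" and p: "p \<in> \<Omega>" "p \<in> fst c"
  shows "gauss_loc (metric M c) (snd c p) = laplacian (metric M c) (log_grad_norm \<circ> param c) (snd c p)"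
proof -
  interpret P: harmonic_patch "dom c" "metric M c" "u \<circ> param c" by (rule harmonic_patch_dom[OF c])
  show ?thesis
    unfolding P.gauss_eq_laplacian_log_norm[OF in_dom[OF p(2,1)]]
    by (rule laplacian_cong[OF P.open_S in_dom[OF p(2,1)] log_grad_norm_chart[OF c, symmetric]])
qed

text \<open>Gauss's theorema egregium on \<open>\<Omega>\<close>. It is reduced to the invariance of the Laplacian by
  \<open>K = \<Delta>log |\<nabla>u|\<close>, instead of the transformation law of the curvature tensor.\<close>

lemma gauss_curvature_chart:
  assumes c: "c \<in> charts M" and p: "p \<in> \<Omega>" "p \<in> fst c"
  shows "gauss_curvature M p = gauss_loc (metric M c) (snd c p)"
  unfolding gauss_curvature_def Let_def gauss_loc_chart[OF c p]
    gauss_loc_chart[OF chart_at(1)[OF p(1)] p(1) chart_at(2)[OF p(1)]]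
  by (rule laplacian_chart_invariant[OF chart_at(1)[OF p(1)] c p(1) chart_at(2)[OF p(1)] p(2) smooth_log_grad_norm])

lemma grad_gauss_curvature:
  assumes c: "c \<in> charts M" and p: "p \<in> \<Omega>" "p \<in> fst c"
  shows "grad M (gauss_curvature M) c (snd c p) = grad_loc (metric M c) (gauss_loc (metric M c)) (snd c p)"
  unfolding grad_def
proof (rule grad_loc_cong[OF open_dom[OF c] in_dom[OF p(2,1)]])
  show "(gauss_curvature M \<circ> param c) y = gauss_loc (metric M c) y" if "y \<in> dom c" for y
    by (rule in_domE[OF that c]) (simp add: gauss_curvature_chart[OF c])
qed

definition level_quotient :: "'a \<Rightarrow> real" where
  "level_quotient p = inverse (vnorm M (grad M u) p) * level_curvature M u p"

definition descent_quotient :: "'a \<Rightarrow> real" where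
  "descent_quotient p = inverse (vnorm M (grad M u) p) * descent_curvature M u p"

lemma norm2_pos:
  assumes c: "c \<in> charts M" and p: "p \<in> \<Omega>" "p \<in> fst c"
  shows "norm2 c p > 0"
proof -
  interpret P: harmonic_patch "dom c" "metric M c" "u \<circ> param c" by (rule harmonic_patch_dom[OF c])
  show ?thesis by (rule P.N_pos[OF in_dom[OF p(2,1)]])
qed

lemma grad_log_norm_chart:
  assumes c: "c \<in> charts M" and p: "p \<in> \<Omega>" "p \<in> fst c"
  shows "grad_loc (metric M c) (harmonic_patch.log_norm (metric M c) (u \<circ> param c)) (snd c p) = grad M log_grad_norm c (snd c p)"
  unfolding grad_def by (rule grad_loc_cong[OF open_dom[OF c] in_dom[OF p(2,1)] log_grad_norm_chart[OF c, symmetric]])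

lemma along_chart:
  assumes c: "c \<in> charts M" and p: "p \<in> \<Omega>" "p \<in> fst c"
  shows "harmonic_patch.along (metric M c) (u \<circ> param c) (harmonic_patch.log_norm (metric M c) (u \<circ> param c)) (snd c p)
    = inner_loc (metric M c) (snd c p) (grad M log_grad_norm c (snd c p)) (grad M u c (snd c p)) / norm2 c p"
proof -
  interpret P: harmonic_patch "dom c" "metric M c" "u \<circ> param c" by (rule harmonic_patch_dom[OF c])
  show ?thesis
    unfolding P.along_eq_inner[OF in_dom[OF p(2,1)]] grad_log_norm_chart[OF c p] by (simp add: grad_def)
qed

text \<open>The formula holds by calculation in the chart selected at \<open>p\<close>; the right-hand side is an inner
  product of gradients over \<open>|\<nabla>u|\<^sup>2\<close>, so it holds in every chart. This makes the quotient smooth.\<close>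

lemma level_quotient_chart:
  assumes c: "c \<in> charts M" and p: "p \<in> \<Omega>" "p \<in> fst c"
  shows "level_quotient p = harmonic_patch.along (metric M c) (u \<circ> param c)
    (harmonic_patch.log_norm (metric M c) (u \<circ> param c)) (snd c p)"
proof -
  define d where "d = chart_at M p"
  have d: "d \<in> charts M" "p \<in> fst d" using chart_at[OF p(1)] by (simp_all add: d_def)
  interpret P: harmonic_patch "dom d" "metric M d" "u \<circ> param d" by (rule harmonic_patch_dom[OF d(1)])
  have "level_curvature M u p = sqrt (norm2 d p) * P.along P.log_norm (snd d p)"
    using P.div_normalized_grad[OF in_dom[OF d(2) p(1)]]
    by (simp add: level_curvature_def divergence_def Let_def over_norm_def grad_def flip: d_def)
  then have "level_quotient p = P.along P.log_norm (snd d p)"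
    using norm2_pos[OF d(1) p(1) d(2)] by (simp add: level_quotient_def vnorm_grad flip: d_def)
  then show ?thesis
    unfolding along_chart[OF d(1) p(1) d(2)] along_chart[OF c p]
      norm2_chart_invariant[OF c d(1) p d(2)] inner_grad_chart_invariant[OF c d(1) p d(2) smooth_log_grad_norm smooth_u] .
qed

lemma across_chart:
  assumes c: "c \<in> charts M" and p: "p \<in> \<Omega>" "p \<in> fst c"
  shows "harmonic_patch.across (metric M c) (u \<circ> param c) (harmonic_patch.log_norm (metric M c) (u \<circ> param c)) (snd c p)
    = (pd 1 (u \<circ> param c) (snd c p) * pd 2 (log_grad_norm \<circ> param c) (snd c p)
      - pd 2 (u \<circ> param c) (snd c p) * pd 1 (log_grad_norm \<circ> param c) (snd c p)) / sqrt (det (metric M c (snd c p)))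
      / norm2 c p"
proof -
  interpret P: harmonic_patch "dom c" "metric M c" "u \<circ> param c" by (rule harmonic_patch_dom[OF c])
  have "pd i (harmonic_patch.log_norm (metric M c) (u \<circ> param c)) (snd c p) = pd i (log_grad_norm \<circ> param c) (snd c p)" for i
    by (rule pd_cong[OF open_dom[OF c] in_dom[OF p(2,1)] log_grad_norm_chart[OF c, symmetric]])
  then show ?thesis by (simp add: P.across_eq)
qed

text \<open>Here the right-hand side is, up to the invariant factor \<open>- 1 / |\<nabla>u|\<^sup>2\<close>, the quotient of
  \<open>du \<and> d\<psi>\<close> by the Riemannian area form, whose sign depends on the orientation.\<close>

lemma descent_quotient_chart:
  assumes c: "c \<in> charts M" and p: "p \<in> \<Omega>" "p \<in> fst c" and "oriented_manifold M"
  shows "descent_quotient p = - harmonic_patch.across (metric M c) (u \<circ> param c)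
    (harmonic_patch.log_norm (metric M c) (u \<circ> param c)) (snd c p)"
proof -
  define d where "d = chart_at M p"
  have d: "d \<in> charts M" "p \<in> fst d" using chart_at[OF p(1)] by (simp_all add: d_def)
  interpret P: harmonic_patch "dom d" "metric M d" "u \<circ> param d" by (rule harmonic_patch_dom[OF d(1)])
  have "descent_curvature M u p = - (sqrt (norm2 d p) * P.across P.log_norm (snd d p))"
    using P.div_normalized_star_grad[OF in_dom[OF d(2) p(1)]]
    by (simp add: descent_curvature_def divergence_def Let_def over_norm_def star_def grad_def flip: d_def)
  then have "descent_quotient p = - P.across P.log_norm (snd d p)"
    using norm2_pos[OF d(1) p(1) d(2)] by (simp add: descent_quotient_def vnorm_grad flip: d_def)
  then show ?thesis
    unfolding across_chart[OF d(1) p(1) d(2)] across_chart[OF c p]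
      norm2_chart_invariant[OF c d(1) p d(2)] bracket_chart_invariant[OF c d(1) p d(2) smooth_u smooth_log_grad_norm assms(4)] .
qed

lemma smooth_level_quotient: "smooth_fun M \<Omega> level_quotient"
  unfolding smooth_fun_def dom_def[symmetric]
proof
  fix c assume c: "c \<in> charts M"
  interpret P: harmonic_patch "dom c" "metric M c" "u \<circ> param c" by (rule harmonic_patch_dom[OF c])
  have "(level_quotient \<circ> param c) x = P.along P.log_norm x" if "x \<in> dom c" for x
    by (rule in_domE[OF that c]) (simp add: level_quotient_chart[OF c])
  then show "smooth_on (level_quotient \<circ> param c) (dom c)"
    using smooth_on_cong[OF P.open_S, of "level_quotient \<circ> param c" "P.along P.log_norm"]
      P.smooth_along[OF P.smooth_log_norm] by blast
qed

lemma smooth_descent_quotient: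
  assumes "oriented_manifold M"
  shows "smooth_fun M \<Omega> descent_quotient"
  unfolding smooth_fun_def dom_def[symmetric]
proof
  fix c assume c: "c \<in> charts M"
  interpret P: harmonic_patch "dom c" "metric M c" "u \<circ> param c" by (rule harmonic_patch_dom[OF c])
  have "(descent_quotient \<circ> param c) x = - P.across P.log_norm x" if "x \<in> dom c" for x
    by (rule in_domE[OF that c]) (simp add: descent_quotient_chart[OF c _ _ assms])
  then show "smooth_on (descent_quotient \<circ> param c) (dom c)"
    using smooth_on_cong[OF P.open_S, of "descent_quotient \<circ> param c" "\<lambda>x. - P.across P.log_norm x"]
      smooth_on_minus[OF P.open_S P.smooth_across[OF P.smooth_log_norm]] by blast
qed

lemma laplacian_level_quotient:
  assumes p: "p \<in> \<Omega>"
  defines "c \<equiv> chart_at M p"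
  shows "laplacian (metric M c) (level_quotient \<circ> param c) (snd c p) + 2 * gauss_curvature M p * level_quotient p
    = vinner M (grad M (gauss_curvature M)) (grad M u) p / norm2 c p"
proof -
  have c: "c \<in> charts M" "p \<in> fst c" using chart_at[OF p] by (simp_all add: c_def)
  interpret P: harmonic_patch "dom c" "metric M c" "u \<circ> param c" by (rule harmonic_patch_dom[OF c(1)])
  have x: "snd c p \<in> dom c" by (rule in_dom[OF c(2) p])
  have "(level_quotient \<circ> param c) y = P.along P.log_norm y" if "y \<in> dom c" for y
    by (rule in_domE[OF that c(1)]) (simp add: level_quotient_chart[OF c(1)])
  then have lc: "laplacian (metric M c) (level_quotient \<circ> param c) (snd c p)
    = laplacian (metric M c) (P.along P.log_norm) (snd c p)"
    by (rule laplacian_cong[OF P.open_S x])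
  have v: "vinner M (grad M (gauss_curvature M)) (grad M u) p / norm2 c p = P.along (gauss_loc (metric M c)) (snd c p)"
    unfolding P.along_eq_inner[OF x] vinner_def Let_def c_def[symmetric] grad_gauss_curvature[OF c(1) p c(2)]
    by (simp add: grad_def)
  show ?thesis
    unfolding v lc gauss_curvature_chart[OF c(1) p c(2)] level_quotient_chart[OF c(1) p c(2)]
    by (rule P.laplacian_along_log_norm[OF x])
qed

lemma laplacian_descent_quotient:
  assumes p: "p \<in> \<Omega>" and or: "oriented_manifold M"
  defines "c \<equiv> chart_at M p"
  shows "laplacian (metric M c) (descent_quotient \<circ> param c) (snd c p) + 2 * gauss_curvature M p * descent_quotient p
    = vinner M (grad M (gauss_curvature M)) (neg_field (star M (grad M u))) p / norm2 c p"
proof -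
  have c: "c \<in> charts M" "p \<in> fst c" using chart_at[OF p] by (simp_all add: c_def)
  interpret P: harmonic_patch "dom c" "metric M c" "u \<circ> param c" by (rule harmonic_patch_dom[OF c(1)])
  have x: "snd c p \<in> dom c" by (rule in_dom[OF c(2) p])
  have "(descent_quotient \<circ> param c) y = 0 + (- 1) * P.across P.log_norm y" if "y \<in> dom c" for y
    by (rule in_domE[OF that c(1)]) (simp add: descent_quotient_chart[OF c(1) _ _ or])
  then have "laplacian (metric M c) (descent_quotient \<circ> param c) (snd c p)
    = laplacian (metric M c) (\<lambda>y. 0 + (- 1) * P.across P.log_norm y) (snd c p)"
    by (rule laplacian_cong[OF P.open_S x])
  also have "\<dots> = laplacian (metric M c) (\<lambda>y. 0) (snd c p) - laplacian (metric M c) (P.across P.log_norm) (snd c p)"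
    by (subst P.laplacian_linear[OF smooth_on_const P.smooth_across[OF P.smooth_log_norm] x]) simp
  also have "laplacian (metric M c) (\<lambda>y. 0) (snd c p) = 0"
    by (simp add: laplacian_def div_loc_def grad_loc_def pd_const sum_2 matrix_vector_mult_def)
  finally have lc: "laplacian (metric M c) (descent_quotient \<circ> param c) (snd c p)
    = - laplacian (metric M c) (P.across P.log_norm) (snd c p)" by (simp only: diff_0)
  have neg: "inner_loc G y v (- w) = - inner_loc G y v w" for G y v w
    by (simp add: inner_loc_def matrix_vector_mult_def inner_vec_def sum_2 algebra_simps)
  have v: "vinner M (grad M (gauss_curvature M)) (neg_field (star M (grad M u))) p / norm2 c p
    = - P.across (gauss_loc (metric M c)) (snd c p)"
    unfolding P.across_eq_inner[OF x] vinner_def Let_def c_def[symmetric] grad_gauss_curvature[OF c(1) p c(2)]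
      neg_field_def star_def neg
    by (simp add: grad_def)
  show ?thesis
    unfolding v lc gauss_curvature_chart[OF c(1) p c(2)] descent_quotient_chart[OF c(1) p c(2) or]
    using P.laplacian_across_log_norm[OF x] by simp
qed

end

section \<open>The maximum principle\<close>

locale harmonic_closure = harmonic_domain +
  fixes V :: "'a vfield"
  assumes domain_nonempty: "\<Omega> \<noteq> {}"
    and compact_closure: "compact (closure \<Omega>)"
    and closure_in_carrier: "closure \<Omega> \<subseteq> carrier M"
    and continuous_u: "continuous_on (closure \<Omega>) u"
    and V_extends: "grad_extends_to_closure M \<Omega> u V"
    and V_nonvanishing: "nonvanishing_on M (closure \<Omega>) V"
begin

definition V_norm2 :: "'a chart \<Rightarrow> 'a \<Rightarrow> real" where
  "V_norm2 c p = inner_loc (metric M c) (snd c p) (V c (snd c p)) (V c (snd c p))"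

lemma chart_at_closure: 
  assumes "p \<in> closure \<Omega>"
  shows "chart_at M p \<in> charts M" "p \<in> fst (chart_at M p)"
  using chart_at_carrier assms closure_in_carrier by blast+

lemma continuous_on_V_norm2:
  assumes c: "c \<in> charts M"
  shows "continuous_on (fst c \<inter> closure \<Omega>) (V_norm2 c)"
proof -
  interpret P: surface_patch "snd c ` fst c" "metric M c" by (rule surface_patch_chart[OF c])
  have ch: "continuous_on (fst c \<inter> closure \<Omega>) (snd c)"
    by (rule continuous_on_subset[OF continuous_on_chart[OF charts_are_charts[OF c]]]) auto
  have V: "continuous_on (fst c \<inter> closure \<Omega>) (\<lambda>p. V c (snd c p))"
    by (rule continuous_on_compose2[OF _ ch]) (use V_extends c in \<open>auto simp: grad_extends_to_closure_def\<close>)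
  have g: "continuous_on (fst c \<inter> closure \<Omega>) (\<lambda>p. metric M c (snd c p) $ i $ j)" for i j
    by (rule continuous_on_compose2[OF smooth_onD(3)[OF P.smooth_metric] ch]) auto
  have *: "continuous_on (fst c \<inter> closure \<Omega>) (\<lambda>p. V c (snd c p) $ i * (metric M c (snd c p) $ i $ j * V c (snd c p) $ j))" for i j
    by (rule continuous_on_mult[OF continuous_on_component[OF V] continuous_on_mult[OF g continuous_on_component[OF V]]])
  show ?thesis
    unfolding V_norm2_def inner_loc_def inner_vec_def matrix_vector_mult_def
    by (simp add: sum_2 distrib_left) (intro continuous_on_add *)
qed

lemma V_norm2_pos:
  assumes c: "c \<in> charts M" and p: "p \<in> closure \<Omega>" "p \<in> fst c"
  shows "V_norm2 c p > 0"
proof -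
  interpret P: surface_patch "snd c ` fst c" "metric M c" by (rule surface_patch_chart[OF c])
  have "V c (snd c p) \<noteq> 0" using V_nonvanishing c p by (auto simp: nonvanishing_on_def)
  then show ?thesis unfolding V_norm2_def inner_loc_def using P.metric_pos p by blast
qed

lemma V_norm2_interior:
  assumes c: "c \<in> charts M" and p: "p \<in> \<Omega>" "p \<in> fst c"
  shows "V_norm2 c p = norm2 c p"
  using V_extends c p by (auto simp: grad_extends_to_closure_def V_norm2_def grad_norm2_def grad_def)

text \<open>At a boundary point no transformation law of \<open>V\<close> is given. Both sides are continuous up to the
  boundary and agree on \<open>\<Omega>\<close>, hence agree in the limit.\<close>

lemma V_norm2_chart_invariant:
  assumes c: "c \<in> charts M" and d: "d \<in> charts M" and p: "p \<in> closure \<Omega>" "p \<in> fst c" "p \<in> fst d"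
  shows "V_norm2 c p = V_norm2 d p"
proof (cases "p \<in> \<Omega>")
  case True
  then show ?thesis using norm2_chart_invariant[OF c d] V_norm2_interior c d p by simp
next
  case False
  define U where "U = fst c \<inter> fst d"
  have U: "open U" "p \<in> U"
    using p open_Int[OF open_chart_domain[OF charts_are_charts[OF c]] open_chart_domain[OF charts_are_charts[OF d]]]
    by (simp_all add: U_def)
  have "p islimpt \<Omega>" using False p(1) by (simp add: closure_def)
  then have nt: "at p within \<Omega> \<noteq> bot" using trivial_limit_within by blast
  have lim: "(V_norm2 a \<longlongrightarrow> V_norm2 a p) (at p within \<Omega>)" if a: "a \<in> charts M" "p \<in> fst a" for a
  proof -
    have "(V_norm2 a \<longlongrightarrow> V_norm2 a p) (at p within fst a \<inter> closure \<Omega>)"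
      using continuous_on_V_norm2[OF a(1)] a(2) p(1) by (auto simp: continuous_on_def)
    then have "(V_norm2 a \<longlongrightarrow> V_norm2 a p) (at p within fst a \<inter> \<Omega>)"
      by (rule tendsto_within_subset) (use closure_subset in blast)
    also have "at p within fst a \<inter> \<Omega> = at p within \<Omega>"
      by (rule at_within_nhd[OF a(2) open_chart_domain[OF charts_are_charts[OF a(1)]]]) auto
    finally show ?thesis .
  qed
  have "((\<lambda>q. V_norm2 c q - V_norm2 d q) \<longlongrightarrow> V_norm2 c p - V_norm2 d p) (at p within \<Omega>)"
    by (intro tendsto_diff lim c d p)
  moreover have "((\<lambda>q. V_norm2 c q - V_norm2 d q) \<longlongrightarrow> 0) (at p within \<Omega>)"
  proof (rule tendsto_eventually)
    have "V_norm2 c q - V_norm2 d q = 0" if "q \<in> U" "q \<in> \<Omega>" for q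
      using that norm2_chart_invariant[OF c d] V_norm2_interior[OF c] V_norm2_interior[OF d] by (simp add: U_def)
    then show "\<forall>\<^sub>F q in at p within \<Omega>. V_norm2 c q - V_norm2 d q = 0"
      using U unfolding eventually_at_topological by blast
  qed
  ultimately have "V_norm2 c p - V_norm2 d p = 0" by (rule tendsto_unique[OF nt])
  then show ?thesis by simp
qed

lemma vnorm_V: "vnorm M V p = sqrt (V_norm2 (chart_at M p) p)"
  by (simp add: vnorm_def vinner_def V_norm2_def Let_def)

lemma vnorm_V_pos: "p \<in> closure \<Omega> \<Longrightarrow> vnorm M V p > 0"
  unfolding vnorm_V using V_norm2_pos chart_at_closure by simp

lemma vnorm_V_interior: "p \<in> \<Omega> \<Longrightarrow> vnorm M V p = vnorm M (grad M u) p"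
  unfolding vnorm_V vnorm_grad using V_norm2_interior chart_at by simp

lemma continuous_on_vnorm_V: "continuous_on (closure \<Omega>) (vnorm M V)"
  unfolding continuous_on_def
proof
  fix p assume p: "p \<in> closure \<Omega>"
  define c where "c = chart_at M p"
  have c: "c \<in> charts M" "p \<in> fst c" using chart_at_closure[OF p] by (simp_all add: c_def)
  have eq: "vnorm M V q = sqrt (V_norm2 c q)" if "q \<in> fst c \<inter> closure \<Omega>" for q
    unfolding vnorm_V using V_norm2_chart_invariant[OF c(1) chart_at_closure(1) _ _ chart_at_closure(2)] that by simp
  have "continuous_on (fst c \<inter> closure \<Omega>) (\<lambda>q. sqrt (V_norm2 c q))"
    by (intro continuous_intros continuous_on_V_norm2 c)
  then have "continuous_on (fst c \<inter> closure \<Omega>) (vnorm M V)"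
    by (subst continuous_on_cong[OF refl eq])
  then have "(vnorm M V \<longlongrightarrow> vnorm M V p) (at p within fst c \<inter> closure \<Omega>)"
    using c p by (auto simp: continuous_on_def)
  also have "at p within fst c \<inter> closure \<Omega> = at p within closure \<Omega>"
    by (rule at_within_nhd[OF c(2) open_chart_domain[OF charts_are_charts[OF c(1)]]]) auto
  finally show "(vnorm M V \<longlongrightarrow> vnorm M V p) (at p within closure \<Omega>)" .
qed

text \<open>By compactness it suffices to find an exponent near each point of the closure, where \<open>|V|\<^sup>2\<close> is
  bounded below and \<open>K\<close> is bounded. Near a boundary point \<open>p\<close> the estimate is made in the fixed chart
  selected at \<open>p\<close>, where all terms are continuous, and transferred on \<open>\<Omega>\<close> to the charts selected at
  the other points.\<close>

lemma exists_barrier_exponent: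
  "\<exists>\<alpha>. \<forall>p\<in>\<Omega>. \<alpha>\<^sup>2 * norm2 (chart_at M p) p + 2 * gauss_curvature M p > 0"
proof -
  have "\<exists>a U. 0 \<le> a \<and> open U \<and> p \<in> U \<and>
      (\<forall>q\<in>U \<inter> \<Omega>. a * norm2 (chart_at M q) q + 2 * gauss_curvature M q > 0)" if p: "p \<in> closure \<Omega>" for p
  proof -
    define c where "c = chart_at M p"
    have c: "c \<in> charts M" "p \<in> fst c" using chart_at_closure[OF p] by (simp_all add: c_def)
    interpret P: surface_patch "snd c ` fst c" "metric M c" by (rule surface_patch_chart[OF c(1)])
    define K where "K = (\<lambda>q. gauss_loc (metric M c) (snd c q))"
    \<comment> \<open>Chosen so that \<open>a |V|\<^sup>2 + 2 K = 2 (|K| + K) + 1\<close> at \<open>p\<close>.\<close>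
    define a where "a = (2 * \<bar>K p\<bar> + 1) / V_norm2 c p"
    have pos: "V_norm2 c p > 0" by (rule V_norm2_pos[OF c(1) p c(2)])
    define \<phi> where "\<phi> = (\<lambda>q. a * V_norm2 c q + 2 * K q)"
    have "\<phi> p > 0" using pos by (simp add: \<phi>_def a_def)
    have "continuous_on (fst c \<inter> closure \<Omega>) (snd c)"
      by (rule continuous_on_subset[OF continuous_on_chart[OF charts_are_charts[OF c(1)]]]) auto
    then have "continuous_on (fst c \<inter> closure \<Omega>) K"
      unfolding K_def by (rule continuous_on_compose2[OF smooth_onD(3)[OF P.smooth_gauss_loc]]) auto
    then have "continuous_on (fst c \<inter> closure \<Omega>) \<phi>"
      unfolding \<phi>_def by (intro continuous_intros continuous_on_V_norm2 c)
    then obtain A where A: "open A" "A \<inter> (fst c \<inter> closure \<Omega>) = \<phi> -` {0<..} \<inter> (fst c \<inter> closure \<Omega>)"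
      using open_greaterThan[of "0::real"] unfolding continuous_on_open_invariant by meson
    have "a * norm2 (chart_at M q) q + 2 * gauss_curvature M q > 0" if q: "q \<in> A \<inter> fst c \<inter> \<Omega>" for q
    proof -
      have qO: "q \<in> \<Omega>" "q \<in> fst c" "q \<in> closure \<Omega>" using q closure_subset by auto
      then have "\<phi> q > 0" using A(2) q by auto
      then show ?thesis
        using V_norm2_interior[OF c(1) qO(1,2)] gauss_curvature_chart[OF c(1) qO(1,2)]
          norm2_chart_invariant[OF c(1) chart_at(1)[OF qO(1)] qO(1,2) chart_at(2)[OF qO(1)]]
        by (simp add: \<phi>_def K_def)
    qed
    moreover have "open (A \<inter> fst c)" using A open_chart_domain[OF charts_are_charts[OF c(1)]] by blast
    moreover have "p \<in> A \<inter> fst c" using A(2) c p \<open>\<phi> p > 0\<close> by auto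
    moreover have "0 \<le> a" using pos by (simp add: a_def)
    ultimately show ?thesis by blast
  qed
  then obtain a U where aU: "\<And>p. p \<in> closure \<Omega> \<Longrightarrow> 0 \<le> a p \<and> open (U p) \<and> p \<in> U p \<and>
      (\<forall>q\<in>U p \<inter> \<Omega>. a p * norm2 (chart_at M q) q + 2 * gauss_curvature M q > 0)"
    by metis
  obtain D where D: "D \<subseteq> closure \<Omega>" "finite D" "closure \<Omega> \<subseteq> (\<Union>p\<in>D. U p)"
    by (rule compactE_image[OF compact_closure, of "closure \<Omega>" U]) (use aU in blast)+
  \<comment> \<open>The sum over the finite subcover dominates every local constant.\<close>
  have "(sqrt (sum a D))\<^sup>2 * norm2 (chart_at M q) q + 2 * gauss_curvature M q > 0" if q: "q \<in> \<Omega>" for q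
  proof -
    obtain p where p: "p \<in> D" "q \<in> U p" using q D closure_subset by blast
    have nonneg: "0 \<le> a r" if "r \<in> D" for r using that D aU by blast
    have "a p \<le> sum a D" by (rule member_le_sum[OF p(1) _ D(2)]) (use nonneg in auto)
    then have "a p * norm2 (chart_at M q) q \<le> sum a D * norm2 (chart_at M q) q"
      using norm2_pos[OF chart_at(1)[OF q] q chart_at(2)[OF q]] by (intro mult_right_mono) auto
    moreover have "a p * norm2 (chart_at M q) q + 2 * gauss_curvature M q > 0" using aU p q D by blast
    moreover have "(sqrt (sum a D))\<^sup>2 = sum a D" by (simp add: sum_nonneg nonneg)
    ultimately show ?thesis by simp
  qed
  then show ?thesis by blast
qed

text \<open>Suppose that the boundary misses the maximum \<open>m\<close>. With \<open>w = exp (\<alpha> u)\<close> and a small \<open>\<epsilon> > 0\<close> the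
  function \<open>F + \<epsilon> w\<close> is still below \<open>m\<close> on the boundary but exceeds \<open>m\<close> where \<open>F\<close> is maximal, so it
  has an interior maximum \<open>p\<close>. There its Laplacian is nonpositive, while
  \<open>(\<Delta> + C) (F + \<epsilon> w) > 0\<close> everywhere; so \<open>C (F + \<epsilon> w) > 0\<close> at \<open>p\<close>, which is impossible when
  \<open>C = 0\<close> or when \<open>C \<le> 0\<close> and the value at \<open>p\<close> is positive. An empty boundary is refuted by the same
  argument.\<close>

lemma maximum_principle:
  fixes F C :: "'a \<Rightarrow> real"
  assumes cont: "continuous_on (closure \<Omega>) F" and smooth: "smooth_fun M \<Omega> F"
    and sub: "\<And>p. p \<in> \<Omega> \<Longrightarrow>
      laplacian (metric M (chart_at M p)) (F \<circ> param (chart_at M p)) (snd (chart_at M p) p) + C p * F p \<ge> 0"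
    and C: "\<And>p. p \<in> \<Omega> \<Longrightarrow> C p \<le> 0"
    and sign: "Sup (F ` closure \<Omega>) \<ge> 0 \<or> (\<forall>p\<in>\<Omega>. C p = 0)"
    and \<alpha>: "\<And>p. p \<in> \<Omega> \<Longrightarrow> \<alpha>\<^sup>2 * norm2 (chart_at M p) p + C p > 0"
  shows "max_attained_on F (closure \<Omega>) (frontier \<Omega>)"
proof (rule ccontr)
  assume no: "\<not> max_attained_on F (closure \<Omega>) (frontier \<Omega>)"
  have ne: "closure \<Omega> \<noteq> {}" using domain_nonempty by simp
  obtain p0 where p0: "p0 \<in> closure \<Omega>" "\<And>q. q \<in> closure \<Omega> \<Longrightarrow> F q \<le> F p0"
    using continuous_attains_sup[OF compact_closure ne cont] by blast
  have Sup: "Sup (F ` closure \<Omega>) = F p0"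
    by (rule cSup_eq_maximum) (use p0 in auto)
  have less: "F q < F p0" if q: "q \<in> frontier \<Omega>" for q
  proof (rule ccontr)
    assume "\<not> F q < F p0"
    then have "is_arg_max F (\<lambda>p. p \<in> closure \<Omega>) q"
      using p0(2) q by (force simp: is_arg_max_def frontier_def)
    then show False using no q by (auto simp: max_attained_on_def)
  qed
  define w where "w = (\<lambda>p. exp (\<alpha> * u p))"
  have cont_w: "continuous_on (closure \<Omega>) w"
    unfolding w_def by (intro continuous_intros continuous_u)
  have w_pos: "w p > 0" for p by (simp add: w_def)
  obtain \<epsilon> where \<epsilon>: "\<epsilon> > 0" "\<And>q. q \<in> frontier \<Omega> \<Longrightarrow> F q + \<epsilon> * w q < F p0"
  proof (cases "frontier \<Omega> = {}")
    case True then show ?thesis using that[of 1] by simp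
  next
    case False
    have fc: "frontier \<Omega> \<subseteq> closure \<Omega>" by (auto simp: frontier_def)
    have "compact (frontier \<Omega>)"
      using compact_Int_closed[OF compact_closure frontier_closed[of \<Omega>]] fc by (simp add: Int_absorb1)
    then obtain q1 q2 where q: "q1 \<in> frontier \<Omega>" "\<And>q. q \<in> frontier \<Omega> \<Longrightarrow> F q \<le> F q1"
      "q2 \<in> frontier \<Omega>" "\<And>q. q \<in> frontier \<Omega> \<Longrightarrow> w q \<le> w q2"
      using continuous_attains_sup[OF _ False continuous_on_subset[OF cont fc]]
        continuous_attains_sup[OF _ False continuous_on_subset[OF cont_w fc]] by metis
    \<comment> \<open>Half of the gap between \<open>F p0\<close> and the largest boundary value, spread over the largest \<open>w\<close>.\<close>
    define e where "e = (F p0 - F q1) / (2 * w q2)"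
    have e: "e > 0" using less[OF q(1)] w_pos by (simp add: e_def)
    have "F q + e * w q < F p0" if "q \<in> frontier \<Omega>" for q
    proof -
      have "e * w q \<le> e * w q2" using q(4)[OF that] e by simp
      also have "\<dots> = (F p0 - F q1) / 2" using w_pos[of q2] by (simp add: e_def field_simps)
      also have "\<dots> < F p0 - F q1" using less[OF q(1)] by simp
      finally show ?thesis using q(2)[OF that] by linarith
    qed
    with e show ?thesis by (rule that)
  qed
  define \<Phi> where "\<Phi> = (\<lambda>p. F p + \<epsilon> * w p)"
  have "continuous_on (closure \<Omega>) \<Phi>" unfolding \<Phi>_def by (intro continuous_intros cont cont_w)
  then obtain p where p: "p \<in> closure \<Omega>" "\<And>q. q \<in> closure \<Omega> \<Longrightarrow> \<Phi> q \<le> \<Phi> p"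
    using continuous_attains_sup[OF compact_closure ne] by blast
  have gt: "\<Phi> p > F p0"
  proof -
    have "F p0 < \<Phi> p0" using \<epsilon>(1) w_pos by (simp add: \<Phi>_def)
    then show ?thesis using p(2)[OF p0(1)] by simp
  qed
  then have "p \<notin> frontier \<Omega>" using \<epsilon>(2)[of p] by (auto simp: \<Phi>_def)
  then have pO: "p \<in> \<Omega>" using p(1) open_domain by (simp add: frontier_def interior_open)
  define c where "c = chart_at M p"
  have c: "c \<in> charts M" "p \<in> fst c" using chart_at[OF pO] by (simp_all add: c_def)
  interpret P: harmonic_patch "dom c" "metric M c" "u \<circ> param c" by (rule harmonic_patch_dom[OF c(1)])
  have x: "snd c p \<in> dom c" by (rule in_dom[OF c(2) pO])
  have pp: "param c (snd c p) = p" by (rule param_chart[OF charts_are_charts[OF c(1)] c(2)])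
  define wc where "wc = (\<lambda>y. exp (\<alpha> * (u \<circ> param c) y))"
  have sF: "smooth_on (F \<circ> param c) (dom c)" by (rule smooth_funD[OF smooth c(1)])
  have sw: "smooth_on wc (dom c)"
    unfolding wc_def by (intro smooth_on_exp smooth_on_mult smooth_on_const P.open_S P.smooth_u)
  have \<Phi>c: "(F \<circ> param c) y + \<epsilon> * wc y = \<Phi> (param c y)" for y by (simp add: \<Phi>_def wc_def w_def)
  have "laplacian (metric M c) (\<lambda>y. (F \<circ> param c) y + \<epsilon> * wc y) (snd c p) \<le> 0"
  proof (rule P.laplacian_nonpos_at_max[OF x P.open_S order_refl])
    show "smooth_on (\<lambda>y. (F \<circ> param c) y + \<epsilon> * wc y) (dom c)"
      by (intro smooth_on_add smooth_on_mult smooth_on_const P.open_S sF sw)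
    show "(F \<circ> param c) y + \<epsilon> * wc y \<le> (F \<circ> param c) (snd c p) + \<epsilon> * wc (snd c p)" if "y \<in> dom c" for y
      unfolding \<Phi>c pp by (rule in_domE[OF that c(1)]) (use p(2) closure_subset in auto)
  qed
  then have le: "laplacian (metric M c) (F \<circ> param c) (snd c p) + \<epsilon> * (\<alpha>\<^sup>2 * norm2 c p * w p) \<le> 0"
    using P.laplacian_linear[OF sF sw x, of \<epsilon>] P.laplacian_exp[OF x, of \<alpha>, folded wc_def]
    by (simp add: pp w_def)
  have "\<epsilon> * w p * (\<alpha>\<^sup>2 * norm2 c p + C p) > 0"
    using \<alpha>[OF pO] \<epsilon>(1) w_pos by (simp add: c_def)
  then have "C p * \<Phi> p > 0"
    using sub[OF pO] le by (simp add: \<Phi>_def algebra_simps flip: c_def)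
  moreover have "C p * \<Phi> p \<le> 0"
    using sign C[OF pO] gt pO unfolding Sup by (auto intro: mult_nonpos_nonneg)
  ultimately show False by simp
qed

lemma laplacian_uminus:
  assumes "smooth_fun M \<Omega> F" "p \<in> \<Omega>"
  defines "c \<equiv> chart_at M p"
  shows "laplacian (metric M c) ((\<lambda>q. - F q) \<circ> param c) (snd c p) = - laplacian (metric M c) (F \<circ> param c) (snd c p)"
proof -
  have c: "c \<in> charts M" "p \<in> fst c" using chart_at[OF assms(2)] by (simp_all add: c_def)
  interpret P: harmonic_patch "dom c" "metric M c" "u \<circ> param c" by (rule harmonic_patch_dom[OF c(1)])
  \<comment> \<open>Negation is written as \<open>F - 2 F\<close> to match \<open>laplacian_linear\<close>.\<close>
  have "laplacian (metric M c) (\<lambda>y. (F \<circ> param c) y + (- 2) * (F \<circ> param c) y) (snd c p)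
    = laplacian (metric M c) (F \<circ> param c) (snd c p) + (- 2) * laplacian (metric M c) (F \<circ> param c) (snd c p)"
    by (rule P.laplacian_linear[OF smooth_funD[OF assms(1) c(1)] smooth_funD[OF assms(1) c(1)] in_dom[OF c(2) assms(2)]])
  moreover have "(\<lambda>y. (F \<circ> param c) y + (- 2) * (F \<circ> param c) y) = (\<lambda>q. - F q) \<circ> param c" by auto
  ultimately show ?thesis by simp
qed

lemma smooth_fun_uminus: "smooth_fun M \<Omega> F \<Longrightarrow> smooth_fun M \<Omega> (\<lambda>q. - F q)"
  unfolding smooth_fun_def dom_def[symmetric] using smooth_on_minus[OF open_dom] by (auto simp: comp_def)

text \<open>For \<open>K \<le> 0\<close> the maximum principle applies with \<open>C = 2 K\<close>. For \<open>K \<ge> 0\<close> and a nonpositive maximum,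
  \<open>K F \<le> 0\<close> can be dropped from the equation, which leaves a subharmonic \<open>F\<close> and \<open>C = 0\<close>.\<close>

lemma maximum_of_curvature_quotient:
  fixes F I :: "'a \<Rightarrow> real"
  assumes cont: "continuous_on (closure \<Omega>) F" and smooth: "smooth_fun M \<Omega> F"
    and eq: "\<And>p. p \<in> \<Omega> \<Longrightarrow>
      laplacian (metric M (chart_at M p)) (F \<circ> param (chart_at M p)) (snd (chart_at M p) p)
      + 2 * gauss_curvature M p * F p = I p / norm2 (chart_at M p) p"
    and I: "\<And>p. p \<in> \<Omega> \<Longrightarrow> I p \<ge> 0"
    and sign: "(\<forall>p\<in>\<Omega>. gauss_curvature M p \<le> 0) \<and> Sup (F ` closure \<Omega>) \<ge> 0
      \<or> (\<forall>p\<in>\<Omega>. gauss_curvature M p \<ge> 0) \<and> Sup (F ` closure \<Omega>) \<le> 0"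
  shows "max_attained_on F (closure \<Omega>) (frontier \<Omega>)"
proof -
  have rhs: "I p / norm2 (chart_at M p) p \<ge> 0" if "p \<in> \<Omega>" for p
    using I[OF that] norm2_pos[OF chart_at(1)[OF that] that chart_at(2)[OF that]] by simp
  from sign show ?thesis
  proof
    assume A: "(\<forall>p\<in>\<Omega>. gauss_curvature M p \<le> 0) \<and> Sup (F ` closure \<Omega>) \<ge> 0"
    obtain \<alpha> where "\<And>p. p \<in> \<Omega> \<Longrightarrow> \<alpha>\<^sup>2 * norm2 (chart_at M p) p + 2 * gauss_curvature M p > 0"
      using exists_barrier_exponent by blast
    then show ?thesis
      using A rhs eq by (intro maximum_principle[OF cont smooth, of "\<lambda>p. 2 * gauss_curvature M p" \<alpha>]) auto
  next
    assume A: "(\<forall>p\<in>\<Omega>. gauss_curvature M p \<ge> 0) \<and> Sup (F ` closure \<Omega>) \<le> 0"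
    have "bdd_above (F ` closure \<Omega>)"
      by (intro bounded_imp_bdd_above compact_imp_bounded compact_continuous_image cont compact_closure)
    then have "F p \<le> 0" if "p \<in> \<Omega>" for p
      using A that closure_subset by (metis cSup_upper imageI order_trans subsetD)
    then have "2 * gauss_curvature M p * F p \<le> 0" if "p \<in> \<Omega>" for p
      using A that by (simp add: mult_nonneg_nonpos)
    then have "laplacian (metric M (chart_at M p)) (F \<circ> param (chart_at M p)) (snd (chart_at M p) p) \<ge> 0"
      if "p \<in> \<Omega>" for p using eq[OF that] rhs[OF that] that by (smt (verit))
    then show ?thesis
      using norm2_pos chart_at by (intro maximum_principle[OF cont smooth, of "\<lambda>p. 0" 1]) auto
  qed
qed

lemma minimum_of_curvature_quotient:
  fixes F I :: "'a \<Rightarrow> real"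
  assumes cont: "continuous_on (closure \<Omega>) F" and smooth: "smooth_fun M \<Omega> F"
    and eq: "\<And>p. p \<in> \<Omega> \<Longrightarrow>
      laplacian (metric M (chart_at M p)) (F \<circ> param (chart_at M p)) (snd (chart_at M p) p)
      + 2 * gauss_curvature M p * F p = I p / norm2 (chart_at M p) p"
    and I: "\<And>p. p \<in> \<Omega> \<Longrightarrow> I p \<le> 0"
    and sign: "(\<forall>p\<in>\<Omega>. gauss_curvature M p \<le> 0) \<and> Inf (F ` closure \<Omega>) \<le> 0
      \<or> (\<forall>p\<in>\<Omega>. gauss_curvature M p \<ge> 0) \<and> Inf (F ` closure \<Omega>) \<ge> 0"
  shows "min_attained_on F (closure \<Omega>) (frontier \<Omega>)"
proof -
  have "Sup ((\<lambda>p. - F p) ` closure \<Omega>) = - Inf (F ` closure \<Omega>)"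
    by (simp add: Inf_real_def image_image)
  then have "max_attained_on (\<lambda>p. - F p) (closure \<Omega>) (frontier \<Omega>)"
    using sign I laplacian_uminus[OF smooth] eq
    by (intro maximum_of_curvature_quotient[where I = "\<lambda>p. - I p"] continuous_on_minus cont smooth_fun_uminus smooth)
       (auto simp flip: minus_divide_left eq)
  then show ?thesis
    by (simp add: max_attained_on_def min_attained_on_def is_arg_max_def is_arg_min_def)
qed

lemma curvature_quotient_extrema:
  fixes F I :: "'a \<Rightarrow> real"
  assumes "continuous_on (closure \<Omega>) F" "smooth_fun M \<Omega> F"
    and "\<And>p. p \<in> \<Omega> \<Longrightarrow>
      laplacian (metric M (chart_at M p)) (F \<circ> param (chart_at M p)) (snd (chart_at M p) p)
      + 2 * gauss_curvature M p * F p = I p / norm2 (chart_at M p) p"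
  shows "((\<forall>p\<in>\<Omega>. gauss_curvature M p \<le> 0) \<and> (\<forall>p\<in>\<Omega>. I p \<ge> 0) \<and> Sup (F ` closure \<Omega>) \<ge> 0
        \<longrightarrow> max_attained_on F (closure \<Omega>) (frontier \<Omega>)) \<and>
      ((\<forall>p\<in>\<Omega>. gauss_curvature M p \<le> 0) \<and> (\<forall>p\<in>\<Omega>. I p \<le> 0) \<and> Inf (F ` closure \<Omega>) \<le> 0
        \<longrightarrow> min_attained_on F (closure \<Omega>) (frontier \<Omega>)) \<and>
      ((\<forall>p\<in>\<Omega>. gauss_curvature M p \<ge> 0) \<and> (\<forall>p\<in>\<Omega>. I p \<ge> 0) \<and> Sup (F ` closure \<Omega>) \<le> 0
        \<longrightarrow> max_attained_on F (closure \<Omega>) (frontier \<Omega>)) \<and>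
      ((\<forall>p\<in>\<Omega>. gauss_curvature M p \<ge> 0) \<and> (\<forall>p\<in>\<Omega>. I p \<le> 0) \<and> Inf (F ` closure \<Omega>) \<ge> 0
        \<longrightarrow> min_attained_on F (closure \<Omega>) (frontier \<Omega>))"
  using maximum_of_curvature_quotient[OF assms] minimum_of_curvature_quotient[OF assms] by blast

lemma
  assumes k: "extends_to_closure \<Omega> f k"
  shows continuous_on_quotient: "continuous_on (closure \<Omega>) (\<lambda>p. inverse (vnorm M V p) * k p)"
    and quotient_interior: "p \<in> \<Omega> \<Longrightarrow> inverse (vnorm M V p) * k p = inverse (vnorm M (grad M u) p) * f p"
proof -
  show "continuous_on (closure \<Omega>) (\<lambda>p. inverse (vnorm M V p) * k p)"
    using k vnorm_V_pos
    by (intro continuous_on_mult continuous_on_inverse continuous_on_vnorm_V)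
       (force simp: extends_to_closure_def)+
  show "p \<in> \<Omega> \<Longrightarrow> inverse (vnorm M V p) * k p = inverse (vnorm M (grad M u) p) * f p"
    using k by (simp add: extends_to_closure_def vnorm_V_interior)
qed

text \<open>The quotient formed with the continuous extensions coincides with \<open>f\<close> only on \<open>\<Omega>\<close>; smoothness and
  the differential equation depend on nothing else.\<close>

lemma curvature_quotient_transfer:
  assumes eq: "\<And>p. p \<in> \<Omega> \<Longrightarrow> F p = f p" and smooth: "smooth_fun M \<Omega> f"
    and f: "\<And>p. p \<in> \<Omega> \<Longrightarrow> laplacian (metric M (chart_at M p)) (f \<circ> param (chart_at M p)) (snd (chart_at M p) p)
      + 2 * gauss_curvature M p * f p = I p / norm2 (chart_at M p) p"
  shows "smooth_fun M \<Omega> F"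
    and "p \<in> \<Omega> \<Longrightarrow> laplacian (metric M (chart_at M p)) (F \<circ> param (chart_at M p)) (snd (chart_at M p) p)
      + 2 * gauss_curvature M p * F p = I p / norm2 (chart_at M p) p"
proof -
  have c: "(F \<circ> param c) y = (f \<circ> param c) y" if "c \<in> charts M" "y \<in> dom c" for c y
    by (rule in_domE[OF that(2,1)]) (simp add: eq)
  show "smooth_fun M \<Omega> F"
    unfolding smooth_fun_def dom_def[symmetric]
    using smooth_on_cong[OF open_dom, of _ "F \<circ> param _" "f \<circ> param _"] c smooth_funD[OF smooth] by blast
  show "laplacian (metric M (chart_at M p)) (F \<circ> param (chart_at M p)) (snd (chart_at M p) p)
      + 2 * gauss_curvature M p * F p = I p / norm2 (chart_at M p) p" if p: "p \<in> \<Omega>"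
  proof -
    have "laplacian (metric M (chart_at M p)) (F \<circ> param (chart_at M p)) (snd (chart_at M p) p)
        = laplacian (metric M (chart_at M p)) (f \<circ> param (chart_at M p)) (snd (chart_at M p) p)"
      by (rule laplacian_cong[OF open_dom[OF chart_at(1)[OF p]] in_dom[OF chart_at(2)[OF p] p]
            c[OF chart_at(1)[OF p]]])
    then show ?thesis using f[OF p] by (simp only: eq[OF p])
  qed
qed

end

theorem corollary4p4:
  fixes M :: "'a::{t2_space, second_countable_topology} manifold2"
    and \<Omega> :: "'a set" and u :: "'a \<Rightarrow> real" and V :: "'a vfield"
  assumes "riemannian_2_manifold M"
    and "open \<Omega>" "connected \<Omega>" "\<Omega> \<noteq> {}"
    and "compact (closure \<Omega>)" "closure \<Omega> \<subseteq> carrier M"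
    and "harmonic_on M \<Omega> u"
    and "continuous_on (closure \<Omega>) u"
    and "grad_extends_to_closure M \<Omega> u V"
    and "nonvanishing_on M (closure \<Omega>) V"
  shows
    "(\<forall>k F. extends_to_closure \<Omega> (level_curvature M u) k \<and> F = (\<lambda>p. inverse (vnorm M V p) * k p) \<longrightarrow>
       ((\<forall>p\<in>\<Omega>. gauss_curvature M p \<le> 0) \<and>
        (\<forall>p\<in>\<Omega>. vinner M (grad M (gauss_curvature M)) (grad M u) p \<ge> 0) \<and>
        Sup (F ` closure \<Omega>) \<ge> 0 \<longrightarrow> max_attained_on F (closure \<Omega>) (frontier \<Omega>)) \<and>
       ((\<forall>p\<in>\<Omega>. gauss_curvature M p \<le> 0) \<and>
        (\<forall>p\<in>\<Omega>. vinner M (grad M (gauss_curvature M)) (grad M u) p \<le> 0) \<and>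
        Inf (F ` closure \<Omega>) \<le> 0 \<longrightarrow> min_attained_on F (closure \<Omega>) (frontier \<Omega>)) \<and>
       ((\<forall>p\<in>\<Omega>. gauss_curvature M p \<ge> 0) \<and>
        (\<forall>p\<in>\<Omega>. vinner M (grad M (gauss_curvature M)) (grad M u) p \<ge> 0) \<and>
        Sup (F ` closure \<Omega>) \<le> 0 \<longrightarrow> max_attained_on F (closure \<Omega>) (frontier \<Omega>)) \<and>
       ((\<forall>p\<in>\<Omega>. gauss_curvature M p \<ge> 0) \<and>
        (\<forall>p\<in>\<Omega>. vinner M (grad M (gauss_curvature M)) (grad M u) p \<le> 0) \<and>
        Inf (F ` closure \<Omega>) \<ge> 0 \<longrightarrow> min_attained_on F (closure \<Omega>) (frontier \<Omega>))) \<and>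
     (\<forall>h F. oriented_manifold M \<and> extends_to_closure \<Omega> (descent_curvature M u) h \<and>
         F = (\<lambda>p. inverse (vnorm M V p) * h p) \<longrightarrow>
       ((\<forall>p\<in>\<Omega>. gauss_curvature M p \<le> 0) \<and>
        (\<forall>p\<in>\<Omega>. vinner M (grad M (gauss_curvature M)) (neg_field (star M (grad M u))) p \<ge> 0) \<and>
        Sup (F ` closure \<Omega>) \<ge> 0 \<longrightarrow> max_attained_on F (closure \<Omega>) (frontier \<Omega>)) \<and>
       ((\<forall>p\<in>\<Omega>. gauss_curvature M p \<le> 0) \<and>
        (\<forall>p\<in>\<Omega>. vinner M (grad M (gauss_curvature M)) (neg_field (star M (grad M u))) p \<le> 0) \<and>
        Inf (F ` closure \<Omega>) \<le> 0 \<longrightarrow> min_attained_on F (closure \<Omega>) (frontier \<Omega>)) \<and>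
       ((\<forall>p\<in>\<Omega>. gauss_curvature M p \<ge> 0) \<and>
        (\<forall>p\<in>\<Omega>. vinner M (grad M (gauss_curvature M)) (neg_field (star M (grad M u))) p \<ge> 0) \<and>
        Sup (F ` closure \<Omega>) \<le> 0 \<longrightarrow> max_attained_on F (closure \<Omega>) (frontier \<Omega>)) \<and>
       ((\<forall>p\<in>\<Omega>. gauss_curvature M p \<ge> 0) \<and>
        (\<forall>p\<in>\<Omega>. vinner M (grad M (gauss_curvature M)) (neg_field (star M (grad M u))) p \<le> 0) \<and>
        Inf (F ` closure \<Omega>) \<ge> 0 \<longrightarrow> min_attained_on F (closure \<Omega>) (frontier \<Omega>)))"
proof -
  interpret harmonic_domain M \<Omega> u
  proof
    show "\<Omega> \<subseteq> carrier M" using assms(6) closure_subset by blast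
    show "grad M u c x \<noteq> 0" if "c \<in> charts M" "x \<in> snd c ` (fst c \<inter> \<Omega>)" for c x
    proof -
      have "V c x = grad M u c x" using assms(9) that unfolding grad_extends_to_closure_def by blast
      moreover have "V c x \<noteq> 0"
        using assms(10) that closure_subset[of \<Omega>] by (fastforce simp: nonvanishing_on_def)
      ultimately show ?thesis by simp
    qed
  qed (fact assms)+
  interpret harmonic_closure M \<Omega> u V
    by unfold_locales (fact assms)+
  show ?thesis
  proof (intro conjI[where Q = "All _"] allI impI, goal_cases)
    case (1 k F)
    then have F: "F = (\<lambda>p. inverse (vnorm M V p) * k p)" and k: "extends_to_closure \<Omega> (level_curvature M u) k"
      by simp_all
    have eq: "F p = level_quotient p" if "p \<in> \<Omega>" for p
      using quotient_interior[OF k that] by (simp add: F level_quotient_def)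
    show ?case
      by (rule curvature_quotient_extrema[OF continuous_on_quotient[OF k, folded F]
        curvature_quotient_transfer[OF eq smooth_level_quotient laplacian_level_quotient]])
  next
    case (2 h F)
    then have F: "F = (\<lambda>p. inverse (vnorm M V p) * h p)" and h: "extends_to_closure \<Omega> (descent_curvature M u) h"
      and or: "oriented_manifold M"
      by simp_all
    have eq: "F p = descent_quotient p" if "p \<in> \<Omega>" for p
      using quotient_interior[OF h that] by (simp add: F descent_quotient_def)
    show ?case
      by (rule curvature_quotient_extrema[OF continuous_on_quotient[OF h, folded F]
        curvature_quotient_transfer[OF eq smooth_descent_quotient[OF or] laplacian_descent_quotient[OF _ or]]])
  qed
qed

end
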